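(* Let $\nu\in[0,1)$. For $0<b<\infty$ let $A_{\nu,b}$ be the operator in $L^2(0,b)$ acting as $\tau_\nu=-\frac{d^2}{dx^2}+\frac{\nu^2-1/4}{x^2}$ on $\{f\in H^2[0,b]: f(0)=f'(0)=f(b)=0\}$, and let $A_{\nu,\infty}$ be the operator in $L^2(\mathbb R_+)$ acting as $\tau_\nu$ on $H_0^2(\mathbb R_+)$. For $A_{\nu,b}^*$ and $A_{\nu,\infty}^*$ respectively take the boundary triplets $\{\mathbb C,\Gamma_0,\Gamma_1\}$ with $\Gamma_0f=[f,x^{1/2+\nu}]_0$ and $\Gamma_1f=-(2\nu)^{-1}[f,x^{1/2-\nu}]_0$ if $\nu\in(0,1)$, $\Gamma_1f=[f,x^{1/2}\log(x)]_0$ if $\nu=0$, and let $$M_{\nu,b}(z)=\begin{cases}-\dfrac{\Gamma(1-\nu)}{2\nu4^\nu\Gamma(1+\nu)}\cdot\dfrac{J_{-\nu}(b\sqrt z)}{J_\nu(b\sqrt z)}\cdot z^\nu, & \nu\in(0,1),\\[2mm] -\log\left(\dfrac{\sqrt z}2\right)+\dfrac\pi2\,\dfrac{Y_0(b\sqrt z)}{J_0(b\sqrt z)}-\gamma, & \nu=0,\end{cases}\qquad M_{\nu;\infty}(z)=\begin{cases}e^{i(1-\nu)\pi}\dfrac{\Gamma(1-\nu)}{2\nu4^\nu\Gamma(1+\nu)}\,z^\nu, & \nu\in(0,1),\\[2mm] -\log\left(\dfrac{\sqrt z}2\right)+\dfrac{i\pi}2-\gamma, & \nu=0,\end{cases}$$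 be the corresponding Weyl functions, where $\gamma$ is Euler's constant. Then $$\lim_{b\to+\infty}M_{\nu,b}(z)=M_{\nu;\infty}(z)$$ uniformly on compact subsets of $\mathbb C_+$.
   Context: $\mathbb R_+=(0,\infty)$, $\mathbb C_+$ is the open upper half-plane, $H_0^2(\mathbb R_+)=\{f\in H^2(\mathbb R_+): f(0)=f'(0)=0\}$. $[f,g]_x=f(x)\overline{g'(x)}-f'(x)\overline{g(x)}$ and $[f,g]_0=\lim_{x\to0^+}[f,g]_x$. $J_{\pm\nu}$, $Y_0$ are the Bessel functions of the first and second kind; $\Gamma(\cdot)$ with a numerical argument is the Gamma function. The branch of $z^\nu$ (and of $\sqrt z$) is taken in $\mathbb C$ cut along $\mathbb R_+$ with $\arg z\in[0,2\pi)$; $\log$ in $\log(\sqrt z/2)$ is the principal branch. Boundary triplet: $\{\mathcal H,\Gamma_0,\Gamma_1\}$ is a boundary triplet for $A^*$ ($A$ a densely defined closed symmetric operator) if $\mathcal H$ is a Hilbert space, $\Gamma_0,\Gamma_1:\operatorname{dom}(A^* )\to\mathcal H$ are linear, $(A^*f,g)-(f,A^*g)=(\Gamma_1f,\Gamma_0g)_{\mathcal H}-(\Gamma_0f,\Gamma_1g)_{\mathcal H}$ for all $f,g\in\operatorname{dom}(A^* )$, and $f\mapsto(\Gamma_0f,\Gamma_1f)$ is surjective onto $\mathcal H\oplus\mathcal H$; its Weyl function is $M(z)=\Gamma_1(\Gamma_0\upharpoonright\ker(A^*-z))^{-1}$ for $z\in\rho(A^*\upharpoonright\ker\Gamma_0)$.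 *)

theory Defs
  imports "HOL-Analysis.Analysis"
begin

section \<open>The space $L^2(I)$ and operators in it\<close>

text \<open>
  The elements of $L^2(I)$ are represented by functions, which are identified when they agree
  almost everywhere on \<open>I\<close>. Operators are given by their graphs, sets of pairs of functions.
\<close>

definition L2_space :: "real set \<Rightarrow> (real \<Rightarrow> complex) set" where
  "L2_space I = {f. f \<in> borel_measurable (lebesgue_on I) \<and>
                    integrable (lebesgue_on I) (\<lambda>x. (cmod (f x))\<^sup>2)}"

definition L2_inner :: "real set \<Rightarrow> (real \<Rightarrow> complex) \<Rightarrow> (real \<Rightarrow> complex) \<Rightarrow> complex" where
  "L2_inner I f g = integral\<^sup>L (lebesgue_on I) (\<lambda>x. f x * cnj (g x))"

definition L2_norm :: "real set \<Rightarrow> (real \<Rightarrow> complex) \<Rightarrow> real" where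
  "L2_norm I f = sqrt (integral\<^sup>L (lebesgue_on I) (\<lambda>x. (cmod (f x))\<^sup>2))"

definition ae_eq :: "real set \<Rightarrow> (real \<Rightarrow> complex) \<Rightarrow> (real \<Rightarrow> complex) \<Rightarrow> bool" where
  "ae_eq I f g \<longleftrightarrow> (AE x in lebesgue_on I. f x = g x)"

type_synonym L2_graph = "((real \<Rightarrow> complex) \<times> (real \<Rightarrow> complex)) set"

text \<open>The last two conditions say that the graph depends only on the almost-everywhere classes
  and that it is single-valued on them.\<close>

definition linear_operator :: "real set \<Rightarrow> L2_graph \<Rightarrow> bool" where
  "linear_operator I A \<longleftrightarrow>
     A \<subseteq> L2_space I \<times> L2_space I \<and> A \<noteq> {} \<and>
     (\<forall>f h g k a c. (f, h) \<in> A \<and> (g, k) \<in> A \<longrightarrow>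
        (\<lambda>x. a * f x + c * g x, \<lambda>x. a * h x + c * k x) \<in> A) \<and>
     (\<forall>f h g k. (f, h) \<in> A \<and> g \<in> L2_space I \<and> k \<in> L2_space I \<and>
        ae_eq I f g \<and> ae_eq I h k \<longrightarrow> (g, k) \<in> A) \<and>
     (\<forall>f h g k. (f, h) \<in> A \<and> (g, k) \<in> A \<and> ae_eq I f g \<longrightarrow> ae_eq I h k)"

definition densely_defined :: "real set \<Rightarrow> L2_graph \<Rightarrow> bool" where
  "densely_defined I A \<longleftrightarrow>
     (\<forall>g\<in>L2_space I. \<forall>e>0. \<exists>f\<in>Domain A. L2_norm I (\<lambda>x. f x - g x) < e)"

definition closed_operator :: "real set \<Rightarrow> L2_graph \<Rightarrow> bool" where
  "closed_operator I A \<longleftrightarrow>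
     (\<forall>F H f h. (\<forall>n::nat. (F n, H n) \<in> A) \<and> f \<in> L2_space I \<and> h \<in> L2_space I \<and>
        (\<lambda>n. L2_norm I (\<lambda>x. F n x - f x)) \<longlonglongrightarrow> 0 \<and>
        (\<lambda>n. L2_norm I (\<lambda>x. H n x - h x)) \<longlonglongrightarrow> 0 \<longrightarrow> (f, h) \<in> A)"

definition symmetric_operator :: "real set \<Rightarrow> L2_graph \<Rightarrow> bool" where
  "symmetric_operator I A \<longleftrightarrow>
     (\<forall>(f, h)\<in>A. \<forall>(g, k)\<in>A. L2_inner I h g = L2_inner I f k)"

definition adjoint_graph :: "real set \<Rightarrow> L2_graph \<Rightarrow> L2_graph" where
  "adjoint_graph I A = {(g, k). g \<in> L2_space I \<and> k \<in> L2_space I \<and>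
     (\<forall>(f, h)\<in>A. L2_inner I h g = L2_inner I f k)}"


section \<open>Boundary triplets and Weyl functions\<close>

text \<open>
  Boundary triplets with boundary space $\mathcal H = \mathbb C$, so that
  $(u, v)_{\mathcal H} = u \overline v$. That \<open>G0\<close> and \<open>G1\<close> do not distinguish functions which
  agree almost everywhere follows from Green's identity and surjectivity.
\<close>

definition boundary_triplet ::
  "real set \<Rightarrow> L2_graph \<Rightarrow> ((real \<Rightarrow> complex) \<Rightarrow> complex) \<Rightarrow> ((real \<Rightarrow> complex) \<Rightarrow> complex) \<Rightarrow> bool"
where
  "boundary_triplet I A G0 G1 \<longleftrightarrow>
     linear_operator I A \<and> densely_defined I A \<and> closed_operator I A \<and> symmetric_operator I A \<and>
     (\<forall>f\<in>Domain (adjoint_graph I A). \<forall>g\<in>Domain (adjoint_graph I A). \<forall>a c.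
        G0 (\<lambda>x. a * f x + c * g x) = a * G0 f + c * G0 g \<and>
        G1 (\<lambda>x. a * f x + c * g x) = a * G1 f + c * G1 g) \<and>
     (\<forall>(f, h)\<in>adjoint_graph I A. \<forall>(g, k)\<in>adjoint_graph I A.
        L2_inner I h g - L2_inner I f k = G1 f * cnj (G0 g) - G0 f * cnj (G1 g)) \<and>
     (\<forall>a c. \<exists>f\<in>Domain (adjoint_graph I A). G0 f = a \<and> G1 f = c)"

definition defect_space :: "real set \<Rightarrow> L2_graph \<Rightarrow> complex \<Rightarrow> (real \<Rightarrow> complex) set" where
  "defect_space I A z = {f. (f, \<lambda>x. z * f x) \<in> adjoint_graph I A}"

text \<open>
  The operator $\Gamma_1 (\Gamma_0 \upharpoonright \ker (A^* - z))^{-1}$ on $\mathbb C$, identified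
  with the number by which it multiplies, i.e. its value at 1. It is meaningful for \<open>z\<close> in the
  resolvent set of $A^* \upharpoonright \ker \Gamma_0$, where $\Gamma_0$ is bijective on the
  kernel up to equality almost everywhere. As $A^* \upharpoonright \ker \Gamma_0$ is
  self-adjoint, this includes every nonreal \<open>z\<close>.
\<close>

definition weyl_function ::
  "real set \<Rightarrow> L2_graph \<Rightarrow> ((real \<Rightarrow> complex) \<Rightarrow> complex) \<Rightarrow> ((real \<Rightarrow> complex) \<Rightarrow> complex)
     \<Rightarrow> complex \<Rightarrow> complex"
where
  "weyl_function I A G0 G1 z = G1 (inv_into (defect_space I A z) G0 1)"


section \<open>The Bessel operators and their boundary maps\<close>

text \<open>\<open>u \<in> H\<^sup>2(I)\<close>, in its continuously differentiable version on the closure of \<open>I\<close>, with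
  derivatives \<open>u1\<close> and \<open>u2\<close>; the last condition says that \<open>u1\<close> is absolutely continuous
  with derivative \<open>u2\<close>.\<close>

definition H2_function ::
  "real set \<Rightarrow> (real \<Rightarrow> complex) \<Rightarrow> (real \<Rightarrow> complex) \<Rightarrow> (real \<Rightarrow> complex) \<Rightarrow> bool"
where
  "H2_function I u u1 u2 \<longleftrightarrow>
     u \<in> L2_space I \<and> u1 \<in> L2_space I \<and> u2 \<in> L2_space I \<and>
     (\<forall>x\<in>closure I. (u has_vector_derivative u1 x) (at x within closure I)) \<and>
     (\<forall>x\<in>closure I. \<forall>y\<in>closure I. x \<le> y \<longrightarrow> (u2 has_integral (u1 y - u1 x)) {x..y})"

text \<open>\<open>E\<close> is the set of further points at which a Dirichlet condition is imposed.\<close>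

definition bessel_operator :: "real \<Rightarrow> real set \<Rightarrow> real set \<Rightarrow> L2_graph" where
  "bessel_operator \<nu> I E = {(f, h). f \<in> L2_space I \<and> h \<in> L2_space I \<and>
     (\<exists>u u1 u2. H2_function I u u1 u2 \<and> u 0 = 0 \<and> u1 0 = 0 \<and> (\<forall>x\<in>E. u x = 0) \<and>
        ae_eq I f u \<and>
        ae_eq I h (\<lambda>x. - u2 x + complex_of_real ((\<nu>\<^sup>2 - 1/4) / x\<^sup>2) * u x))}"

definition bessel_operator_fin :: "real \<Rightarrow> real \<Rightarrow> L2_graph" where
  "bessel_operator_fin \<nu> b = bessel_operator \<nu> {0<..<b} {b}"

definition bessel_operator_inf :: "real \<Rightarrow> L2_graph" where
  "bessel_operator_inf \<nu> = bessel_operator \<nu> {0<..} {}"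

definition bracket :: "(real \<Rightarrow> complex) \<Rightarrow> (real \<Rightarrow> complex) \<Rightarrow> real \<Rightarrow> complex" where
  "bracket f g x = f x * cnj (vector_derivative g (at x)) - vector_derivative f (at x) * cnj (g x)"

text \<open>The limit $[f, g]_0$, where an element \<open>f\<close> of $L^2(I)$ is replaced by its continuously
  differentiable version on \<open>I\<close>, which is unique if it exists.\<close>

definition bracket0 :: "real set \<Rightarrow> (real \<Rightarrow> complex) \<Rightarrow> (real \<Rightarrow> complex) \<Rightarrow> complex" where
  "bracket0 I f g = (THE c. \<exists>u. ae_eq I f u \<and> u C1_differentiable_on I \<and>
                              (bracket u g \<longlongrightarrow> c) (at_right 0))"

definition Gamma_0 :: "real \<Rightarrow> real set \<Rightarrow> (real \<Rightarrow> complex) \<Rightarrow> complex" where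
  "Gamma_0 \<nu> I f = bracket0 I f (\<lambda>x. complex_of_real (x powr (1/2 + \<nu>)))"

definition Gamma_1 :: "real \<Rightarrow> real set \<Rightarrow> (real \<Rightarrow> complex) \<Rightarrow> complex" where
  "Gamma_1 \<nu> I f =
     (if \<nu> = 0 then bracket0 I f (\<lambda>x. complex_of_real (x powr (1/2) * ln x))
      else - (1 / complex_of_real (2 * \<nu>)) *
             bracket0 I f (\<lambda>x. complex_of_real (x powr (1/2 - \<nu>))))"


section \<open>Bessel functions and the explicit Weyl functions\<close>

text \<open>The power $(z/2)^\nu$ is the principal one. The case distinction is needed
  because \<open>0 powr 0 = 0\<close>.\<close>

definition bessel_J :: "real \<Rightarrow> complex \<Rightarrow> complex" where
  "bessel_J \<nu> z =
     (if \<nu> = 0 then 1 else (z / 2) powr complex_of_real \<nu>) *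
     (\<Sum>k. (-1) ^ k * rGamma (of_nat k + complex_of_real \<nu> + 1) / fact k * (z / 2) ^ (2 * k))"

text \<open>The ascending series of $Y_0$, with the principal logarithm; \<open>harm k\<close> is the harmonic
  number $1 + 1/2 + \dots + 1/k$.\<close>

definition bessel_Y0 :: "complex \<Rightarrow> complex" where
  "bessel_Y0 z =
     2 / complex_of_real pi *
     ((Ln (z / 2) + euler_mascheroni) * bessel_J 0 z
      - (\<Sum>k. (-1) ^ k * harm k / (fact k)\<^sup>2 * (z / 2) ^ (2 * k)))"

text \<open>The branch of $z^s$ in the plane cut along the positive half-line:
  \<open>Arg2pi\<close> takes values in $[0, 2\pi)$.\<close>

definition cut_powr :: "complex \<Rightarrow> real \<Rightarrow> complex" where
  "cut_powr z s = complex_of_real (cmod z powr s) * cis (s * Arg2pi z)"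

definition cut_sqrt :: "complex \<Rightarrow> complex" where
  "cut_sqrt z = cut_powr z (1/2)"

definition M_fin :: "real \<Rightarrow> real \<Rightarrow> complex \<Rightarrow> complex" where
  "M_fin \<nu> b z =
     (if \<nu> = 0 then
        - Ln (cut_sqrt z / 2)
        + complex_of_real (pi / 2) *
            (bessel_Y0 (of_real b * cut_sqrt z) / bessel_J 0 (of_real b * cut_sqrt z))
        - euler_mascheroni
      else
        - complex_of_real (Gamma (1 - \<nu>) / (2 * \<nu> * 4 powr \<nu> * Gamma (1 + \<nu>))) *
          (bessel_J (- \<nu>) (of_real b * cut_sqrt z) / bessel_J \<nu> (of_real b * cut_sqrt z)) *
          cut_powr z \<nu>)"

definition M_inf :: "real \<Rightarrow> complex \<Rightarrow> complex" where
  "M_inf \<nu> z =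
     (if \<nu> = 0 then
        - Ln (cut_sqrt z / 2) + \<i> * complex_of_real (pi / 2) - euler_mascheroni
      else
        exp (\<i> * complex_of_real ((1 - \<nu>) * pi)) *
        complex_of_real (Gamma (1 - \<nu>) / (2 * \<nu> * 4 powr \<nu> * Gamma (1 + \<nu>))) *
        cut_powr z \<nu>)"

end

theory Submission
  imports Defs "HOL-Complex_Analysis.Complex_Analysis" "HOL-Real_Asymp.Real_Asymp"
begin

text \<open>
  Writing \<open>f x = sqrt x * p x\<close> turns \<open>\<tau> f = z f\<close> into Bessel's equation
  \<open>x (x p')' = (\<nu>\<^sup>2 - z x\<^sup>2) p\<close>. It has the solution \<open>frobenius \<nu> z\<close>, which is \<open>x powr \<nu>\<close>
  near 0, and a second solution \<open>singular \<nu> z\<close>, normalised such that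
  \<open>sqrt x * (singular \<nu> z x + m * frobenius \<nu> z x)\<close> has the boundary values \<open>\<Gamma>\<^sub>0 = 1\<close> and
  \<open>\<Gamma>\<^sub>1 = m\<close> (\<open>Gamma_0_weyl_sol\<close>, \<open>Gamma_1_weyl_sol\<close>). The Weyl function at \<open>z\<close> is therefore the
  number \<open>m\<close> for which this function lies in the kernel of \<open>A\<^sup>* - z\<close>. On \<open>(0, b)\<close> this means that it
  vanishes at \<open>b\<close>, and so \<open>m\<close> is the quotient \<open>weyl_quot \<nu> b z\<close> of the two solutions at \<open>b\<close>;
  inserting the power series gives the stated formula. On the half-line it means square
  integrability at infinity. That the choice of an element of the kernel with \<open>\<Gamma>\<^sub>0 = 1\<close> does not
  matter is a consequence of Green's identity (\<open>weyl_function_eqI\<close>); about \<open>A\<^sup>*\<close> itself it remains to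
  show that these explicit functions lie in its domain (\<open>liouville_in_defect_space\<close>).

  Convergence as \<open>b\<close> tends to infinity follows from an energy argument. Let \<open>s\<^sup>2 = - z\<close> with
  \<open>Re s > 0\<close>, which is possible off the positive half-line. Along a solution, the quantity
  \<open>Q = Re (cnj s * (x p') * cnj p)\<close> satisfies \<open>Q' \<ge> 2 * Re s * \<bar>Q\<bar>\<close>. For \<open>frobenius \<nu> z\<close> it starts
  from 0, so it is positive and grows exponentially; for a solution that vanishes at \<open>b\<close> it is
  nonpositive on \<open>(0, b]\<close>. As these signs are opposite, the constancy of the Wronskian yields
  \<open>\<bar>M\<^sub>b\<^sub>' - M\<^sub>b\<bar> \<le> \<bar>s\<bar> / Q(b)\<close> for \<open>b \<le> b'\<close> (\<open>weyl_quot_diff\<close>). Hence the quotients converge,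
  uniformly on compact subsets of the plane cut along the positive half-line. The energy of
  the limiting solution is still nonpositive, and since it increases, its derivative is integrable;
  this makes the limiting solution square integrable, so that the limit is the
  Weyl function of the half-line.

  It remains to evaluate the limit. The solutions depend on \<open>z\<close> essentially through \<open>z x\<^sup>2\<close>, so
  rescaling \<open>x\<close> shows that the limit is homogeneous: \<open>M(t\<^sup>2 z) = t powr (2 * \<nu>) * M(z)\<close>, and
  \<open>M(t\<^sup>2 z) = M(z) - ln t\<close> for \<open>\<nu> = 0\<close>. Being holomorphic in the cut plane, it is determined by its
  value at \<open>- 1\<close> (\<open>weyl_limit_closed_form\<close>). There all series have positive terms, and comparing
  them term by term, together with the first moment of the terms, gives the
  constants (\<open>weyl_limit_minus_one\<close>).
\<close>

section \<open>Everywhere convergent power series\<close>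

definition entire_coeffs :: "(nat \<Rightarrow> complex) \<Rightarrow> bool" where
  "entire_coeffs c \<longleftrightarrow> (\<forall>y. summable (\<lambda>k. c k * y ^ k))"

definition entire_series :: "(nat \<Rightarrow> complex) \<Rightarrow> complex \<Rightarrow> complex" where
  "entire_series c \<zeta> = (\<Sum>k. c k * \<zeta> ^ k)"

text \<open>
  The coefficients of \<open>\<zeta> * d/d\<zeta>\<close> of the series. This derivation preserves degrees, so that Bessel's
  equation becomes a recursion between two consecutive coefficients.
\<close>

definition euler_op :: "(nat \<Rightarrow> complex) \<Rightarrow> nat \<Rightarrow> complex" where
  "euler_op c k = of_nat k * c k"

lemma entire_series_sums:
  "entire_coeffs c \<Longrightarrow> (\<lambda>k. c k * \<zeta> ^ k) sums entire_series c \<zeta>"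
  by (simp add: entire_coeffs_def entire_series_def summable_sums)

lemma entire_series_0 [simp]: "entire_series c 0 = c 0"
  unfolding entire_series_def by (subst powser_zero) simp

lemma entire_series_deriv:
  assumes "entire_coeffs c"
  shows "(entire_series c has_field_derivative (\<Sum>k. diffs c k * \<zeta> ^ k)) (at \<zeta>)"
proof -
  have "((\<lambda>x. \<Sum>n. c n * x^n) has_field_derivative (\<Sum>n. diffs c n * \<zeta>^n)) (at \<zeta>)"
    by (rule termdiffs_strong_converges_everywhere) (use assms in \<open>simp add: entire_coeffs_def\<close>)
  moreover have "(\<lambda>x. \<Sum>n. c n * x^n) = entire_series c" by (simp add: entire_series_def fun_eq_iff)
  ultimately show ?thesis by simp
qed

lemma euler_op_sums:
  assumes "entire_coeffs c"
  shows "(\<lambda>k. euler_op c k * \<zeta> ^ k) sums (\<zeta> * (\<Sum>k. diffs c k * \<zeta> ^ k))"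
proof -
  have "summable (\<lambda>k. diffs c k * \<zeta> ^ k)"
    by (rule termdiff_converges_all) (use assms in \<open>simp add: entire_coeffs_def\<close>)
  then have "(\<lambda>k. \<zeta> * (diffs c k * \<zeta> ^ k)) sums (\<zeta> * (\<Sum>k. diffs c k * \<zeta> ^ k))"
    by (intro sums_mult summable_sums)
  moreover have "(\<lambda>k. \<zeta> * (diffs c k * \<zeta> ^ k)) = (\<lambda>k. euler_op c (Suc k) * \<zeta> ^ Suc k)"
    by (simp add: fun_eq_iff euler_op_def diffs_def)
  ultimately have "(\<lambda>k. euler_op c (Suc k) * \<zeta> ^ Suc k) sums (\<zeta> * (\<Sum>k. diffs c k * \<zeta> ^ k))"
    by simp
  from this[THEN sums_Suc_iff[THEN iffD1]] show ?thesis by (simp add: euler_op_def)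
qed

lemma entire_coeffs_euler_op:
  "entire_coeffs c \<Longrightarrow> entire_coeffs (euler_op c)"
  using euler_op_sums[THEN sums_summable] unfolding entire_coeffs_def by blast

lemma entire_series_euler_op:
  "entire_coeffs c \<Longrightarrow> entire_series (euler_op c) \<zeta> = \<zeta> * (\<Sum>k. diffs c k * \<zeta> ^ k)"
  unfolding entire_series_def[of "euler_op c"] by (rule sums_unique[symmetric, OF euler_op_sums])

lemma entire_series_holomorphic:
  assumes "entire_coeffs c"
  shows "entire_series c holomorphic_on S"
  using entire_series_deriv[OF assms]
  by (meson field_differentiable_at_within field_differentiable_def holomorphic_onI)

lemma entire_series_holomorphic' [holomorphic_intros]:
  assumes "entire_coeffs c" "f holomorphic_on S"
  shows "(\<lambda>z. entire_series c (f z)) holomorphic_on S"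
  using holomorphic_on_compose[OF assms(2) entire_series_holomorphic[OF assms(1)]]
  by (simp add: o_def)

lemma isCont_entire_series: "entire_coeffs c \<Longrightarrow> isCont (entire_series c) \<zeta>"
  using entire_series_deriv DERIV_isCont by blast

text \<open>Along \<open>\<zeta> = z x\<^sup>2\<close> one has \<open>x d/dx = 2 \<zeta> d/d\<zeta>\<close>.\<close>

lemma entire_series_square_deriv:
  fixes x :: real
  assumes c: "entire_coeffs c" and "x > 0"
  shows "((\<lambda>x. entire_series c (z * of_real (x\<^sup>2))) has_vector_derivative
          2 * entire_series (euler_op c) (z * of_real (x\<^sup>2)) / of_real x) (at x)"
proof -
  let ?D = "\<Sum>k. diffs c k * (z * of_real (x\<^sup>2)) ^ k"
  have "((\<lambda>x. z * complex_of_real (x\<^sup>2)) has_vector_derivative (z * of_real (2 * x))) (at x)"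
  proof -
    have "((\<lambda>x. x\<^sup>2) has_vector_derivative (2 * x)) (at x)"
      by (auto intro!: derivative_eq_intros simp: has_real_derivative_iff_has_vector_derivative[symmetric])
    then show ?thesis
      by (intro has_vector_derivative_mult_right has_vector_derivative_of_real)
         (simp add: has_real_derivative_iff_has_vector_derivative)
  qed
  from field_vector_diff_chain_at[OF this entire_series_deriv[OF c]]
  have "((entire_series c \<circ> (\<lambda>x. z * complex_of_real (x\<^sup>2))) has_vector_derivative
         (z * of_real (2 * x)) * ?D) (at x)" .
  moreover have "(z * of_real (2 * x)) * ?D =
      2 * entire_series (euler_op c) (z * of_real (x\<^sup>2)) / of_real x"
    using \<open>x > 0\<close> by (simp add: entire_series_euler_op[OF c] power2_eq_square field_simps)
  ultimately show ?thesis by (simp add: o_def)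
qed

lemma entire_series_square_tendsto:
  assumes "entire_coeffs c"
  shows "((\<lambda>x. entire_series c (z * of_real (x\<^sup>2))) \<longlongrightarrow> c 0) (at_right 0)"
proof -
  have "((\<lambda>x. z * complex_of_real (x\<^sup>2)) \<longlongrightarrow> z * of_real (0\<^sup>2)) (at_right 0)"
    by (intro tendsto_intros)
  then have "((\<lambda>x. entire_series c (z * of_real (x\<^sup>2))) \<longlongrightarrow> entire_series c (z * of_real (0\<^sup>2))) (at_right 0)"
    by (rule isCont_tendsto_compose[OF isCont_entire_series[OF assms]])
  then show ?thesis by simp
qed

section \<open>The entire factors of the Bessel functions\<close>

text \<open>
  The series with these coefficients is \<open>0F1(1 + \<mu>; - \<zeta> / 4)\<close>. Up to a constant, \<open>J\<^sub>\<mu>(w)\<close> is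
  \<open>(w / 2) powr \<mu>\<close> times its value at \<open>w\<^sup>2\<close>. As it is entire, the branches of the powers enter only
  when the explicit Weyl functions are compared with it.
\<close>

definition bessel_coeff :: "real \<Rightarrow> nat \<Rightarrow> complex" where
  "bessel_coeff \<mu> k = of_real ((-1) ^ k / (4 ^ k * fact k * pochhammer (1 + \<mu>) k))"

definition bessel_log_coeff :: "nat \<Rightarrow> complex" where
  "bessel_log_coeff k = of_real (harm k) * bessel_coeff 0 k"

lemma bessel_coeff_0 [simp]: "bessel_coeff \<mu> 0 = 1" "bessel_log_coeff 0 = 0"
  by (simp_all add: bessel_coeff_def bessel_log_coeff_def harm_def)

lemma bessel_coeff_Suc:
  assumes "\<mu> > -1"
  shows "4 * of_nat (Suc k) * (of_nat (Suc k) + of_real \<mu>) * bessel_coeff \<mu> (Suc k) = - bessel_coeff \<mu> k"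
proof -
  have [simp]: "pochhammer (1 + \<mu>) k \<noteq> 0"
    using assms pochhammer_pos[of "1+\<mu>" k] by simp
  have ne: "1 + \<mu> + real k \<noteq> 0" using assms by linarith
  have eq: "4 * real (Suc k) * (real (Suc k) + \<mu>) * ((-1) ^ Suc k / (4 ^ Suc k * fact (Suc k) * pochhammer (1 + \<mu>) (Suc k)))
      = - ((-1) ^ k / (4 ^ k * fact k * pochhammer (1 + \<mu>) k))"
  proof -
    have "fact (Suc k) = real (Suc k) * fact k" by simp
    moreover have "pochhammer (1 + \<mu>) (Suc k) = pochhammer (1 + \<mu>) k * (1 + \<mu> + real k)"
      by (simp add: pochhammer_Suc)
    moreover have "real (Suc k) + \<mu> = 1 + \<mu> + real k" by simp
    moreover have "4 * K * L * (- s / (4 * q * (K * f) * (P * L))) = - (s / (q * f * P))"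
      if "K \<noteq> 0" "L \<noteq> 0" for K L s q f P :: real
      using that by simp
    from this[of "real (Suc k)" "1 + \<mu> + real k"]
    have "4 * real (Suc k) * (1 + \<mu> + real k) * (- ((-1) ^ k) / (4 * 4 ^ k * (real (Suc k) * fact k) * (pochhammer (1 + \<mu>) k * (1 + \<mu> + real k))))
      = - ((-1) ^ k / (4 ^ k * fact k * pochhammer (1 + \<mu>) k))" using ne by (simp del: of_nat_Suc)
    ultimately show ?thesis by (simp only: power_Suc mult_minus1)
  qed
  show ?thesis
    unfolding bessel_coeff_def using arg_cong[OF eq, of complex_of_real]
    by (simp only: of_real_mult of_real_add of_real_minus of_real_of_nat_eq of_real_numeral)
qed

lemma entire_coeffs_bessel:
  assumes "\<mu> > -1"
  shows "entire_coeffs (bessel_coeff \<mu>)"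
  unfolding entire_coeffs_def
proof
  fix y :: complex
  obtain N :: nat where N: "real N \<ge> cmod y + \<bar>\<mu>\<bar>" using real_arch_simple by blast
  show "summable (\<lambda>k. bessel_coeff \<mu> k * y ^ k)"
  proof (rule summable_ratio_test[of "1/2" N])
    fix n assume "N \<le> n"
    then have n: "real n \<ge> cmod y + \<bar>\<mu>\<bar>" using N by linarith
    let ?a = "norm (bessel_coeff \<mu> n)" and ?b = "norm (bessel_coeff \<mu> (Suc n))"
    have "norm (4 * of_nat (Suc n) * (of_nat (Suc n) + complex_of_real \<mu>) * bessel_coeff \<mu> (Suc n)) = ?a"
      by (simp only: bessel_coeff_Suc[OF assms] norm_minus_cancel)
    moreover have "norm (of_nat (Suc n) + complex_of_real \<mu>) = real (Suc n) + \<mu>"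
    proof -
      have "of_nat (Suc n) + complex_of_real \<mu> = of_real (real (Suc n) + \<mu>)" by simp
      then show ?thesis using assms by (simp only: norm_of_real)
    qed
    ultimately have eq: "4 * real (Suc n) * (real (Suc n) + \<mu>) * ?b = ?a"
      by (simp add: norm_mult del: of_nat_Suc)
    have "2 * cmod y \<le> 4 * real (Suc n) * (real (Suc n) + \<mu>)"
    proof -
      have "cmod y \<le> real (Suc n) + \<mu>" using n by linarith
      moreover have "1 * (real (Suc n) + \<mu>) \<le> real (Suc n) * (real (Suc n) + \<mu>)"
        using assms by (intro mult_right_mono) auto
      moreover have "0 \<le> cmod y" by simp
      moreover have "2 * c \<le> 4 * B" if "c \<le> A" "1 * A \<le> B" "0 \<le> c" for A B c :: real
        using that by linarith
      ultimately show ?thesis unfolding mult.assoc by blast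
    qed
    then have "2 * cmod y * ?b \<le> ?a" unfolding eq[symmetric] by (intro mult_right_mono) auto
    then have "cmod y * ?b \<le> 1/2 * ?a" by simp
    then have "cmod y * ?b * cmod y ^ n \<le> 1/2 * ?a * cmod y ^ n" by (intro mult_right_mono) auto
    then show "norm (bessel_coeff \<mu> (Suc n) * y ^ Suc n) \<le> 1/2 * norm (bessel_coeff \<mu> n * y ^ n)"
      by (simp add: norm_mult norm_power mult_ac)
  qed simp
qed

text \<open>
  Because of \<open>harm k \<le> 2 ^ k\<close>, the harmonic numbers are absorbed by doubling the argument in the
  absolutely convergent series for \<open>\<mu> = 0\<close>.
\<close>

lemma entire_coeffs_bessel_log: "entire_coeffs bessel_log_coeff"
  unfolding entire_coeffs_def
proof
  fix y :: complex
  have harm_le: "harm k \<le> (2 :: real) ^ k" for k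
  proof -
    have "harm k \<le> real (\<Sum>i\<in>{1..k}. 1)"
      unfolding harm_def of_nat_sum by (intro sum_mono) (auto simp: field_simps)
    also have "\<dots> \<le> 2 ^ k" using less_exp[of k] by (simp add: less_imp_le)
    finally show ?thesis .
  qed
  have "summable (\<lambda>k. bessel_coeff 0 k * (of_real (2 * cmod y + 1)) ^ k)"
    using entire_coeffs_bessel[of 0] by (simp add: entire_coeffs_def)
  then have "summable (\<lambda>k. norm (bessel_coeff 0 k * (of_real (2 * cmod y)) ^ k))"
    by (rule powser_insidea) (simp only: norm_of_real, simp)
  then show "summable (\<lambda>k. bessel_log_coeff k * y ^ k)"
  proof (rule summable_comparison_test'[where N = 0])
    fix k
    have "norm (bessel_log_coeff k * y ^ k) = harm k * (norm (bessel_coeff 0 k) * cmod y ^ k)"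
      by (simp add: bessel_log_coeff_def norm_mult norm_power harm_nonneg)
    also have "\<dots> \<le> 2 ^ k * (norm (bessel_coeff 0 k) * cmod y ^ k)"
      by (intro mult_right_mono harm_le) auto
    also have "\<dots> = norm (bessel_coeff 0 k * (of_real (2 * cmod y)) ^ k)"
      by (simp add: norm_mult norm_power power_mult_distrib)
    finally show "norm (bessel_log_coeff k * y ^ k) \<le> norm (bessel_coeff 0 k * (of_real (2 * cmod y)) ^ k)" .
  qed
qed

abbreviation bessel_E :: "real \<Rightarrow> complex \<Rightarrow> complex" where
  "bessel_E \<mu> \<equiv> entire_series (bessel_coeff \<mu>)"

abbreviation bessel_E1 :: "real \<Rightarrow> complex \<Rightarrow> complex" where
  "bessel_E1 \<mu> \<equiv> entire_series (euler_op (bessel_coeff \<mu>))"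

abbreviation bessel_L :: "complex \<Rightarrow> complex" where
  "bessel_L \<equiv> entire_series bessel_log_coeff"

abbreviation bessel_L1 :: "complex \<Rightarrow> complex" where
  "bessel_L1 \<equiv> entire_series (euler_op bessel_log_coeff)"

lemmas entire_coeffs_intros =
  entire_coeffs_bessel entire_coeffs_bessel_log entire_coeffs_euler_op

lemma bessel_E_ode:
  assumes \<mu>: "\<mu> > -1"
  shows "4 * entire_series (euler_op (euler_op (bessel_coeff \<mu>))) \<zeta> + 4 * of_real \<mu> * bessel_E1 \<mu> \<zeta>
         = - \<zeta> * bessel_E \<mu> \<zeta>"
proof -
  let ?c = "bessel_coeff \<mu>"
  define t where "t k = (4 * euler_op (euler_op ?c) k + 4 * of_real \<mu> * euler_op ?c k) * \<zeta> ^ k" for k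
  have "t sums (4 * entire_series (euler_op (euler_op ?c)) \<zeta> + 4 * of_real \<mu> * bessel_E1 \<mu> \<zeta>)"
    unfolding t_def ring_distribs mult.assoc
    by (intro sums_add sums_mult entire_series_sums entire_coeffs_intros \<mu>)
  moreover have "(\<lambda>k. t (Suc k)) sums (- \<zeta> * bessel_E \<mu> \<zeta>)"
  proof -
    have "t (Suc k) = - \<zeta> * (?c k * \<zeta> ^ k)" for k
    proof -
      have "t (Suc k) = (4 * of_nat (Suc k) * (of_nat (Suc k) + of_real \<mu>) * ?c (Suc k)) * \<zeta> ^ Suc k"
        unfolding t_def euler_op_def by (simp add: algebra_simps del: of_nat_Suc)
      also have "\<dots> = - \<zeta> * (?c k * \<zeta> ^ k)" unfolding bessel_coeff_Suc[OF \<mu>] by simp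
      finally show ?thesis .
    qed
    then show ?thesis
      by (simp only:) (intro sums_mult entire_series_sums entire_coeffs_intros \<mu>)
  qed
  then have "t sums (- \<zeta> * bessel_E \<mu> \<zeta> + t 0)" by (simp only: sums_Suc_iff[symmetric])
  then have "t sums (- \<zeta> * bessel_E \<mu> \<zeta>)" by (simp add: t_def euler_op_def)
  ultimately show ?thesis by (rule sums_unique2)
qed

text \<open>
  The inhomogeneity comes from \<open>harm (Suc k) - harm k = 1 / Suc k\<close>. In \<open>log_solution\<close> it cancels
  the terms in which the logarithm is differentiated.
\<close>

lemma bessel_L_ode:
  "4 * entire_series (euler_op (euler_op bessel_log_coeff)) \<zeta> - 4 * bessel_E1 0 \<zeta>
     = - \<zeta> * bessel_L \<zeta>"
proof -
  let ?c = bessel_log_coeff and ?a = "bessel_coeff 0"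
  define t where "t k = (4 * euler_op (euler_op ?c) k - 4 * euler_op ?a k) * \<zeta> ^ k" for k
  have "t sums (4 * entire_series (euler_op (euler_op ?c)) \<zeta> - 4 * bessel_E1 0 \<zeta>)"
    unfolding t_def ring_distribs mult.assoc left_diff_distrib
    by (intro sums_diff sums_mult entire_series_sums entire_coeffs_intros) auto
  moreover have "(\<lambda>k. t (Suc k)) sums (- \<zeta> * bessel_L \<zeta>)"
  proof -
    have "t (Suc k) = - \<zeta> * (?c k * \<zeta> ^ k)" for k
    proof -
      have h: "complex_of_real (harm (Suc k)) = of_real (harm k) + 1 / of_nat (Suc k)"
        by (simp add: harm_Suc inverse_eq_divide del: of_nat_Suc)
      have rec: "4 * of_nat (Suc k) * of_nat (Suc k) * ?a (Suc k) = - ?a k"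
        using bessel_coeff_Suc[of 0 k] by simp
      have ne: "(of_nat (Suc k) :: complex) \<noteq> 0" by (simp only: of_nat_eq_0_iff)
      have "t (Suc k) = (4 * of_nat (Suc k) * of_nat (Suc k) * ?a (Suc k)) * of_real (harm k) * \<zeta> ^ Suc k"
        unfolding t_def euler_op_def bessel_log_coeff_def h using ne by (simp add: field_simps del: of_nat_Suc)
      also have "\<dots> = - \<zeta> * (?c k * \<zeta> ^ k)" unfolding rec by (simp add: bessel_log_coeff_def)
      finally show ?thesis .
    qed
    then show ?thesis
      by (simp only:) (intro sums_mult entire_series_sums entire_coeffs_intros)
  qed
  then have "t sums (- \<zeta> * bessel_L \<zeta> + t 0)" by (simp only: sums_Suc_iff[symmetric])
  then have "t sums (- \<zeta> * bessel_L \<zeta>)" by (simp add: t_def euler_op_def)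
  ultimately show ?thesis by (rule sums_unique2)
qed

lemma bessel_J_0_entire: "bessel_J 0 w = bessel_E 0 (w\<^sup>2)"
proof -
  have "(-1) ^ k * rGamma (of_nat k + 1) / fact k * (w / 2) ^ (2 * k) = bessel_coeff 0 k * (w\<^sup>2) ^ k" for k
  proof -
    have "rGamma (of_nat k + 1 :: complex) = 1 / fact k"
      by (metis Gamma_fact add.commute inverse_eq_divide rGamma_inverse_Gamma)
    moreover have "(w / 2) ^ (2 * k) = (w\<^sup>2) ^ k / 4 ^ k"
      by (simp add: power_mult power_divide)
    moreover have "pochhammer (1::real) k = fact k" by (simp add: pochhammer_fact)
    ultimately show ?thesis by (simp only: bessel_coeff_def) simp
  qed
  then show ?thesis by (simp add: bessel_J_def entire_series_def)
qed

lemma bessel_J_entire: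
  assumes "\<mu> > -1" "\<mu> \<noteq> 0"
  shows "bessel_J \<mu> w = (w / 2) powr of_real \<mu> * of_real (rGamma (1 + \<mu>)) * bessel_E \<mu> (w\<^sup>2)"
proof -
  have *: "(-1) ^ k * rGamma (of_nat k + complex_of_real \<mu> + 1) / fact k * (w / 2) ^ (2 * k)
        = of_real (rGamma (1 + \<mu>)) * (bessel_coeff \<mu> k * (w\<^sup>2) ^ k)" for k
  proof -
    have pos: "pochhammer (1 + \<mu>) k > 0" using assms by (intro pochhammer_pos) simp
    have "rGamma (1 + \<mu>) = pochhammer (1 + \<mu>) k * rGamma (1 + \<mu> + real k)"
      by (rule pochhammer_rGamma)
    then have "rGamma (1 + \<mu> + real k) = rGamma (1 + \<mu>) / pochhammer (1 + \<mu>) k"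
      using pos by (simp add: field_simps)
    moreover have "rGamma (of_nat k + complex_of_real \<mu> + 1) = of_real (rGamma (1 + \<mu> + real k))"
      by (simp add: add_ac flip: rGamma_complex_of_real)
    moreover have "(w / 2) ^ (2 * k) = (w\<^sup>2) ^ k / 4 ^ k"
      by (simp add: power_mult power_divide)
    ultimately show ?thesis by (simp only: bessel_coeff_def) (simp add: mult_ac)
  qed
  have "(\<Sum>k. (-1) ^ k * rGamma (of_nat k + complex_of_real \<mu> + 1) / fact k * (w / 2) ^ (2 * k))
     = of_real (rGamma (1 + \<mu>)) * bessel_E \<mu> (w\<^sup>2)"
    unfolding entire_series_def *
    using suminf_mult[OF sums_summable[OF entire_series_sums[OF entire_coeffs_bessel[OF assms(1)]]], of "of_real (rGamma (1 + \<mu>))" "w\<^sup>2"]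
    by simp
  then show ?thesis using assms by (simp add: bessel_J_def)
qed

lemma bessel_Y0_entire:
  "bessel_Y0 w = 2 / of_real pi * ((Ln (w / 2) + euler_mascheroni) * bessel_E 0 (w\<^sup>2) - bessel_L (w\<^sup>2))"
proof -
  have "(-1) ^ k * harm k / (fact k)\<^sup>2 * (w / 2) ^ (2 * k) = bessel_log_coeff k * (w\<^sup>2) ^ k" for k
  proof -
    have "(w / 2) ^ (2 * k) = (w\<^sup>2) ^ k / 4 ^ k"
      by (simp add: power_mult power_divide)
    moreover have "pochhammer (1::real) k = fact k" by (simp add: pochhammer_fact)
    moreover have "complex_of_real (harm k) = harm k" by (simp add: of_real_harm)
    ultimately show ?thesis
      by (simp only: bessel_coeff_def bessel_log_coeff_def) (simp add: power2_eq_square mult_ac)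
  qed
  then show ?thesis by (simp add: bessel_Y0_def bessel_J_0_entire entire_series_def)
qed

section \<open>The Bessel equation as a first-order system\<close>

text \<open>
  Here \<open>P\<close> is the quasi-derivative \<open>x p'\<close>. The system says that \<open>sqrt x * p x\<close> solves
  \<open>\<tau> f = z f\<close>; with the quasi-derivative neither the Wronskian nor the energy carries a weight.
\<close>

definition bessel_system ::
  "real \<Rightarrow> complex \<Rightarrow> (real \<Rightarrow> complex) \<Rightarrow> (real \<Rightarrow> complex) \<Rightarrow> bool" where
  "bessel_system \<nu> z p P \<longleftrightarrow>
     (\<forall>x>0. (p has_vector_derivative P x / of_real x) (at x) \<and>
            (P has_vector_derivative (of_real (\<nu>\<^sup>2 / x) - z * of_real x) * p x) (at x))"

lemma bessel_system_lincomb: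
  assumes "bessel_system \<nu> z p P" "bessel_system \<nu> z r R"
  shows "bessel_system \<nu> z (\<lambda>x. p x + c * r x) (\<lambda>x. P x + c * R x)"
  unfolding bessel_system_def
proof (intro allI impI conjI)
  fix x :: real assume "x > 0"
  have *: "(p has_vector_derivative P x / of_real x) (at x)"
      "(P has_vector_derivative (of_real (\<nu>\<^sup>2 / x) - z * of_real x) * p x) (at x)"
      "(r has_vector_derivative R x / of_real x) (at x)"
      "(R has_vector_derivative (of_real (\<nu>\<^sup>2 / x) - z * of_real x) * r x) (at x)"
    using assms \<open>x > 0\<close> unfolding bessel_system_def by blast+
  have "((\<lambda>x. p x + c * r x) has_vector_derivative P x / of_real x + c * (R x / of_real x)) (at x)"
    by (intro has_vector_derivative_add has_vector_derivative_mult_right *)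
  then show "((\<lambda>x. p x + c * r x) has_vector_derivative (P x + c * R x) / of_real x) (at x)"
    by (simp add: add_divide_distrib)
  have "((\<lambda>x. P x + c * R x) has_vector_derivative
      (of_real (\<nu>\<^sup>2 / x) - z * of_real x) * p x + c * ((of_real (\<nu>\<^sup>2 / x) - z * of_real x) * r x)) (at x)"
    by (intro has_vector_derivative_add has_vector_derivative_mult_right *)
  then show "((\<lambda>x. P x + c * R x) has_vector_derivative
      (of_real (\<nu>\<^sup>2 / x) - z * of_real x) * (p x + c * r x)) (at x)"
    by (simp only: distrib_left mult.left_commute)
qed

text \<open>
  The Frobenius solution with exponent \<open>\<mu>\<close>, where \<open>\<mu>\<close> will be \<open>\<nu>\<close> or \<open>- \<nu>\<close>.
\<close>

definition frobenius :: "real \<Rightarrow> complex \<Rightarrow> real \<Rightarrow> complex" where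
  "frobenius \<mu> z x = of_real (x powr \<mu>) * bessel_E \<mu> (z * of_real (x\<^sup>2))"

definition frobenius_quasi :: "real \<Rightarrow> complex \<Rightarrow> real \<Rightarrow> complex" where
  "frobenius_quasi \<mu> z x = of_real (x powr \<mu>) *
     (of_real \<mu> * bessel_E \<mu> (z * of_real (x\<^sup>2)) + 2 * bessel_E1 \<mu> (z * of_real (x\<^sup>2)))"

lemma powr_vector_deriv:
  fixes x :: real
  assumes "x > 0"
  shows "((\<lambda>x. complex_of_real (x powr \<mu>)) has_vector_derivative
           of_real \<mu> * of_real (x powr \<mu>) / of_real x) (at x)"
proof -
  have "((\<lambda>x. x powr \<mu>) has_real_derivative \<mu> * x powr \<mu> / x) (at x)"
    using assms by (auto intro!: derivative_eq_intros simp: powr_diff)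
  from has_vector_derivative_of_real[OF this, where 'a = complex] show ?thesis by simp
qed

lemma bessel_system_frobenius:
  assumes \<mu>: "\<mu> > -1"
  shows "bessel_system \<mu> z (frobenius \<mu> z) (frobenius_quasi \<mu> z)"
  unfolding bessel_system_def
proof (intro allI impI conjI)
  fix x :: real assume x: "x > 0"
  let ?Z = "\<lambda>x::real. z * of_real (x\<^sup>2)"
  let ?E = "bessel_E \<mu> (?Z x)" and ?E1 = "bessel_E1 \<mu> (?Z x)"
  let ?E2 = "entire_series (euler_op (euler_op (bessel_coeff \<mu>))) (?Z x)"
  let ?X = "complex_of_real (x powr \<mu>)" and ?m = "complex_of_real \<mu>"
  note E = entire_series_square_deriv[OF entire_coeffs_bessel[OF \<mu>] x, of z]
  note E1 = entire_series_square_deriv[OF entire_coeffs_euler_op[OF entire_coeffs_bessel[OF \<mu>]] x, of z]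
  note X = powr_vector_deriv[OF x, of \<mu>]
  have "(frobenius \<mu> z has_vector_derivative ?X * (2 * ?E1 / x) + (?m * ?X / x) * ?E) (at x)"
    unfolding frobenius_def[abs_def] by (intro has_vector_derivative_mult X E)
  moreover have "?X * (2 * ?E1 / x) + (?m * ?X / x) * ?E = frobenius_quasi \<mu> z x / of_real x"
    unfolding frobenius_quasi_def using x by (simp add: field_simps)
  ultimately show "(frobenius \<mu> z has_vector_derivative frobenius_quasi \<mu> z x / of_real x) (at x)"
    by simp
  have "(frobenius_quasi \<mu> z has_vector_derivative
      ?X * (?m * (2 * ?E1 / x) + 2 * (2 * ?E2 / x)) + (?m * ?X / x) * (?m * ?E + 2 * ?E1)) (at x)"
    unfolding frobenius_quasi_def[abs_def]
    by (intro has_vector_derivative_mult has_vector_derivative_add has_vector_derivative_mult_right X E E1)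
  moreover have "?X * (?m * (2 * ?E1 / x) + 2 * (2 * ?E2 / x)) + (?m * ?X / x) * (?m * ?E + 2 * ?E1)
      = ?X / x * (?m\<^sup>2 * ?E + (4 * ?E2 + 4 * ?m * ?E1))"
  proof -
    have "X * (m * (2 * e1 / y) + 2 * (2 * e2 / y)) + (m * X / y) * (m * e + 2 * e1)
      = X / y * (m\<^sup>2 * e + (4 * e2 + 4 * m * e1))" for X m e e1 e2 y :: complex
      by (simp add: power2_eq_square add_divide_distrib algebra_simps)
    then show ?thesis .
  qed
  moreover have "\<dots> = (of_real (\<mu>\<^sup>2 / x) - z * of_real x) * frobenius \<mu> z x"
  proof -
    have "X / y * (m\<^sup>2 * e + - (z * y\<^sup>2) * e) = (m\<^sup>2 / y - z * y) * (X * e)"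
      if "y \<noteq> 0" for X m e y :: complex
      using that by (simp add: power2_eq_square field_simps)
    from this[of "of_real x" ?X ?m ?E] x show ?thesis
      unfolding bessel_E_ode[OF \<mu>] frobenius_def by simp
  qed
  ultimately show "(frobenius_quasi \<mu> z has_vector_derivative
      (of_real (\<mu>\<^sup>2 / x) - z * of_real x) * frobenius \<mu> z x) (at x)" by simp
qed

text \<open>
  The exponents coincide for \<open>\<nu> = 0\<close>, which produces a logarithm in the second solution.
\<close>

definition log_solution :: "complex \<Rightarrow> real \<Rightarrow> complex" where
  "log_solution z x = bessel_L (z * of_real (x\<^sup>2)) - of_real (ln x) * bessel_E 0 (z * of_real (x\<^sup>2))"

definition log_solution_quasi :: "complex \<Rightarrow> real \<Rightarrow> complex" where
  "log_solution_quasi z x = 2 * bessel_L1 (z * of_real (x\<^sup>2)) - bessel_E 0 (z * of_real (x\<^sup>2))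
     - 2 * (of_real (ln x) * bessel_E1 0 (z * of_real (x\<^sup>2)))"

lemma bessel_system_log_solution:
  "bessel_system 0 z (log_solution z) (log_solution_quasi z)"
  unfolding bessel_system_def
proof (intro allI impI conjI)
  fix x :: real assume x: "x > 0"
  let ?Z = "\<lambda>x::real. z * of_real (x\<^sup>2)"
  let ?E = "bessel_E 0 (?Z x)" and ?E1 = "bessel_E1 0 (?Z x)"
  let ?E2 = "entire_series (euler_op (euler_op (bessel_coeff 0))) (?Z x)"
  let ?L = "bessel_L (?Z x)" and ?L1 = "bessel_L1 (?Z x)"
  let ?L2 = "entire_series (euler_op (euler_op bessel_log_coeff)) (?Z x)"
  have c: "entire_coeffs (bessel_coeff 0)" by (rule entire_coeffs_bessel) simp
  note E = entire_series_square_deriv[OF c x, of z]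
  note E1 = entire_series_square_deriv[OF entire_coeffs_euler_op[OF c] x, of z]
  note L = entire_series_square_deriv[OF entire_coeffs_bessel_log x, of z]
  note L1 = entire_series_square_deriv[OF entire_coeffs_euler_op[OF entire_coeffs_bessel_log] x, of z]
  have ln: "((\<lambda>x. complex_of_real (ln x)) has_vector_derivative of_real (1 / x)) (at x)"
    using x by (intro has_vector_derivative_of_real) (auto intro!: derivative_eq_intros)
  let ?l = "complex_of_real (ln x)"
  have "(log_solution z has_vector_derivative
      2 * ?L1 / x - (?l * (2 * ?E1 / x) + of_real (1 / x) * ?E)) (at x)"
    unfolding log_solution_def[abs_def] by (intro has_vector_derivative_diff has_vector_derivative_mult L E ln)
  moreover have "2 * ?L1 / x - (?l * (2 * ?E1 / x) + of_real (1 / x) * ?E) = log_solution_quasi z x / of_real x"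
    unfolding log_solution_quasi_def using x by (simp add: field_simps)
  ultimately show "(log_solution z has_vector_derivative log_solution_quasi z x / of_real x) (at x)"
    by simp
  have "(log_solution_quasi z has_vector_derivative
      2 * (2 * ?L2 / x) - 2 * ?E1 / x - 2 * (?l * (2 * ?E2 / x) + of_real (1 / x) * ?E1)) (at x)"
    unfolding log_solution_quasi_def[abs_def]
    by (intro has_vector_derivative_mult has_vector_derivative_diff has_vector_derivative_mult_right L1 E E1 ln)
  moreover have "2 * (2 * ?L2 / x) - 2 * ?E1 / x - 2 * (?l * (2 * ?E2 / x) + of_real (1 / x) * ?E1)
      = ((4 * ?L2 - 4 * ?E1) - ?l * (4 * ?E2 + 4 * of_real 0 * ?E1)) / x"
  proof -
    have "2 * (2 * l2 / y) - 2 * e1 / y - 2 * (l * (2 * e2 / y) + 1 / y * e1)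
      = ((4 * l2 - 4 * e1) - l * (4 * e2 + 4 * 0 * e1)) / y" for l2 y e1 l e2 :: complex
      by (simp add: add_divide_distrib diff_divide_distrib algebra_simps)
    then show ?thesis by simp
  qed
  moreover have "\<dots> = (of_real (0\<^sup>2 / x) - z * of_real x) * log_solution z x"
  proof -
    have "(- (z * y\<^sup>2) * e1 - l * (- (z * y\<^sup>2) * e)) / y = (0 - z * y) * (e1 - l * e)"
      if "y \<noteq> 0" for e1 l e y :: complex
      using that by (simp add: power2_eq_square field_simps)
    from this[of "of_real x" ?L ?l ?E] x show ?thesis
      unfolding bessel_E_ode[of 0 "?Z x", simplified] bessel_L_ode log_solution_def
      using bessel_E_ode[of 0 "?Z x"] by simp
  qed
  ultimately show "(log_solution_quasi z has_vector_derivative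
      (of_real (0\<^sup>2 / x) - z * of_real x) * log_solution z x) (at x)" by simp
qed

text \<open>
  The factor \<open>1 / (2 * \<nu>)\<close>, like the sign chosen in the logarithmic case, makes the Wronskian with
  \<open>frobenius \<nu> z\<close> equal to 1, and with it the boundary value \<open>\<Gamma>\<^sub>0\<close>.
\<close>

definition singular :: "real \<Rightarrow> complex \<Rightarrow> real \<Rightarrow> complex" where
  "singular \<nu> z x = (if \<nu> = 0 then log_solution z x else frobenius (- \<nu>) z x / of_real (2 * \<nu>))"

definition singular_quasi :: "real \<Rightarrow> complex \<Rightarrow> real \<Rightarrow> complex" where
  "singular_quasi \<nu> z x =
     (if \<nu> = 0 then log_solution_quasi z x else frobenius_quasi (- \<nu>) z x / of_real (2 * \<nu>))"

lemma bessel_system_singular: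
  assumes "\<nu> < 1"
  shows "bessel_system \<nu> z (singular \<nu> z) (singular_quasi \<nu> z)"
proof (cases "\<nu> = 0")
  case True
  then show ?thesis using bessel_system_log_solution by (simp add: singular_def[abs_def] singular_quasi_def[abs_def])
next
  case False
  have "bessel_system (-\<nu>) z (frobenius (-\<nu>) z) (frobenius_quasi (-\<nu>) z)"
    using assms by (intro bessel_system_frobenius) simp
  then have *: "bessel_system \<nu> z (frobenius (-\<nu>) z) (frobenius_quasi (-\<nu>) z)"
    by (simp add: bessel_system_def)
  have "bessel_system \<nu> z (\<lambda>x. 0) (\<lambda>x. 0)" by (simp add: bessel_system_def)
  from bessel_system_lincomb[OF this *, of "1 / of_real (2 * \<nu>)"] False show ?thesis
    by (simp add: singular_def[abs_def] singular_quasi_def[abs_def])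
qed

text \<open>
  A power series without constant term is \<open>O(x\<^sup>2)\<close> along \<open>\<zeta> = z x\<^sup>2\<close>.
\<close>

lemma powr_square_mult_tendsto_0:
  assumes "entire_coeffs c" "c 0 = 0" "s > -2"
  shows "((\<lambda>x. of_real (x powr s) * entire_series c (z * of_real (x\<^sup>2))) \<longlongrightarrow> 0) (at_right 0)"
proof -
  \<comment> \<open>The coefficients of the quotient of the series by its argument.\<close>
  define d where "d k = c (Suc k)" for k
  have d: "entire_coeffs d"
    unfolding entire_coeffs_def d_def
  proof
    fix y :: complex
    show "summable (\<lambda>k. c (Suc k) * y ^ k)"
    proof (cases "y = 0")
      case False
      have "summable (\<lambda>k. c (Suc k) * y ^ Suc k)"
        using assms(1) by (subst summable_Suc_iff) (simp add: entire_coeffs_def)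
      from summable_mult2[OF this, of "1 / y"] show ?thesis using False by (simp add: field_simps)
    qed simp
  qed
  have eq: "entire_series c \<zeta> = \<zeta> * entire_series d \<zeta>" for \<zeta>
  proof -
    have "(\<lambda>k. \<zeta> * (d k * \<zeta> ^ k)) sums (\<zeta> * entire_series d \<zeta>)"
      by (intro sums_mult entire_series_sums d)
    then have "(\<lambda>k. c (Suc k) * \<zeta> ^ Suc k) sums (\<zeta> * entire_series d \<zeta>)" by (simp add: d_def mult_ac)
    from this[THEN sums_Suc_iff[THEN iffD1]] have "(\<lambda>k. c k * \<zeta> ^ k) sums (\<zeta> * entire_series d \<zeta>)"
      using assms(2) by simp
    then show ?thesis using entire_series_sums[OF assms(1)] sums_unique2 by blast
  qed
  have "((\<lambda>x. of_real (x powr (s + 2)) * (z * entire_series d (z * of_real (x\<^sup>2)))) \<longlongrightarrow>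
      of_real 0 * (z * d 0)) (at_right 0)"
  proof (intro tendsto_intros entire_series_square_tendsto d)
    show "((\<lambda>x. x powr (s + 2)) \<longlongrightarrow> 0) (at_right 0)"
      using assms(3) by (intro tendsto_zero_powrI[where b = "s+2"] tendsto_intros)
        (auto simp: eventually_at_filter)
  qed
  moreover have "eventually (\<lambda>x. of_real (x powr (s + 2)) * (z * entire_series d (z * of_real (x\<^sup>2)))
      = of_real (x powr s) * entire_series c (z * of_real (x\<^sup>2))) (at_right (0::real))"
    using eventually_at_right_less[of 0]
    by eventually_elim (simp add: eq powr_add)
  ultimately show ?thesis by (simp add: tendsto_cong)
qed

lemma bessel_wronskian_const:
  assumes "bessel_system \<nu> z p P" "bessel_system \<nu> z r R"
  shows "\<exists>w. \<forall>x>0. p x * R x - P x * r x = w"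
proof -
  have "((\<lambda>x. p x * R x - P x * r x) has_vector_derivative 0) (at x within {0<..})"
    if "x \<in> {0<..}" for x :: real
  proof -
    have x: "x > 0" using that by simp
    let ?q = "complex_of_real (\<nu>\<^sup>2 / x) - z * of_real x"
    have *: "(p has_vector_derivative P x / of_real x) (at x)"
        "(P has_vector_derivative ?q * p x) (at x)"
        "(r has_vector_derivative R x / of_real x) (at x)"
        "(R has_vector_derivative ?q * r x) (at x)"
      using assms x unfolding bessel_system_def by blast+
    have "((\<lambda>x. p x * R x - P x * r x) has_vector_derivative
        (p x * (?q * r x) + P x / x * R x) - (P x * (R x / x) + ?q * p x * r x)) (at x)"
      by (intro has_vector_derivative_diff has_vector_derivative_mult *)
    moreover have "(p x * (?q * r x) + P x / x * R x) - (P x * (R x / x) + ?q * p x * r x) = 0"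
      by simp
    ultimately show ?thesis using has_vector_derivative_at_within by metis
  qed
  from has_vector_derivative_zero_constant[OF convex_real_interval(3) this]
  obtain w where "\<And>x. x \<in> {0<..} \<Longrightarrow> p x * R x - P x * r x = w" by blast
  then show ?thesis by auto
qed

text \<open>
  The Wronskian is constant, so its limit at 0 determines it. For \<open>\<nu> = 0\<close> the logarithms cancel.
\<close>

lemma bessel_wronskian:
  assumes \<nu>: "0 \<le> \<nu>" "\<nu> < 1" and "x > 0"
  shows "singular \<nu> z x * frobenius_quasi \<nu> z x - singular_quasi \<nu> z x * frobenius \<nu> z x = 1"
proof -
  let ?W = "\<lambda>x. singular \<nu> z x * frobenius_quasi \<nu> z x - singular_quasi \<nu> z x * frobenius \<nu> z x"
  have "bessel_system \<nu> z (frobenius \<nu> z) (frobenius_quasi \<nu> z)"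
    using \<nu> by (intro bessel_system_frobenius) simp
  from bessel_wronskian_const[OF bessel_system_singular[OF \<nu>(2)] this]
  obtain w where w: "\<And>x. x > 0 \<Longrightarrow> ?W x = w" by blast
  let ?Z = "\<lambda>x::real. z * of_real (x\<^sup>2)"
  have "(?W \<longlongrightarrow> 1) (at_right 0)"
  proof (cases "\<nu> = 0")
    case True
    let ?g = "\<lambda>x. 2 * (bessel_L (?Z x) * bessel_E1 0 (?Z x)) - 2 * (bessel_L1 (?Z x) * bessel_E 0 (?Z x))
       + bessel_E 0 (?Z x) * bessel_E 0 (?Z x)"
    have "(?g \<longlongrightarrow> 2 * (bessel_log_coeff 0 * euler_op (bessel_coeff 0) 0)
        - 2 * (euler_op bessel_log_coeff 0 * bessel_coeff 0 0) + bessel_coeff 0 0 * bessel_coeff 0 0) (at_right 0)"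
      by (intro tendsto_intros entire_series_square_tendsto entire_coeffs_intros) auto
    then have "(?g \<longlongrightarrow> 1) (at_right 0)" by (simp add: euler_op_def)
    moreover have "eventually (\<lambda>x. ?g x = ?W x) (at_right 0)"
      using eventually_at_right_less[of 0]
    proof eventually_elim
      case (elim x)
      then show ?case unfolding True
        by (simp add: singular_def singular_quasi_def log_solution_def log_solution_quasi_def
            frobenius_def frobenius_quasi_def) (simp add: algebra_simps)
    qed
    ultimately show ?thesis by (simp add: tendsto_cong)
  next
    case False
    then have pos: "\<nu> > 0" using \<nu> by simp
    let ?g = "\<lambda>x. (bessel_E (-\<nu>) (?Z x) * (of_real \<nu> * bessel_E \<nu> (?Z x) + 2 * bessel_E1 \<nu> (?Z x))
       - (of_real (-\<nu>) * bessel_E (-\<nu>) (?Z x) + 2 * bessel_E1 (-\<nu>) (?Z x)) * bessel_E \<nu> (?Z x)) / of_real (2 * \<nu>)"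
    have "(?g \<longlongrightarrow> (bessel_coeff (-\<nu>) 0 * (of_real \<nu> * bessel_coeff \<nu> 0 + 2 * euler_op (bessel_coeff \<nu>) 0)
       - (of_real (-\<nu>) * bessel_coeff (-\<nu>) 0 + 2 * euler_op (bessel_coeff (-\<nu>)) 0) * bessel_coeff \<nu> 0) / of_real (2 * \<nu>)) (at_right 0)"
      using \<nu> pos by (intro tendsto_intros entire_series_square_tendsto entire_coeffs_intros) auto
    then have "(?g \<longlongrightarrow> 1) (at_right 0)" using pos by (simp add: euler_op_def)
    moreover have "eventually (\<lambda>x. ?g x = ?W x) (at_right 0)"
      using eventually_at_right_less[of 0]
    proof eventually_elim
      case (elim x)
      have "x powr (-\<nu>) * x powr \<nu> = 1" using elim by (simp add: powr_minus)
      then have inv: "complex_of_real (x powr (-\<nu>)) * of_real (x powr \<nu>) = 1"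
        by (simp only: flip: of_real_mult) simp
      have "(e * f - g * h) / n = ((X * e) / n) * (Y * f) - (X * g) / n * (Y * h)"
        if "X * Y = 1" for X Y e f g h n :: complex
      proof -
        have "((X * e) / n) * (Y * f) - (X * g) / n * (Y * h) = (X * Y) * ((e * f - g * h) / n)"
          by (simp add: diff_divide_distrib algebra_simps)
        then show ?thesis using that by simp
      qed
      from this[OF inv] show ?case using pos
        by (simp only: singular_def singular_quasi_def frobenius_def frobenius_quasi_def if_False False)
    qed
    ultimately show ?thesis by (simp add: tendsto_cong)
  qed
  moreover have "(?W \<longlongrightarrow> w) (at_right 0)"
    by (rule tendsto_eventually, use eventually_at_right_less[of 0] in eventually_elim) (rule w)
  ultimately have "w = 1" using tendsto_unique trivial_limit_at_right_real by blast
  then show ?thesis using w[OF \<open>x > 0\<close>] by simp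
qed

section \<open>The energy form\<close>

text \<open>
  For \<open>s\<^sup>2 = - z\<close> and \<open>Re s > 0\<close> the factor \<open>cnj s\<close> rotates both parts of
  \<open>(P * cnj p)' = \<bar>P\<bar>\<^sup>2 / x + (\<nu>\<^sup>2 / x - z x) * \<bar>p\<bar>\<^sup>2\<close> into the right half-plane. The usual choice, the
  imaginary part of \<open>P * cnj p\<close>, would be of no use on the negative half-line, where
  the limit is going to be evaluated.
\<close>

definition energy :: "complex \<Rightarrow> (real \<Rightarrow> complex) \<Rightarrow> (real \<Rightarrow> complex) \<Rightarrow> real \<Rightarrow> real" where
  "energy s p P x = Re (cnj s * P x * cnj (p x))"

definition energy_density ::
  "real \<Rightarrow> complex \<Rightarrow> (real \<Rightarrow> complex) \<Rightarrow> (real \<Rightarrow> complex) \<Rightarrow> real \<Rightarrow> real" where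
  "energy_density \<nu> s p P x =
     (cmod (P x))\<^sup>2 / x + \<nu>\<^sup>2 / x * (cmod (p x))\<^sup>2 + (cmod s)\<^sup>2 * x * (cmod (p x))\<^sup>2"

lemma energy_deriv:
  assumes "bessel_system \<nu> z p P" "s\<^sup>2 = - z" "x > 0"
  shows "(energy s p P has_real_derivative Re s * energy_density \<nu> s p P x) (at x)"
proof -
  let ?q = "complex_of_real (\<nu>\<^sup>2 / x) - z * of_real x"
  have *: "(p has_vector_derivative P x / of_real x) (at x)" "(P has_vector_derivative ?q * p x) (at x)"
    using assms unfolding bessel_system_def by blast+
  have c: "((\<lambda>x. cnj (p x)) has_vector_derivative cnj (P x / of_real x)) (at x)"
    by (rule has_vector_derivative_cnj[OF *(1)])
  have "((\<lambda>x. cnj s * P x * cnj (p x)) has_vector_derivative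
      cnj s * P x * cnj (P x / of_real x) + cnj s * (?q * p x) * cnj (p x)) (at x)"
    by (intro has_vector_derivative_mult has_vector_derivative_mult_right * c)
  then have "((\<lambda>x. Re (cnj s * P x * cnj (p x))) has_vector_derivative
      Re (cnj s * P x * cnj (P x / of_real x) + cnj s * (?q * p x) * cnj (p x))) (at x)"
    by (rule bounded_linear.has_vector_derivative[OF bounded_linear_Re])
  moreover have "Re (cnj s * P x * cnj (P x / of_real x) + cnj s * (?q * p x) * cnj (p x))
      = Re s * energy_density \<nu> s p P x"
  proof -
    have z: "z = - s\<^sup>2" using assms(2) by simp
    have "cnj s * P x * cnj (P x / of_real x) + cnj s * (?q * p x) * cnj (p x)
       = cnj s * (P x * cnj (P x)) / of_real x + cnj s * of_real (\<nu>\<^sup>2 / x) * (p x * cnj (p x))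
         + (cnj s * s) * s * of_real x * (p x * cnj (p x))"
      unfolding z by (simp add: algebra_simps power2_eq_square)
    also have "\<dots> = cnj s * of_real ((cmod (P x))\<^sup>2 / x + \<nu>\<^sup>2 / x * (cmod (p x))\<^sup>2)
         + s * of_real ((cmod s)\<^sup>2 * x * (cmod (p x))\<^sup>2)"
      by (simp only: complex_norm_square[symmetric] mult.commute[of "cnj s" s])
        (simp add: algebra_simps)
    finally show ?thesis by (simp add: energy_density_def algebra_simps)
  qed
  ultimately show ?thesis
    by (simp add: energy_def[abs_def] has_real_derivative_iff_has_vector_derivative)
qed

text \<open>
  The inequality between geometric and arithmetic mean for \<open>\<bar>P\<bar> / sqrt x\<close> and \<open>\<bar>s\<bar> * sqrt x * \<bar>p\<bar>\<close>.
\<close>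

lemma abs_energy_le_density:
  assumes "x > 0"
  shows "2 * \<bar>energy s p P x\<bar> \<le> energy_density \<nu> s p P x"
proof -
  let ?a = "cmod (P x) / sqrt x" and ?b = "cmod s * sqrt x * cmod (p x)"
  have "\<bar>energy s p P x\<bar> \<le> cmod (cnj s * P x * cnj (p x))"
    unfolding energy_def by (rule abs_Re_le_cmod)
  also have "\<dots> = ?a * ?b" using assms by (simp add: norm_mult)
  finally have "\<bar>energy s p P x\<bar> \<le> ?a * ?b" .
  then have "2 * \<bar>energy s p P x\<bar> \<le> 2 * ?a * ?b" unfolding mult.assoc by (rule mult_left_mono) simp
  also have "\<dots> \<le> ?a\<^sup>2 + ?b\<^sup>2" by (rule sum_squares_bound)
  also have "\<dots> \<le> energy_density \<nu> s p P x"
    using assms unfolding energy_density_def by (simp add: power_mult_distrib power_divide)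
  finally show ?thesis .
qed

lemma energy_density_nonneg: "x > 0 \<Longrightarrow> energy_density \<nu> s p P x \<ge> 0"
  unfolding energy_density_def by simp

lemma energy_mono:
  assumes "bessel_system \<nu> z p P" "s\<^sup>2 = - z" "Re s \<ge> 0" "0 < a" "a \<le> b"
  shows "energy s p P a \<le> energy s p P b"
proof (rule DERIV_nonneg_imp_nondecreasing[OF assms(5)])
  fix x assume "a \<le> x" "x \<le> b"
  then have "x > 0" using assms by simp
  with energy_deriv[OF assms(1,2) this] energy_density_nonneg[OF this] assms(3)
  show "\<exists>y. (energy s p P has_real_derivative y) (at x) \<and> 0 \<le> y" by (meson mult_nonneg_nonneg)
qed

text \<open>
  By \<open>energy_deriv\<close> and \<open>abs_energy_le_density\<close> the energy \<open>Q\<close> satisfies \<open>Q' \<ge> 2 * Re s * Q\<close>.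
\<close>

lemma energy_exponential_growth:
  assumes sys: "bessel_system \<nu> z p P" and s: "s\<^sup>2 = - z" "Re s \<ge> 0" and ab: "0 < a" "a \<le> b"
  shows "energy s p P a * exp (2 * Re s * (b - a)) \<le> energy s p P b"
proof -
  let ?f = "\<lambda>x. energy s p P x * exp (- 2 * Re s * x)"
  have "?f a \<le> ?f b"
  proof (rule DERIV_nonneg_imp_nondecreasing[OF ab(2)])
    fix x assume "a \<le> x" "x \<le> b"
    then have x: "x > 0" using ab by simp
    have "(?f has_real_derivative Re s * energy_density \<nu> s p P x * exp (- 2 * Re s * x)
        + exp (- 2 * Re s * x) * (- 2 * Re s) * energy s p P x) (at x)"
      by (rule DERIV_mult[OF energy_deriv[OF sys s(1) x]]) (auto intro!: derivative_eq_intros)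
    moreover have "Re s * energy_density \<nu> s p P x * exp (- 2 * Re s * x)
        + exp (- 2 * Re s * x) * (- 2 * Re s) * energy s p P x
        = Re s * exp (- 2 * Re s * x) * (energy_density \<nu> s p P x - 2 * energy s p P x)"
      by (simp add: algebra_simps)
    moreover have "\<dots> \<ge> 0" using s(2) abs_energy_le_density[OF x, of s p P \<nu>] by (intro mult_nonneg_nonneg) auto
    ultimately show "\<exists>y. (?f has_real_derivative y) (at x) \<and> 0 \<le> y" by auto
  qed
  then have "?f a * exp (2 * Re s * b) \<le> ?f b * exp (2 * Re s * b)" by (intro mult_right_mono) auto
  then show ?thesis by (simp add: mult.assoc algebra_simps flip: exp_add)
qed

lemma frobenius_energy_tendsto_0:
  assumes \<nu>: "0 \<le> \<nu>"
  shows "(energy s (frobenius \<nu> z) (frobenius_quasi \<nu> z) \<longlongrightarrow> 0) (at_right 0)"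
proof -
  let ?Z = "\<lambda>x::real. z * of_real (x\<^sup>2)"
  let ?g = "\<lambda>x. Re (cnj s * (of_real (x powr (2 * \<nu>)) * of_real \<nu> * bessel_E \<nu> (?Z x) 
      + 2 * (of_real (x powr (2 * \<nu>)) * bessel_E1 \<nu> (?Z x))) * cnj (bessel_E \<nu> (?Z x)))"
  have nu: "\<nu> > -1" using \<nu> by simp
  have "((\<lambda>x. complex_of_real (x powr (2 * \<nu>)) * of_real \<nu>) \<longlongrightarrow> 0) (at_right 0)"
  proof (cases "\<nu> = 0")
    case False
    have "((\<lambda>x. x powr (2 * \<nu>)) \<longlongrightarrow> 0) (at_right 0)"
      using False \<nu> by (intro tendsto_zero_powrI[where b = "2 * \<nu>"] tendsto_intros) (auto simp: eventually_at_filter)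
    from tendsto_mult[OF tendsto_of_real[OF this] tendsto_const] show ?thesis by simp
  qed simp
  from this have "(?g \<longlongrightarrow> Re (cnj s * (0 * bessel_coeff \<nu> 0 + 2 * 0) * cnj (bessel_coeff \<nu> 0))) (at_right 0)"
    using \<nu> by (intro tendsto_intros entire_series_square_tendsto powr_square_mult_tendsto_0
        entire_coeffs_intros nu) (auto simp: euler_op_def)
  then have "(?g \<longlongrightarrow> 0) (at_right 0)" by simp
  moreover have "eventually (\<lambda>x. ?g x = energy s (frobenius \<nu> z) (frobenius_quasi \<nu> z) x) (at_right 0)"
    using eventually_at_right_less[of 0]
  proof eventually_elim
    case (elim x)
    have "x powr (2 * \<nu>) = x powr \<nu> * x powr \<nu>" by (simp flip: powr_add)
    then show ?case by (simp add: energy_def frobenius_def frobenius_quasi_def algebra_simps)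
  qed
  ultimately show ?thesis by (simp add: tendsto_cong)
qed

text \<open>
  The energy increases from its limit 0 at 0. If it vanished at \<open>x\<close>, its derivative and hence the
  solution would vanish on \<open>(0, x)\<close>, contradicting the normalisation at 0.
\<close>

lemma frobenius_energy_pos:
  assumes \<nu>: "0 \<le> \<nu>" and s: "s\<^sup>2 = - z" "Re s > 0" and x: "x > 0"
  shows "energy s (frobenius \<nu> z) (frobenius_quasi \<nu> z) x > 0"
proof -
  let ?Q = "energy s (frobenius \<nu> z) (frobenius_quasi \<nu> z)"
  have sys: "bessel_system \<nu> z (frobenius \<nu> z) (frobenius_quasi \<nu> z)"
    using \<nu> by (intro bessel_system_frobenius) simp
  have mono: "?Q a \<le> ?Q b" if "0 < a" "a \<le> b" for a b
    using energy_mono[OF sys s(1) _ that] s(2) by simp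
  have nonneg: "?Q a \<ge> 0" if "a > 0" for a
  proof (rule tendsto_upperbound[OF frobenius_energy_tendsto_0[OF \<nu>]])
    show "eventually (\<lambda>x. ?Q x \<le> ?Q a) (at_right 0)"
      using that by (auto simp: eventually_at_right[of 0 "1"] intro!: exI[of _ a] mono)
  qed simp
  show ?thesis
  proof (rule ccontr)
    assume "\<not> ?Q x > 0"
    then have Q0: "?Q y = 0" if "0 < y" "y \<le> x" for y
      using nonneg[OF that(1)] mono[OF that] by simp
    have p0: "frobenius \<nu> z y = 0" if y: "0 < y" "y < x" for y
    proof -
      have "(?Q has_real_derivative Re s * energy_density \<nu> s (frobenius \<nu> z) (frobenius_quasi \<nu> z) y) (at y)"
        by (rule energy_deriv[OF sys s(1) y(1)])
      then have "Re s * energy_density \<nu> s (frobenius \<nu> z) (frobenius_quasi \<nu> z) y = 0"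
        by (rule DERIV_local_const[where d = "min y (x - y)"]) (use y Q0 in auto)
      then have "energy_density \<nu> s (frobenius \<nu> z) (frobenius_quasi \<nu> z) y = 0" using s by simp
      moreover have "energy_density \<nu> s (frobenius \<nu> z) (frobenius_quasi \<nu> z) y
          \<ge> (cmod s)\<^sup>2 * y * (cmod (frobenius \<nu> z y))\<^sup>2"
        unfolding energy_density_def using y by simp
      ultimately have "(cmod s)\<^sup>2 * y * (cmod (frobenius \<nu> z y))\<^sup>2 \<le> 0" by simp
      moreover have "s \<noteq> 0" using s by auto
      ultimately show ?thesis using y by (auto simp: mult_le_0_iff)
    qed
    have "((\<lambda>y. bessel_E \<nu> (z * of_real (y\<^sup>2))) \<longlongrightarrow> bessel_coeff \<nu> 0) (at_right 0)"
      using \<nu> by (intro entire_series_square_tendsto entire_coeffs_intros) simp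
    moreover have "eventually (\<lambda>y. bessel_E \<nu> (z * of_real (y\<^sup>2)) = 0) (at_right 0)"
      using x p0 by (auto simp: eventually_at_right[of 0 1] frobenius_def intro!: exI[of _ x])
    then have "((\<lambda>y. bessel_E \<nu> (z * of_real (y\<^sup>2))) \<longlongrightarrow> 0) (at_right 0)" by (rule tendsto_eventually)
    ultimately have "bessel_coeff \<nu> 0 = 0" using tendsto_unique trivial_limit_at_right_real by blast
    then show False by simp
  qed
qed

lemma frobenius_nonzero:
  assumes "0 \<le> \<nu>" "s\<^sup>2 = - z" "Re s > 0" "x > 0"
  shows "frobenius \<nu> z x \<noteq> 0"
  using frobenius_energy_pos[OF assms] by (auto simp: energy_def)

section \<open>Convergence of the Weyl functions of the finite intervals\<close>

text \<open>
  The number \<open>m\<close> for which \<open>singular \<nu> z + m * frobenius \<nu> z\<close> vanishes at \<open>b\<close>.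
\<close>

definition weyl_quot :: "real \<Rightarrow> real \<Rightarrow> complex \<Rightarrow> complex" where
  "weyl_quot \<nu> b z = - singular \<nu> z b / frobenius \<nu> z b"

definition weyl_sol :: "real \<Rightarrow> complex \<Rightarrow> complex \<Rightarrow> real \<Rightarrow> complex" where
  "weyl_sol \<nu> z m x = singular \<nu> z x + m * frobenius \<nu> z x"

definition weyl_sol_quasi :: "real \<Rightarrow> complex \<Rightarrow> complex \<Rightarrow> real \<Rightarrow> complex" where
  "weyl_sol_quasi \<nu> z m x = singular_quasi \<nu> z x + m * frobenius_quasi \<nu> z x"

lemma bessel_system_weyl_sol:
  assumes "0 \<le> \<nu>" "\<nu> < 1"
  shows "bessel_system \<nu> z (weyl_sol \<nu> z m) (weyl_sol_quasi \<nu> z m)"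
  unfolding weyl_sol_def[abs_def] weyl_sol_quasi_def[abs_def]
  using assms by (intro bessel_system_lincomb bessel_system_singular bessel_system_frobenius) auto

lemma csqrt_minus_Re_pos:
  assumes "z \<notin> \<real>\<^sub>\<ge>\<^sub>0"
  shows "Re (csqrt (- z)) > 0"
proof -
  have "Re (csqrt (- z)) \<noteq> 0"
  proof
    assume "Re (csqrt (- z)) = 0"
    then have "(csqrt (- z))\<^sup>2 = of_real (- (Im (csqrt (- z)))\<^sup>2)"
      by (simp add: complex_eq_iff power2_eq_square)
    then have "z = of_real ((Im (csqrt (- z)))\<^sup>2)" by (simp add: minus_equation_iff)
    then show False using assms by (metis nonneg_Reals_of_real_iff zero_le_power2)
  qed
  moreover have "Re (csqrt (- z)) \<ge> 0" by (rule Re_csqrt)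
  ultimately show ?thesis by simp
qed

text \<open>
  Multiplied by \<open>cnj s * cnj p * cnj r\<close>, the Wronskian 1 of \<open>r = weyl_sol \<nu> z m\<close> and
  \<open>p = frobenius \<nu> z\<close> has the real part \<open>Q\<^sub>p * \<bar>r\<bar>\<^sup>2 - Q\<^sub>r * \<bar>p\<bar>\<^sup>2\<close>, where \<open>Q\<^sub>p\<close> and \<open>Q\<^sub>r\<close> are the
  energies. As \<open>Q\<^sub>r \<le> 0\<close>, there is no cancellation in it.
\<close>

lemma weyl_sol_estimate:
  assumes \<nu>: "0 \<le> \<nu>" "\<nu> < 1" and x: "x > 0"
    and neg: "energy s (weyl_sol \<nu> z m) (weyl_sol_quasi \<nu> z m) x \<le> 0"
  shows "energy s (frobenius \<nu> z) (frobenius_quasi \<nu> z) x * cmod (weyl_sol \<nu> z m x)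
           \<le> cmod s * cmod (frobenius \<nu> z x)"
proof (cases "weyl_sol \<nu> z m x = 0")
  case True
  then show ?thesis by simp
next
  case False
  let ?p = "frobenius \<nu> z x" and ?P = "frobenius_quasi \<nu> z x"
  let ?r = "weyl_sol \<nu> z m x" and ?R = "weyl_sol_quasi \<nu> z m x"
  let ?Qp = "energy s (frobenius \<nu> z) (frobenius_quasi \<nu> z) x"
  let ?Qr = "energy s (weyl_sol \<nu> z m) (weyl_sol_quasi \<nu> z m) x"
  have "?r * ?P - ?R * ?p = 1"
    using bessel_wronskian[OF \<nu> x, of z] by (simp add: weyl_sol_def weyl_sol_quasi_def algebra_simps)
  then have "cnj s * cnj ?p * cnj ?r = cnj s * cnj ?p * cnj ?r * (?r * ?P - ?R * ?p)" by simp
  also have "\<dots> = (cnj s * ?P * cnj ?p) * (?r * cnj ?r) - (cnj s * ?R * cnj ?r) * (?p * cnj ?p)"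
    by (simp add: algebra_simps)
  also have "\<dots> = (cnj s * ?P * cnj ?p) * of_real ((cmod ?r)\<^sup>2) - (cnj s * ?R * cnj ?r) * of_real ((cmod ?p)\<^sup>2)"
    by (simp only: complex_norm_square)
  finally have "Re (cnj s * cnj ?p * cnj ?r) = ?Qp * (cmod ?r)\<^sup>2 - ?Qr * (cmod ?p)\<^sup>2"
    by (simp add: energy_def)
  moreover have "?Qr * (cmod ?p)\<^sup>2 \<le> 0" using neg by (simp add: mult_nonpos_nonneg)
  ultimately have "?Qp * (cmod ?r)\<^sup>2 \<le> Re (cnj s * cnj ?p * cnj ?r)" by linarith
  also have "\<dots> \<le> cmod (cnj s * cnj ?p * cnj ?r)" by (rule complex_Re_le_cmod)
  also have "\<dots> = cmod s * cmod ?p * cmod ?r" by (simp add: norm_mult)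
  finally have "(?Qp * cmod ?r) * cmod ?r \<le> (cmod s * cmod ?p) * cmod ?r"
    by (simp add: power2_eq_square mult.assoc)
  then show ?thesis using False by simp
qed

lemma weyl_sol_at_endpoint:
  assumes "0 \<le> \<nu>" "s\<^sup>2 = - z" "Re s > 0" "b > 0"
  shows "weyl_sol \<nu> z (weyl_quot \<nu> b z) b = 0"
  using frobenius_nonzero[OF assms] by (simp add: weyl_sol_def weyl_quot_def)

text \<open>
  The energy increases, and it is 0 at the endpoint \<open>b\<close>.
\<close>

lemma weyl_sol_energy_nonpos:
  assumes \<nu>: "0 \<le> \<nu>" "\<nu> < 1" and s: "s\<^sup>2 = - z" "Re s > 0" and x: "0 < x" "x \<le> b"
  shows "energy s (weyl_sol \<nu> z (weyl_quot \<nu> b z)) (weyl_sol_quasi \<nu> z (weyl_quot \<nu> b z)) x \<le> 0"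
proof -
  let ?m = "weyl_quot \<nu> b z"
  have "energy s (weyl_sol \<nu> z ?m) (weyl_sol_quasi \<nu> z ?m) x
     \<le> energy s (weyl_sol \<nu> z ?m) (weyl_sol_quasi \<nu> z ?m) b"
    using s x by (intro energy_mono[OF bessel_system_weyl_sol[OF \<nu>]]) auto
  also have "\<dots> = 0" using weyl_sol_at_endpoint[OF \<nu>(1) s, of b] x by (simp add: energy_def)
  finally show ?thesis .
qed

text \<open>
  At \<open>b\<close> the solution that vanishes at \<open>b'\<close> is \<open>(weyl_quot \<nu> b' z - weyl_quot \<nu> b z)\<close> times
  \<open>frobenius \<nu> z b\<close>, and \<open>weyl_sol_estimate\<close> bounds it.
\<close>

lemma weyl_quot_diff:
  assumes \<nu>: "0 \<le> \<nu>" "\<nu> < 1" and s: "s\<^sup>2 = - z" "Re s > 0" and b: "0 < b" "b \<le> b'"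
  shows "cmod (weyl_quot \<nu> b' z - weyl_quot \<nu> b z)
           \<le> cmod s / energy s (frobenius \<nu> z) (frobenius_quasi \<nu> z) b"
proof -
  let ?p = "frobenius \<nu> z b" and ?Q = "energy s (frobenius \<nu> z) (frobenius_quasi \<nu> z) b"
  have p: "?p \<noteq> 0" by (rule frobenius_nonzero[OF \<nu>(1) s b(1)])
  have Q: "?Q > 0" by (rule frobenius_energy_pos[OF \<nu>(1) s b(1)])
  have "?Q * cmod (weyl_sol \<nu> z (weyl_quot \<nu> b' z) b) \<le> cmod s * cmod ?p"
    by (rule weyl_sol_estimate[OF \<nu> b(1) weyl_sol_energy_nonpos[OF \<nu> s b]])
  moreover have "weyl_sol \<nu> z (weyl_quot \<nu> b' z) b = (weyl_quot \<nu> b' z - weyl_quot \<nu> b z) * ?p"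
    using p by (simp add: weyl_sol_def weyl_quot_def[of \<nu> b] algebra_simps)
  ultimately have "(?Q * cmod (weyl_quot \<nu> b' z - weyl_quot \<nu> b z)) * cmod ?p \<le> cmod s * cmod ?p"
    by (simp add: norm_mult mult.assoc)
  then have "?Q * cmod (weyl_quot \<nu> b' z - weyl_quot \<nu> b z) \<le> cmod s" using p by simp
  then show ?thesis using Q by (simp add: field_simps)
qed

text \<open>
  On a compact set \<open>Re (csqrt (- z))\<close> and the energy of \<open>frobenius \<nu> z\<close> at 1 have positive lower
  bounds, so the energy at \<open>b\<close> grows exponentially and uniformly in \<open>z\<close>.
\<close>

lemma weyl_quot_uniformly_Cauchy:
  assumes \<nu>: "0 \<le> \<nu>" "\<nu> < 1" and K: "compact K" "K \<subseteq> - \<real>\<^sub>\<ge>\<^sub>0"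
  obtains e where "(e \<longlongrightarrow> 0) at_top"
    "\<And>z b b'. z \<in> K \<Longrightarrow> 1 \<le> b \<Longrightarrow> b \<le> b' \<Longrightarrow> cmod (weyl_quot \<nu> b' z - weyl_quot \<nu> b z) \<le> e b"
proof (cases "K = {}")
  case True
  then show ?thesis using that[of "\<lambda>_. 0"] by simp
next
  case False
  define s where "s z = csqrt (- z)" for z
  let ?Q = "\<lambda>z x. energy (s z) (frobenius \<nu> z) (frobenius_quasi \<nu> z) x"
  have nn: "- z \<notin> \<real>\<^sub>\<le>\<^sub>0" if "z \<in> K" for z
    using that K by (auto simp: complex_nonpos_Reals_iff complex_nonneg_Reals_iff)
  have s2: "(s z)\<^sup>2 = - z" "Re (s z) > 0" if "z \<in> K" for z
    using that K csqrt_minus_Re_pos[of z] by (auto simp: s_def simp del: csqrt.simps)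
  have cs: "continuous_on K s"
    unfolding s_def by (rule continuous_on_compose2[OF continuous_on_csqrt]) (use nn in \<open>auto intro!: continuous_intros\<close>)
  have cont: "continuous_on K (entire_series c)" if "entire_coeffs c" for c
    using isCont_entire_series[OF that] by (auto intro: continuous_at_imp_continuous_on)
  have cQ: "continuous_on K (\<lambda>z. ?Q z 1)"
    unfolding energy_def frobenius_def frobenius_quasi_def
    using \<nu> by (auto intro!: continuous_intros cs cont entire_coeffs_intros)
  obtain z1 where z1: "z1 \<in> K" "\<And>z. z \<in> K \<Longrightarrow> Re (s z1) \<le> Re (s z)"
    using continuous_attains_inf[OF K(1) False, of "\<lambda>z. Re (s z)"] cs by (auto intro!: continuous_intros)
  obtain z2 where z2: "z2 \<in> K" "\<And>z. z \<in> K \<Longrightarrow> ?Q z2 1 \<le> ?Q z 1"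
    using continuous_attains_inf[OF K(1) False cQ] by auto
  obtain z3 where z3: "z3 \<in> K" "\<And>z. z \<in> K \<Longrightarrow> cmod (s z) \<le> cmod (s z3)"
    using continuous_attains_sup[OF K(1) False, of "\<lambda>z. cmod (s z)"] cs by (auto intro!: continuous_intros)
  define k c C where "k = 2 * Re (s z1)" and "c = ?Q z2 1" and "C = cmod (s z3)"
  have k: "k > 0" using s2[OF z1(1)] by (simp add: k_def)
  have c: "c > 0" unfolding c_def by (rule frobenius_energy_pos[OF \<nu>(1) s2[OF z2(1)]]) simp
  define e where "e b = C / c * exp (- (k * (b - 1)))" for b
  show ?thesis
  proof (rule that[of e])
    have "filterlim (\<lambda>b. k * (b - 1)) at_top at_top"
      using k by (intro filterlim_tendsto_pos_mult_at_top[OF tendsto_const] filterlim_at_top_add_at_top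
          filterlim_tendsto_add_at_top[of "\<lambda>_. -1", OF tendsto_const filterlim_ident, simplified add.commute add_uminus_conv_diff])
        auto
    then have "((\<lambda>b. exp (- (k * (b - 1)))) \<longlongrightarrow> 0) at_top"
      by (intro filterlim_compose[OF exp_at_bot] filterlim_compose[OF filterlim_uminus_at_bot_at_top])
    then have "(e \<longlongrightarrow> C / c * 0) at_top" unfolding e_def[abs_def] by (intro tendsto_intros)
    then show "(e \<longlongrightarrow> 0) at_top" by simp
  next
    fix z b b' assume z: "z \<in> K" and b: "1 \<le> (b::real)" "b \<le> b'"
    have sys: "bessel_system \<nu> z (frobenius \<nu> z) (frobenius_quasi \<nu> z)"
      using \<nu> by (intro bessel_system_frobenius) simp
    have "c * exp (k * (b - 1)) \<le> ?Q z 1 * exp (2 * Re (s z) * (b - 1))"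
    proof (rule mult_mono)
      show "c \<le> ?Q z 1" using z2 z by (simp add: c_def)
      show "exp (k * (b - 1)) \<le> exp (2 * Re (s z) * (b - 1))"
        using z1(2)[OF z] b by (auto simp: k_def intro!: mult_right_mono)
      show "0 \<le> ?Q z 1" using \<open>c \<le> ?Q z 1\<close> c by simp
    qed simp
    also have "\<dots> \<le> ?Q z b"
      using s2[OF z] b by (intro energy_exponential_growth[OF sys]) auto
    finally have Q: "c * exp (k * (b - 1)) \<le> ?Q z b" .
    have "cmod (weyl_quot \<nu> b' z - weyl_quot \<nu> b z) \<le> cmod (s z) / ?Q z b"
      using b by (intro weyl_quot_diff \<nu> s2 z) auto
    also have "\<dots> \<le> C / (c * exp (k * (b - 1)))"
      using Q c z3(2)[OF z] by (intro frac_le) (auto simp: C_def)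
    also have "\<dots> = e b" by (simp add: e_def exp_minus inverse_eq_divide)
    finally show "cmod (weyl_quot \<nu> b' z - weyl_quot \<nu> b z) \<le> e b" .
  qed
qed

definition weyl_limit :: "real \<Rightarrow> complex \<Rightarrow> complex" where
  "weyl_limit \<nu> z = Lim at_top (\<lambda>b. weyl_quot \<nu> b z)"

lemma weyl_quot_tendsto:
  assumes \<nu>: "0 \<le> \<nu>" "\<nu> < 1" and z: "z \<notin> \<real>\<^sub>\<ge>\<^sub>0"
  shows "((\<lambda>b. weyl_quot \<nu> b z) \<longlongrightarrow> weyl_limit \<nu> z) at_top"
proof -
  obtain e where e: "(e \<longlongrightarrow> 0) at_top"
    "\<And>b b'. 1 \<le> b \<Longrightarrow> b \<le> b' \<Longrightarrow> cmod (weyl_quot \<nu> b' z - weyl_quot \<nu> b z) \<le> e b"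
    by (rule weyl_quot_uniformly_Cauchy[OF \<nu>, of "{z}"]) (use z in auto)
  have en: "((\<lambda>n. e (real n)) \<longlongrightarrow> 0) sequentially"
    by (rule filterlim_compose[OF e(1) filterlim_real_sequentially])
  have "Cauchy (\<lambda>n. weyl_quot \<nu> (real n) z)"
  proof (rule CauchyI')
    fix d :: real assume "d > 0"
    then have "eventually (\<lambda>n. e (real n) < d \<and> 1 \<le> real n) sequentially"
      using order_tendstoD(2)[OF en] eventually_ge_at_top[of 1]
      by (intro eventually_conj) (auto elim: eventually_mono)
    then obtain M where M: "\<And>n. n \<ge> M \<Longrightarrow> e (real n) < d \<and> 1 \<le> real n"
      by (auto simp: eventually_sequentially)
    show "\<exists>M. \<forall>m\<ge>M. \<forall>n>m. dist (weyl_quot \<nu> (real m) z) (weyl_quot \<nu> (real n) z) < d"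
    proof (intro exI allI impI)
      fix m n assume "M \<le> m" "m < n"
      then show "dist (weyl_quot \<nu> (real m) z) (weyl_quot \<nu> (real n) z) < d"
        using e(2)[of "real m" "real n"] M[of m] by (simp add: dist_norm norm_minus_commute)
    qed
  qed
  then obtain l where l: "(\<lambda>n. weyl_quot \<nu> (real n) z) \<longlonglongrightarrow> l"
    using Cauchy_convergent convergent_def by blast
  have "cmod (weyl_quot \<nu> b z - l) \<le> e b" if "1 \<le> b" for b
  proof -
    have "(\<lambda>n. cmod (weyl_quot \<nu> (real n) z - weyl_quot \<nu> b z)) \<longlonglongrightarrow> cmod (l - weyl_quot \<nu> b z)"
      by (intro tendsto_intros l)
    moreover have "eventually (\<lambda>n. cmod (weyl_quot \<nu> (real n) z - weyl_quot \<nu> b z) \<le> e b) sequentially"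
      using filterlim_real_sequentially eventually_ge_at_top[of b]
      unfolding filterlim_at_top by (auto elim!: eventually_mono intro!: e(2) that)
    ultimately have "cmod (l - weyl_quot \<nu> b z) \<le> e b"
      by (rule tendsto_upperbound) simp
    then show ?thesis by (simp add: norm_minus_commute)
  qed
  then have "((\<lambda>b. weyl_quot \<nu> b z - l) \<longlongrightarrow> 0) at_top"
    by (intro Lim_null_comparison[OF _ e(1)] eventually_mono[OF eventually_ge_at_top[of 1]])
  then have "((\<lambda>b. weyl_quot \<nu> b z) \<longlongrightarrow> l) at_top" by (simp add: LIM_zero_iff)
  moreover from this have "weyl_limit \<nu> z = l"
    unfolding weyl_limit_def by (intro tendsto_Lim) auto
  ultimately show ?thesis by simp
qed

lemma weyl_quot_uniform_limit:
  assumes \<nu>: "0 \<le> \<nu>" "\<nu> < 1" and K: "compact K" "K \<subseteq> - \<real>\<^sub>\<ge>\<^sub>0"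
  shows "uniform_limit K (weyl_quot \<nu>) (weyl_limit \<nu>) at_top"
proof -
  obtain e where e: "(e \<longlongrightarrow> 0) at_top"
    "\<And>z b b'. z \<in> K \<Longrightarrow> 1 \<le> b \<Longrightarrow> b \<le> b' \<Longrightarrow> cmod (weyl_quot \<nu> b' z - weyl_quot \<nu> b z) \<le> e b"
    using weyl_quot_uniformly_Cauchy[OF \<nu> K] by blast
  have le: "cmod (weyl_quot \<nu> b z - weyl_limit \<nu> z) \<le> e b" if "1 \<le> b" "z \<in> K" for b z
  proof -
    have "((\<lambda>b'. cmod (weyl_quot \<nu> b' z - weyl_quot \<nu> b z)) \<longlongrightarrow> cmod (weyl_limit \<nu> z - weyl_quot \<nu> b z)) at_top"
      using that K by (intro tendsto_intros weyl_quot_tendsto \<nu>) auto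
    moreover have "eventually (\<lambda>b'. cmod (weyl_quot \<nu> b' z - weyl_quot \<nu> b z) \<le> e b) at_top"
      using that by (intro eventually_mono[OF eventually_ge_at_top[of b]] e(2))
    ultimately have "cmod (weyl_limit \<nu> z - weyl_quot \<nu> b z) \<le> e b"
      by (rule tendsto_upperbound) simp
    then show ?thesis by (simp add: norm_minus_commute)
  qed
  show ?thesis
  proof (rule uniform_limitI)
    fix d :: real assume "d > 0"
    then have "eventually (\<lambda>b. e b < d) at_top" using order_tendstoD(2)[OF e(1)] by blast
    then show "eventually (\<lambda>b. \<forall>z\<in>K. dist (weyl_quot \<nu> b z) (weyl_limit \<nu> z) < d) at_top"
      using eventually_ge_at_top[of 1]
    proof eventually_elim
      case (elim b)
      then show ?case using le by (auto simp: dist_norm intro: le_less_trans)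
    qed
  qed
qed

lemma open_cut_plane: "open (- \<real>\<^sub>\<ge>\<^sub>0 :: complex set)"
  using closed_nonneg_Reals_complex by (simp add: open_Compl)

lemma weyl_quot_holomorphic:
  assumes \<nu>: "0 \<le> \<nu>" "\<nu> < 1" and b: "b > 0"
  shows "weyl_quot \<nu> b holomorphic_on - \<real>\<^sub>\<ge>\<^sub>0"
proof -
  have nz: "frobenius \<nu> z b \<noteq> 0" if "z \<in> - \<real>\<^sub>\<ge>\<^sub>0" for z
    using that csqrt_minus_Re_pos[of z] b by (intro frobenius_nonzero[of _ "csqrt (-z)"] \<nu>) auto
  have s: "(\<lambda>z. singular \<nu> z b) holomorphic_on - \<real>\<^sub>\<ge>\<^sub>0"
    unfolding singular_def log_solution_def frobenius_def
    using \<nu> by (cases "\<nu> = 0") (auto intro!: holomorphic_intros entire_coeffs_intros)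
  have p: "(\<lambda>z. frobenius \<nu> z b) holomorphic_on - \<real>\<^sub>\<ge>\<^sub>0"
    unfolding frobenius_def using \<nu> by (auto intro!: holomorphic_intros entire_coeffs_intros)
  show ?thesis
    unfolding weyl_quot_def using s p nz by (intro holomorphic_intros) auto
qed

lemma weyl_limit_holomorphic:
  assumes \<nu>: "0 \<le> \<nu>" "\<nu> < 1"
  shows "weyl_limit \<nu> holomorphic_on - \<real>\<^sub>\<ge>\<^sub>0"
proof (rule holomorphic_uniform_sequence[OF open_cut_plane])
  show "weyl_quot \<nu> (real (Suc n)) holomorphic_on - \<real>\<^sub>\<ge>\<^sub>0" for n
    by (rule weyl_quot_holomorphic[OF \<nu>]) simp
next
  fix x :: complex assume "x \<in> - \<real>\<^sub>\<ge>\<^sub>0"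
  then obtain d where d: "d > 0" "cball x d \<subseteq> - \<real>\<^sub>\<ge>\<^sub>0"
    using open_cut_plane open_contains_cball by blast
  have "filterlim (\<lambda>n. real (Suc n)) at_top sequentially"
    by (rule filterlim_compose[OF filterlim_real_sequentially filterlim_Suc])
  then have "uniform_limit (cball x d) (\<lambda>n. weyl_quot \<nu> (real (Suc n))) (weyl_limit \<nu>) sequentially"
    using filterlim_compose[OF weyl_quot_uniform_limit[OF \<nu> compact_cball d(2)]] by blast
  then show "\<exists>d>0. cball x d \<subseteq> - \<real>\<^sub>\<ge>\<^sub>0 \<and>
      uniform_limit (cball x d) (\<lambda>n. weyl_quot \<nu> (real (Suc n))) (weyl_limit \<nu>) sequentially"
    using d by blast
qed

section \<open>Homogeneity of the limit\<close>

text \<open>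
  Apart from the powers and the logarithm of \<open>x\<close>, the solutions depend on \<open>z x\<^sup>2\<close> only.
\<close>

lemma weyl_quot_scaling:
  assumes t: "t > 0" and b: "b > 0" and nz: "frobenius \<nu> z (t * b) \<noteq> 0"
  shows "weyl_quot \<nu> b (z * of_real (t\<^sup>2)) =
    (if \<nu> = 0 then weyl_quot \<nu> (t * b) z - of_real (ln t)
     else of_real (t powr (2 * \<nu>)) * weyl_quot \<nu> (t * b) z)"
proof -
  have Z: "z * of_real (t\<^sup>2) * of_real (b\<^sup>2) = z * of_real ((t * b)\<^sup>2)" by (simp add: power_mult_distrib)
  show ?thesis
  proof (cases "\<nu> = 0")
    case True
    have "bessel_E 0 (z * of_real ((t * b)\<^sup>2)) \<noteq> 0" using nz t b by (simp add: True frobenius_def)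
    moreover have "ln (t * b) = ln t + ln b" using t b by (rule ln_mult_pos)
    ultimately show ?thesis using t b
      by (simp add: True weyl_quot_def singular_def log_solution_def frobenius_def Z del: of_real_mult of_real_power)
        (simp add: field_simps)
  next
    case False
    have ne: "t powr \<nu> \<noteq> 0" "b powr \<nu> \<noteq> 0" using t b by auto
    have "t powr (2 * \<nu>) * (t powr - \<nu> / t powr \<nu>) = 1" using t
      by (simp flip: powr_add powr_diff)
    then have *: "complex_of_real (t powr (2 * \<nu>)) * (of_real (t powr - \<nu>) / of_real (t powr \<nu>)) = 1"
      by (simp only: of_real_1 flip: of_real_mult of_real_divide)
    have split: "(t * b) powr \<mu> = t powr \<mu> * b powr \<mu>" for \<mu> using t b by (simp add: powr_mult)
    have "(T2 * (Tm / Tp)) * (- (Bm * e / n) / (Bp * f)) = T2 * (- (Tm * Bm * e / n) / (Tp * Bp * f))"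
      for T2 Tm Bm e n Tp Bp f :: complex by (simp add: mult_ac)
    from this[of "of_real (t powr (2 * \<nu>))" "of_real (t powr - \<nu>)" "of_real (t powr \<nu>)" "of_real (b powr - \<nu>)"
       "bessel_E (-\<nu>) (z * of_real ((t * b)\<^sup>2))" "of_real (2 * \<nu>)" "of_real (b powr \<nu>)" "bessel_E \<nu> (z * of_real ((t * b)\<^sup>2))"]
    show ?thesis
      unfolding * by (simp only: False weyl_quot_def singular_def frobenius_def Z split of_real_mult if_False) simp
  qed
qed

lemma weyl_limit_scaling:
  assumes \<nu>: "0 \<le> \<nu>" "\<nu> < 1" and z: "z \<notin> \<real>\<^sub>\<ge>\<^sub>0" and t: "t > 0"
  shows "weyl_limit \<nu> (z * of_real (t\<^sup>2)) =
    (if \<nu> = 0 then weyl_limit \<nu> z - of_real (ln t) else of_real (t powr (2 * \<nu>)) * weyl_limit \<nu> z)"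
proof -
  have "z * of_real (t\<^sup>2) \<notin> \<real>\<^sub>\<ge>\<^sub>0"
    using z t by (auto simp: complex_nonneg_Reals_iff zero_le_mult_iff simp flip: of_real_power)
  then have lim: "((\<lambda>b. weyl_quot \<nu> b (z * of_real (t\<^sup>2))) \<longlongrightarrow> weyl_limit \<nu> (z * of_real (t\<^sup>2))) at_top"
    by (rule weyl_quot_tendsto[OF \<nu>])
  have lim': "((\<lambda>b. if \<nu> = 0 then weyl_quot \<nu> (t * b) z - of_real (ln t)
     else of_real (t powr (2 * \<nu>)) * weyl_quot \<nu> (t * b) z) \<longlongrightarrow>
     (if \<nu> = 0 then weyl_limit \<nu> z - of_real (ln t) else of_real (t powr (2 * \<nu>)) * weyl_limit \<nu> z)) at_top"
  proof -
    have "filterlim (\<lambda>b. t * b) at_top at_top"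
      using t by (intro filterlim_tendsto_pos_mult_at_top[OF tendsto_const _ filterlim_ident])
    from filterlim_compose[OF weyl_quot_tendsto[OF \<nu> z] this]
    have "((\<lambda>b. weyl_quot \<nu> (t * b) z) \<longlongrightarrow> weyl_limit \<nu> z) at_top" .
    then show ?thesis by (cases "\<nu> = 0") (auto intro!: tendsto_intros)
  qed
  have ev: "eventually (\<lambda>b. weyl_quot \<nu> b (z * of_real (t\<^sup>2)) = (if \<nu> = 0 then weyl_quot \<nu> (t * b) z - of_real (ln t)
     else of_real (t powr (2 * \<nu>)) * weyl_quot \<nu> (t * b) z)) at_top"
    using eventually_gt_at_top[of 0]
  proof eventually_elim
    case (elim b)
    have "frobenius \<nu> z (t * b) \<noteq> 0"
      using t elim csqrt_minus_Re_pos[OF z] by (intro frobenius_nonzero[of _ "csqrt (-z)"] \<nu>) auto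
    then show ?case by (rule weyl_quot_scaling[OF t elim])
  qed
  show ?thesis
    by (rule tendsto_unique[OF trivial_limit_at_top_linorder lim
          tendsto_cong[OF ev, THEN iffD2, OF lim']])
qed

section \<open>Modified Bessel functions at infinity\<close>

text \<open>
  Logarithmic convexity of the Gamma function between \<open>y\<close> and \<open>y + 1\<close>.
\<close>

lemma Gamma_shift_le:
  fixes y a :: real
  assumes y: "y > 0" and a: "0 \<le> a" "a \<le> 1"
  shows "Gamma (y + a) \<le> y powr a * Gamma y"
proof -
  have "(ln \<circ> Gamma) ((1 - a) * y + a * (y + 1)) \<le> (1 - a) * (ln \<circ> Gamma) y + a * (ln \<circ> Gamma) (y + 1)"
    using convex_onD[OF log_convex_Gamma_real, of a y "y + 1"] y a by simp
  moreover have "(1 - a) * y + a * (y + 1) = y + a" by (simp add: algebra_simps)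
  moreover have "ln (Gamma (y + 1)) = ln y + ln (Gamma y)"
  proof -
    have "Gamma (y + 1) = y * Gamma y" using y by (intro Gamma_plus1) (auto elim!: nonpos_Ints_cases')
    then show ?thesis using y by (simp add: ln_mult_pos Gamma_real_pos)
  qed
  ultimately have "ln (Gamma (y + a)) \<le> a * ln y + ln (Gamma y)"
    by (simp add: algebra_simps)
  also have "\<dots> = ln (y powr a * Gamma y)"
    using y by (simp add: ln_mult_pos ln_powr Gamma_real_pos)
  finally show ?thesis
    using y a Gamma_real_pos[of y] Gamma_real_pos[of "y + a"] by (subst (asm) ln_le_cancel_iff) auto
qed

lemma Gamma_ratio_le:
  fixes x a :: real
  assumes a: "0 \<le> a" "a \<le> 2" and x: "x - a > 0" "x \<ge> 1"
  shows "Gamma x \<le> x powr a * Gamma (x - a)"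
proof (cases "a \<le> 1")
  case True
  have "Gamma x \<le> (x - a) powr a * Gamma (x - a)" using Gamma_shift_le[of "x - a" a] True a x by simp
  also have "\<dots> \<le> x powr a * Gamma (x - a)"
    using a x Gamma_real_pos[of "x - a"] by (intro mult_right_mono powr_mono2) auto
  finally show ?thesis .
next
  case False
  have "x - 1 > 0" using False x by simp
  then have "x - 1 \<notin> \<int>\<^sub>\<le>\<^sub>0" by (meson nonpos_Ints_nonpos not_less)
  then have "Gamma x = (x - 1) * Gamma (x - 1)" using Gamma_plus1[of "x - 1"] by simp
  also have "Gamma (x - 1) \<le> (x - a) powr (a - 1) * Gamma (x - a)"
    using Gamma_shift_le[of "x - a" "a - 1"] False a x by simp
  also have "(x - a) powr (a - 1) * Gamma (x - a) \<le> x powr (a - 1) * Gamma (x - a)"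
    using False a x Gamma_real_pos[of "x - a"] by (intro mult_right_mono powr_mono2) auto
  also have "(x - 1) * (x powr (a - 1) * Gamma (x - a)) \<le> x * (x powr (a - 1) * Gamma (x - a))"
    using x Gamma_real_pos[of "x - a"] by (intro mult_right_mono) auto
  also have "\<dots> = x powr a * Gamma (x - a)" using x by (simp add: powr_diff)
  finally show ?thesis using x by (simp add: mult_left_mono)
qed

text \<open>
  The graph of a concave power lies below its tangent at 1; this replaces Jensen's inequality.
\<close>

lemma powr_le_tangent:
  fixes x a :: real
  assumes "x > 0" "0 \<le> a" "a \<le> 1"
  shows "x powr a \<le> 1 - a + a * x"
proof -
  have "x powr a * 1 powr (1 - a) \<le> a * x + (1 - a) * 1"
    using assms by (intro Youngs_inequality_0) auto
  then show ?thesis by simp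
qed

definition mod_term :: "real \<Rightarrow> real \<Rightarrow> nat \<Rightarrow> real" where
  "mod_term \<mu> Y k = Y ^ k / (fact k * Gamma (real k + 1 + \<mu>))"

text \<open>
  In terms of the modified Bessel function this is \<open>Y powr (- \<mu> / 2) * I\<^sub>\<mu>(2 * sqrt Y)\<close>.
\<close>

definition mod_series :: "real \<Rightarrow> real \<Rightarrow> real" where
  "mod_series \<mu> Y = (\<Sum>k. mod_term \<mu> Y k)"

lemma bessel_coeff_mod_term:
  assumes "\<mu> > -1"
  shows "bessel_coeff \<mu> k * of_real (- (4 * Y)) ^ k = of_real (Gamma (1 + \<mu>) * mod_term \<mu> Y k)"
proof -
  have "1 + \<mu> \<notin> \<int>\<^sub>\<le>\<^sub>0" using assms by (auto elim!: nonpos_Ints_cases')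
  then have "pochhammer (1 + \<mu>) k = Gamma (1 + \<mu> + real k) / Gamma (1 + \<mu>)" by (rule pochhammer_Gamma)
  then have G: "Gamma (real k + 1 + \<mu>) = pochhammer (1 + \<mu>) k * Gamma (1 + \<mu>)"
    using Gamma_real_pos[of "1 + \<mu>"] assms by (cases "Gamma (1 + \<mu>) = 0") (auto simp: add_ac)
  have "Gamma (1 + \<mu>) > 0" using assms by (intro Gamma_real_pos) simp
  then have "Gamma (1 + \<mu>) * mod_term \<mu> Y k = Y ^ k / (fact k * pochhammer (1 + \<mu>) k)"
    unfolding mod_term_def G by simp
  moreover have "(-1) ^ k / (4 ^ k * fact k * pochhammer (1 + \<mu>) k) * (- (4 * Y)) ^ k = Y ^ k / (fact k * pochhammer (1 + \<mu>) k)"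
  proof -
    have "- (4 * Y) = (-1) * (4 * Y)" by simp
    then have "(- (4 * Y)) ^ k = (-1) ^ k * (4 ^ k * Y ^ k)" by (simp only: power_mult_distrib)
    moreover have "s / (q * f * P) * (s * (q * y)) = y / (f * P)" if "s * s = 1" "q \<noteq> 0" for s q f P y :: real
    proof -
      have "s / (q * f * P) * (s * (q * y)) = (s * s) * (q / q) * (y / (f * P))" by (simp add: mult_ac)
      then show ?thesis using that by simp
    qed
    from this[of "(-1) ^ k" "4 ^ k"] have "(-1) ^ k / (4 ^ k * f * P) * ((-1) ^ k * (4 ^ k * y)) = y / (f * P)"
      for f P y :: real by (simp flip: power_add power2_eq_square)
    ultimately show ?thesis by (simp only:)
  qed
  ultimately show ?thesis unfolding bessel_coeff_def by (simp only: flip: of_real_mult of_real_power)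
qed

lemma mod_term_sums:
  assumes "\<mu> > -1"
  shows "mod_term \<mu> Y sums mod_series \<mu> Y"
    and "bessel_E \<mu> (of_real (- (4 * Y))) = of_real (Gamma (1 + \<mu>) * mod_series \<mu> Y)"
proof -
  have 0: "(\<lambda>k. complex_of_real (Gamma (1 + \<mu>) * mod_term \<mu> Y k)) sums bessel_E \<mu> (of_real (- (4 * Y)))"
    using entire_series_sums[OF entire_coeffs_bessel[OF assms], of "of_real (- (4 * Y))"]
    by (simp only: bessel_coeff_mod_term[OF assms])
  from 0 have 1: "(\<lambda>k. Gamma (1 + \<mu>) * mod_term \<mu> Y k) sums Re (bessel_E \<mu> (of_real (- (4 * Y))))"
    using sums_Re by fastforce
  have "Gamma (1 + \<mu>) > 0" using assms by (intro Gamma_real_pos) simp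
  then have G: "Gamma (1 + \<mu>) \<noteq> 0" by simp
  have "summable (mod_term \<mu> Y)"
    using summable_mult[OF sums_summable[OF 1], of "1 / Gamma (1 + \<mu>)"] G by simp
  then show s: "mod_term \<mu> Y sums mod_series \<mu> Y" unfolding mod_series_def by (rule summable_sums)
  from sums_of_real[OF sums_mult[OF s, of "Gamma (1 + \<mu>)"], where 'a = complex]
  show "bessel_E \<mu> (of_real (- (4 * Y))) = of_real (Gamma (1 + \<mu>) * mod_series \<mu> Y)"
    by (rule sums_unique2[OF 0])
qed

lemma mod_term_pos: "\<mu> > -1 \<Longrightarrow> Y > 0 \<Longrightarrow> mod_term \<mu> Y k > 0"
  unfolding mod_term_def by (auto intro!: divide_pos_pos mult_pos_pos Gamma_real_pos)

lemma mod_series_pos: "\<mu> > -1 \<Longrightarrow> Y > 0 \<Longrightarrow> mod_series \<mu> Y > 0"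
  unfolding mod_series_def
  by (rule suminf_pos[OF sums_summable[OF mod_term_sums(1)]]) (auto intro: mod_term_pos)

lemma mod_term_Suc:
  assumes "\<mu> > -1"
  shows "real (Suc k) * (real (Suc k) + \<mu>) * mod_term \<mu> Y (Suc k) = Y * mod_term \<mu> Y k"
proof -
  have "Gamma (real k + 1 + \<mu> + 1) = (real k + 1 + \<mu>) * Gamma (real k + 1 + \<mu>)"
    using assms by (intro Gamma_plus1) (auto elim!: nonpos_Ints_cases')
  then have G: "Gamma (real (Suc k) + 1 + \<mu>) = (real (Suc k) + \<mu>) * Gamma (real k + 1 + \<mu>)"
    by (simp add: add_ac)
  have pos: "real (Suc k) + \<mu> > 0" "real (Suc k) > 0" using assms by auto
  have "K * L * (Y * y / (K * f * (L * g))) = Y * (y / (f * g))" if "K > 0" "L > 0" for K L y f g :: real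
    using that by simp
  from this[OF pos(2,1)] show ?thesis
    unfolding mod_term_def G by (simp del: of_nat_Suc)
qed

text \<open>
  With respect to the weights \<open>mod_term \<mu> Y k\<close>, the mean of \<open>k * (k + \<mu>)\<close> is exactly \<open>Y\<close>. The
  estimates below use the concentration of the weights near \<open>k = sqrt Y\<close> in this form.
\<close>

lemma mod_term_moment:
  assumes "\<mu> > -1"
  shows "(\<lambda>k. real k * (real k + \<mu>) * mod_term \<mu> Y k) sums (Y * mod_series \<mu> Y)"
proof -
  have "(\<lambda>k. real (Suc k) * (real (Suc k) + \<mu>) * mod_term \<mu> Y (Suc k)) sums (Y * mod_series \<mu> Y)"
    unfolding mod_term_Suc[OF assms] by (intro sums_mult mod_term_sums assms)
  from this[THEN sums_Suc_iff[THEN iffD1]] show ?thesis by simp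
qed

lemma le_square_mean:
  fixes k r :: real
  assumes "r > 0"
  shows "k \<le> (k * k / r + r) / 2"
proof -
  have "0 \<le> (k - r)\<^sup>2 / r" using assms by simp
  also have "(k - r)\<^sup>2 / r = k * k / r + r - 2 * k"
    using assms by (simp add: power2_eq_square field_simps)
  finally show ?thesis by simp
qed

text \<open>
  This is the estimate \<open>I\<^sub>\<mu>\<^sub>-\<^sub>a(x) \<le> (1 + O(1/x)) * I\<^sub>\<mu>(x)\<close>. The quotients of corresponding terms are at
  most \<open>(k + 1 + \<mu>) powr a\<close>. As \<open>a \<le> 2\<close>, this is a concave function of \<open>(k + 1 + \<mu>)\<^sup>2\<close>, so
  its mean is controlled by the first moment.
\<close>

lemma mod_series_lower_order:
  assumes \<mu>: "\<mu> \<ge> 0" and a: "0 \<le> a" "a \<le> 2" "\<mu> - a > -1" and Y: "Y \<ge> 1"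
  shows "mod_series (\<mu> - a) Y \<le> Y powr (a/2) * (1 + (2 + \<mu> + (1 + \<mu>)\<^sup>2) / sqrt Y) * mod_series \<mu> Y"
proof -
  let ?w = "mod_term \<mu> Y" and ?S = "mod_series \<mu> Y" and ?c = "1 + \<mu>" and ?r = "sqrt Y"
  define v where "v k = real k * (real k + \<mu>) * ?w k" for k
  \<comment> \<open>\<open>A\<close> and \<open>B\<close> bound \<open>(k + 1 + \<mu>)\<^sup>2\<close> by \<open>A * (k * (k + \<mu>)) + B\<close>: the linear term in \<open>k\<close> is
    absorbed by \<open>2 * k \<le> k\<^sup>2 / ?r + ?r\<close>, which is sharp where \<open>k\<close> is near \<open>sqrt Y\<close>.\<close>
  define A where "A = 1 + (2 + \<mu>) / (2 * ?r)"
  define B where "B = (2 + \<mu>) * ?r / 2 + ?c\<^sup>2"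
  have w: "?w k > 0" for k using \<mu> Y by (intro mod_term_pos) auto
  have r: "?r \<ge> 1" "?r * ?r = Y" using Y by auto
  have term_le: "mod_term (\<mu> - a) Y k \<le> Y powr (a/2) * ((1 - a/2) * ?w k + a/2/Y * (A * v k + B * ?w k))" for k
  proof -
    let ?x = "real k + 1 + \<mu>"
    have x: "?x \<ge> 1" "?x - a > 0" using \<mu> a by auto
    have G: "Gamma ?x > 0" "Gamma (?x - a) > 0" using x by (auto intro!: Gamma_real_pos)
    have "mod_term (\<mu> - a) Y k = Y ^ k / (fact k * Gamma (?x - a))"
      by (simp add: mod_term_def algebra_simps)
    also have "\<dots> = ?w k * (Gamma ?x / Gamma (?x - a))" using G by (simp add: mod_term_def)
    also have "\<dots> \<le> ?w k * ?x powr a"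
      using Gamma_ratio_le[of a ?x] a x G w[of k] by (intro mult_left_mono) (auto simp: field_simps)
    also have "?x powr a = Y powr (a/2) * (?x\<^sup>2 / Y) powr (a/2)"
    proof -
      have "(?x\<^sup>2) powr (a/2) = ?x powr a"
        using x by (simp add: powr_powr flip: powr_numeral)
      then show ?thesis using x Y by (simp add: powr_divide)
    qed
    also have "(?x\<^sup>2 / Y) powr (a/2) \<le> 1 - a/2 + a/2 * (?x\<^sup>2 / Y)"
      using x Y a by (intro powr_le_tangent) auto
    finally have 1: "mod_term (\<mu> - a) Y k \<le> ?w k * (Y powr (a/2) * (1 - a/2 + a/2 * (?x\<^sup>2 / Y)))"
      using w[of k] Y by (simp add: mult_left_mono)
    have "?x\<^sup>2 \<le> A * (real k * (real k + \<mu>)) + B"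
    proof -
      have "?x\<^sup>2 = real k * (real k + \<mu>) + (2 + \<mu>) * real k + ?c\<^sup>2"
        by (simp add: power2_eq_square algebra_simps)
      also have "\<dots> \<le> real k * (real k + \<mu>) + (2 + \<mu>) * ((real k * (real k + \<mu>) / ?r + ?r) / 2) + ?c\<^sup>2"
      proof -
        have "real k \<le> (real k * real k / ?r + ?r) / 2" using r by (intro le_square_mean) simp
        also have "\<dots> \<le> (real k * (real k + \<mu>) / ?r + ?r) / 2"
          using \<mu> r by (intro divide_right_mono add_right_mono mult_left_mono) auto
        finally show ?thesis using \<mu> by (intro add_right_mono add_left_mono mult_left_mono) auto
      qed
      also have "\<dots> = A * (real k * (real k + \<mu>)) + B"
      proof -
        have "q + (2 + m) * ((q / t + t) / 2) + c = (1 + (2 + m) / (2 * t)) * q + ((2 + m) * t / 2 + c)"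
          if "t > 0" for q m t c :: real using that by (simp add: field_simps)
        from this[of ?r "real k * (real k + \<mu>)" "\<mu>" "?c\<^sup>2"]
        have "0 < ?r \<longrightarrow> real k * (real k + \<mu>) + (2 + \<mu>) * ((real k * (real k + \<mu>) / ?r + ?r) / 2) + ?c\<^sup>2
          = A * (real k * (real k + \<mu>)) + B" unfolding A_def B_def by blast
        moreover have "0 < ?r" using r(1) by linarith
        ultimately show ?thesis by blast
      qed
      finally show ?thesis .
    qed
    then have "a/2 * (?x\<^sup>2 / Y) \<le> a/2 * ((A * (real k * (real k + \<mu>)) + B) / Y)"
      using a Y by (intro mult_left_mono divide_right_mono) auto
    then have "?w k * (Y powr (a/2) * (1 - a/2 + a/2 * (?x\<^sup>2 / Y)))
      \<le> ?w k * (Y powr (a/2) * (1 - a/2 + a/2 * ((A * (real k * (real k + \<mu>)) + B) / Y)))"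
      using w[of k] by (intro mult_left_mono) auto
    also have "\<dots> = Y powr (a/2) * ((1 - a/2) * ?w k + a/2/Y * (A * v k + B * ?w k))"
      unfolding v_def using Y by (simp add: field_simps)
    finally show ?thesis using 1 by linarith
  qed
  have s1: "mod_term (\<mu> - a) Y sums mod_series (\<mu> - a) Y" using a by (intro mod_term_sums)
  have s2: "?w sums ?S" using \<mu> by (intro mod_term_sums) simp
  have s3: "v sums (Y * ?S)" unfolding v_def using \<mu> by (intro mod_term_moment) simp
  have "(\<lambda>k. Y powr (a/2) * ((1 - a/2) * ?w k + a/2/Y * (A * v k + B * ?w k))) sums
     (Y powr (a/2) * ((1 - a/2) * ?S + a/2/Y * (A * (Y * ?S) + B * ?S)))"
    by (intro sums_mult sums_add s2 s3)
  from sums_le[OF term_le s1 this]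
  have "mod_series (\<mu> - a) Y \<le> Y powr (a/2) * ((1 - a/2) * ?S + a/2/Y * (A * (Y * ?S) + B * ?S))" .
  also have "(1 - a/2) * ?S + a/2/Y * (A * (Y * ?S) + B * ?S)
      = (1 + a/2 * (((2 + \<mu>) * ?r + ?c\<^sup>2) / Y)) * ?S"
  proof -
    have "A * Y + B = Y + (2 + \<mu>) * ?r + ?c\<^sup>2"
    proof -
      have "(1 + m / (2 * t)) * (t * t) = t * t + m * t / 2" if "t > 0" for m t :: real
        using that by (simp add: field_simps)
      from this[of ?r "2 + \<mu>"] have "A * Y = Y + (2 + \<mu>) * ?r / 2"
        unfolding A_def using r Y by (simp only: r(2); simp?)
      then show ?thesis by (simp add: B_def)
    qed
    then have "A * (Y * ?S) + B * ?S = (Y + (2 + \<mu>) * ?r + ?c\<^sup>2) * ?S"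
      by (metis distrib_right mult.assoc)
    then show ?thesis using Y by (simp add: field_simps)
  qed
  also have "\<dots> \<le> (1 + (2 + \<mu> + ?c\<^sup>2) / ?r) * ?S"
  proof -
    have "((2 + \<mu>) * ?r + ?c\<^sup>2) / Y \<le> ((2 + \<mu>) * ?r + ?c\<^sup>2 * ?r) / Y"
      using r Y \<mu> mult_left_mono[OF r(1), of "?c\<^sup>2"] by (intro divide_right_mono) auto
    also have "\<dots> = (2 + \<mu> + ?c\<^sup>2) / ?r"
    proof -
      have "(m * t + c * t) / (t * t) = (m + c) / t" if "t > 0" for m c t :: real
        using that by (simp add: field_simps)
      from this[of ?r "2 + \<mu>" "?c\<^sup>2"] show ?thesis using r Y by (simp only: r(2); simp?)
    qed
    finally have "((2 + \<mu>) * ?r + ?c\<^sup>2) / Y \<le> (2 + \<mu> + ?c\<^sup>2) / ?r" .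
    moreover have "0 \<le> (2 + \<mu> + ?c\<^sup>2) / ?r" using \<mu> r by simp
    moreover have "0 \<le> ((2 + \<mu>) * ?r + ?c\<^sup>2) / Y" using \<mu> Y by simp
    ultimately have "a/2 * (((2 + \<mu>) * ?r + ?c\<^sup>2) / Y) \<le> 1 * ((2 + \<mu> + ?c\<^sup>2) / ?r)"
      using a by (intro mult_mono) auto
    moreover have "?S > 0" using \<mu> Y by (intro mod_series_pos) auto
    ultimately show ?thesis by (intro mult_right_mono) auto
  qed
  finally show ?thesis by (simp add: mult_left_mono mult.assoc)
qed

text \<open>
  This is \<open>I\<^sub>2\<^sub>-\<^sub>\<nu> \<le> I\<^sub>-\<^sub>\<nu>\<close>, which holds termwise after a shift of the index by one.
\<close>

lemma mod_series_step:
  assumes "0 < \<nu>" "\<nu> < 1" "Y > 0"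
  shows "Y * mod_series (2 - \<nu>) Y \<le> mod_series (- \<nu>) Y"
proof -
  have "mod_term (-\<nu>) Y sums mod_series (-\<nu>) Y" using assms by (intro mod_term_sums) auto
  then have "(\<lambda>k. mod_term (-\<nu>) Y (Suc k)) sums (mod_series (-\<nu>) Y - mod_term (-\<nu>) Y 0)"
    by (subst sums_Suc_iff) simp
  moreover have "(\<lambda>k. Y * mod_term (2-\<nu>) Y k) sums (Y * mod_series (2-\<nu>) Y)"
    using assms by (intro sums_mult mod_term_sums) auto
  moreover have "Y * mod_term (2-\<nu>) Y k \<le> mod_term (-\<nu>) Y (Suc k)" for k
  proof -
    let ?x = "real k + 2 - \<nu>"
    have x: "?x \<ge> real k + 1" "?x > 0" using assms by auto
    have "Gamma (?x + 1) = ?x * Gamma ?x" using x by (intro Gamma_plus1) (auto elim!: nonpos_Ints_cases')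
    then have G: "Gamma (real k + 1 + (2 - \<nu>)) = ?x * Gamma ?x" by (simp add: algebra_simps)
    have G2: "Gamma (real (Suc k) + 1 + - \<nu>) = Gamma ?x" by (simp add: algebra_simps)
    have "fact (Suc k) * Gamma ?x \<le> fact k * (?x * Gamma ?x)"
      using x Gamma_real_pos[of ?x] by (simp add: mult_ac mult_left_mono)
    moreover have "fact (Suc k) * Gamma ?x > 0" using x Gamma_real_pos[of ?x] by (intro mult_pos_pos) auto
    ultimately have "Y ^ Suc k / (fact k * (?x * Gamma ?x)) \<le> Y ^ Suc k / (fact (Suc k) * Gamma ?x)"
      using assms by (intro divide_left_mono mult_pos_pos) auto
    then show ?thesis unfolding mod_term_def G G2 by simp
  qed
  ultimately have "Y * mod_series (2-\<nu>) Y \<le> mod_series (-\<nu>) Y - mod_term (-\<nu>) Y 0"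
    by (meson sums_le)
  then show ?thesis using mod_term_pos[of "-\<nu>" Y 0] assms by simp
qed

text \<open>
  That is, \<open>I\<^sub>-\<^sub>\<nu> / I\<^sub>\<nu>\<close> tends to 1. The upper bound is \<open>mod_series_lower_order\<close>. For the lower bound
  the order is first raised beyond \<open>\<nu>\<close>: \<open>I\<^sub>\<nu> \<le> (1 + o(1)) * I\<^sub>2\<^sub>-\<^sub>\<nu> \<le> (1 + o(1)) * I\<^sub>-\<^sub>\<nu>\<close>.
\<close>

lemma mod_series_ratio_tendsto:
  assumes \<nu>: "0 < \<nu>" "\<nu> < 1"
  shows "((\<lambda>Y. Y powr (- \<nu>) * mod_series (- \<nu>) Y / mod_series \<nu> Y) \<longlongrightarrow> 1) at_top"
proof -
  let ?R = "\<lambda>Y. Y powr (- \<nu>) * mod_series (- \<nu>) Y / mod_series \<nu> Y"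
  define C where "C = 2 + \<nu> + (1 + \<nu>)\<^sup>2"
  define D where "D = 2 + (2 - \<nu>) + (1 + (2 - \<nu>))\<^sup>2"
  have D: "D > 0" using \<nu> by (auto simp: D_def intro!: add_pos_nonneg)
  have up: "?R Y \<le> 1 + C / sqrt Y" and lo: "1 / (1 + D / sqrt Y) \<le> ?R Y" if Y: "Y \<ge> 1" for Y
  proof -
    have pos: "mod_series \<nu> Y > 0" "mod_series (-\<nu>) Y > 0" using \<nu> Y by (auto intro!: mod_series_pos)
    have "mod_series (- \<nu>) Y \<le> Y powr \<nu> * (1 + C / sqrt Y) * mod_series \<nu> Y"
      using mod_series_lower_order[of \<nu> "2 * \<nu>" Y] \<nu> Y by (simp add: C_def)
    then have "Y powr (-\<nu>) * mod_series (- \<nu>) Y \<le> Y powr (-\<nu>) * (Y powr \<nu> * (1 + C / sqrt Y) * mod_series \<nu> Y)"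
      by (intro mult_left_mono) auto
    also have "\<dots> = (1 + C / sqrt Y) * mod_series \<nu> Y"
      using Y by (simp add: powr_minus)
    finally show "?R Y \<le> 1 + C / sqrt Y" using pos by (simp add: pos_divide_le_eq)
    have d: "1 + D / sqrt Y > 0" using D Y by (intro add_pos_nonneg) auto
    have "mod_series \<nu> Y \<le> Y powr (1 - \<nu>) * (1 + D / sqrt Y) * mod_series (2 - \<nu>) Y"
    proof -
      have eq: "2 - \<nu> - (2 - 2 * \<nu>) = \<nu>" "(2 - 2 * \<nu>) / 2 = 1 - \<nu>" by (auto simp: field_simps)
      show ?thesis
        using mod_series_lower_order[of "2 - \<nu>" "2 - 2 * \<nu>" Y, unfolded eq] \<nu> Y unfolding D_def by simp
    qed
    also have "\<dots> = Y powr (- \<nu>) * (1 + D / sqrt Y) * (Y * mod_series (2 - \<nu>) Y)"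
      using Y by (simp add: powr_diff powr_minus field_simps)
    also have "\<dots> \<le> Y powr (- \<nu>) * (1 + D / sqrt Y) * mod_series (- \<nu>) Y"
      using mod_series_step[OF \<nu>, of Y] d Y by (intro mult_left_mono) auto
    finally have "1 \<le> ?R Y * (1 + D / sqrt Y)" using pos by (simp add: field_simps)
    then show "1 / (1 + D / sqrt Y) \<le> ?R Y" using d by (simp add: pos_divide_le_eq)
  qed
  have lim: "((\<lambda>Y. c / sqrt Y) \<longlongrightarrow> 0) at_top" for c
    by (intro tendsto_divide_0[OF tendsto_const] filterlim_at_top_imp_at_infinity sqrt_at_top)
  show ?thesis
  proof (rule tendsto_sandwich)
    show "eventually (\<lambda>Y. 1 / (1 + D / sqrt Y) \<le> ?R Y) at_top"
      by (intro eventually_mono[OF eventually_ge_at_top[of 1]] lo)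
    show "eventually (\<lambda>Y. ?R Y \<le> 1 + C / sqrt Y) at_top"
      by (intro eventually_mono[OF eventually_ge_at_top[of 1]] up)
    have "((\<lambda>Y. 1 / (1 + D / sqrt Y)) \<longlongrightarrow> 1 / (1 + 0)) at_top" by (intro tendsto_intros lim) auto
    then show "((\<lambda>Y. 1 / (1 + D / sqrt Y)) \<longlongrightarrow> 1) at_top" by simp
    have "((\<lambda>Y. 1 + C / sqrt Y) \<longlongrightarrow> 1 + 0) at_top" by (intro tendsto_intros lim)
    then show "((\<lambda>Y. 1 + C / sqrt Y) \<longlongrightarrow> 1) at_top" by simp
  qed
qed

lemma harm_bounds:
  "harm k \<le> ln (real k + 1) + (euler_mascheroni :: real)"
  "ln (real k + 1) + (euler_mascheroni :: real) - 2 / (real k + 1) \<le> harm k"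
proof -
  have "harm k \<le> ln (real k + 1) + (euler_mascheroni :: real) \<and>
        ln (real k + 1) + (euler_mascheroni :: real) - 2 / (real k + 1) \<le> harm k"
  proof (cases k)
    case 0
    have "(euler_mascheroni :: real) \<le> 1 - ln 2 + 1 / 2"
      using euler_mascheroni_upper[of 0] by (simp add: harm_def)
    moreover have "ln (2::real) > 0" by simp
    ultimately have "(euler_mascheroni :: real) \<le> 2" by linarith
    then show ?thesis using 0 euler_mascheroni_pos by (simp add: harm_def less_imp_le)
  next
    case (Suc n)
    have eq: "real (n + 2) = real k + 1" using Suc by simp
    have "0 \<le> 1 / real (2 * (n + 2))" by simp
    then have "harm k \<le> ln (real k + 1) + (euler_mascheroni :: real)"
      using euler_mascheroni_lower[of n, unfolded eq, folded Suc] by linarith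
    moreover have "1 / real (2 * (n + 1)) \<le> 2 / (real k + 1)"
      using Suc by (simp add: field_simps)
    then have "ln (real k + 1) + (euler_mascheroni :: real) - 2 / (real k + 1) \<le> harm k"
      using euler_mascheroni_upper[of n] Suc by (simp add: add_ac)
    ultimately show ?thesis by simp
  qed
  then show "harm k \<le> ln (real k + 1) + (euler_mascheroni :: real)"
    "ln (real k + 1) + (euler_mascheroni :: real) - 2 / (real k + 1) \<le> harm k" by auto
qed

text \<open>
  By \<open>harm_bounds\<close> the weighted mean of \<open>harm k\<close> is that of \<open>ln (k + 1) + euler_mascheroni\<close> up to
  terms of order \<open>1 / k\<close>. With \<open>y = (k + 1)\<^sup>2 / Y\<close> one has \<open>ln (k + 1) = (ln Y + ln y) / 2\<close> and
  \<open>1 - 1 / y \<le> ln y \<le> y - 1\<close>. Both bounds can be summed: the weights satisfy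
  \<open>mod_term 0 Y (Suc k) = mod_term 0 Y k / y\<close>, and the mean of \<open>k\<^sup>2\<close> is \<open>Y\<close>.
\<close>

lemma harm_mod_series:
  assumes Y: "Y \<ge> 1"
  obtains H where "(\<lambda>k. harm k * mod_term 0 Y k) sums H"
    "bessel_L (of_real (- (4 * Y))) = of_real H"
    "\<bar>H / mod_series 0 Y - ln Y / 2 - euler_mascheroni\<bar> \<le> 3 / sqrt Y"
proof -
  let ?w = "mod_term 0 Y" and ?S = "mod_series 0 Y" and ?r = "sqrt Y" and ?g = "euler_mascheroni :: real"
  have "(\<lambda>k. bessel_log_coeff k * of_real (- (4 * Y)) ^ k) sums bessel_L (of_real (- (4 * Y)))"
    by (rule entire_series_sums[OF entire_coeffs_bessel_log])
  moreover have "bessel_log_coeff k * of_real (- (4 * Y)) ^ k = of_real (harm k * ?w k)" for k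
    using bessel_coeff_mod_term[of 0 k Y] by (simp add: bessel_log_coeff_def mult.assoc)
  ultimately have L: "(\<lambda>k. complex_of_real (harm k * ?w k)) sums bessel_L (of_real (- (4 * Y)))"
    by (simp only:)
  define H where "H = Re (bessel_L (of_real (- (4 * Y))))"
  have H: "(\<lambda>k. harm k * ?w k) sums H" unfolding H_def using sums_Re[OF L] by (simp only: Re_complex_of_real)
  have LH: "bessel_L (of_real (- (4 * Y))) = of_real H"
    by (rule sums_unique2[OF L sums_of_real[OF H]])
  have w: "?w k > 0" for k using Y by (intro mod_term_pos) auto
  have S: "?S > 0" using Y by (intro mod_series_pos) auto
  have w0: "?w 0 = 1" by (simp add: mod_term_def)
  have r: "?r \<ge> 1" "?r * ?r = Y" using Y by auto
  have s: "?w sums ?S" by (intro mod_term_sums) simp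
  have s1: "(\<lambda>k. ?w (Suc k)) sums (?S - 1)" using s by (subst sums_Suc_iff) (simp add: w0)
  have s2: "(\<lambda>k. real k * real k * ?w k) sums (Y * ?S)" using mod_term_moment[of 0 Y] by simp
  have rec: "?w (Suc k) = Y / (real k + 1)\<^sup>2 * ?w k" for k
  proof -
    have "(real k + 1)\<^sup>2 * ?w (Suc k) = Y * ?w k"
      using mod_term_Suc[of 0 k Y] by (simp add: power2_eq_square add.commute)
    moreover have "(real k + 1)\<^sup>2 > 0" by simp
    ultimately show ?thesis by (simp add: field_simps)
  qed
  have lnY: "2 * ln (real k + 1) = ln ((real k + 1)\<^sup>2 / Y) + ln Y" for k
    using Y by (simp add: ln_div ln_realpow)
  have upper: "harm k * ?w k \<le> (?g + ln Y / 2 + (?r + 1) / (2 * Y) - 1/2) * ?w k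
      + (1 + 1 / ?r) / (2 * Y) * (real k * real k * ?w k)" for k
  proof -
    have "harm k \<le> ln (real k + 1) + ?g" by (rule harm_bounds)
    also have "ln (real k + 1) = (ln ((real k + 1)\<^sup>2 / Y) + ln Y) / 2" using lnY[of k] by simp
    also have "ln ((real k + 1)\<^sup>2 / Y) \<le> (real k + 1)\<^sup>2 / Y - 1"
      using Y by (intro ln_le_minus_one) (auto intro!: divide_pos_pos)
    also have "(real k + 1)\<^sup>2 \<le> real k * real k + 2 * ((real k * real k / ?r + ?r) / 2) + 1"
    proof -
      have "(real k + 1)\<^sup>2 = real k * real k + 2 * real k + 1" by (simp add: power2_eq_square algebra_simps)
      then show ?thesis using le_square_mean[of ?r "real k"] r by linarith
    qed
    finally have "harm k \<le> ((real k * real k + 2 * ((real k * real k / ?r + ?r) / 2) + 1) / Y - 1 + ln Y) / 2 + ?g"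
      using Y by (simp add: divide_right_mono)
    also have "\<dots> = (?g + ln Y / 2 + (?r + 1) / (2 * Y) - 1/2) + (1 + 1 / ?r) / (2 * Y) * (real k * real k)"
      by (simp add: add_divide_distrib diff_divide_distrib algebra_simps)
    finally have "harm k * ?w k \<le> ((?g + ln Y / 2 + (?r + 1) / (2 * Y) - 1/2) + (1 + 1 / ?r) / (2 * Y) * (real k * real k)) * ?w k"
      using w[of k] by (intro mult_right_mono) auto
    then show ?thesis by (simp add: algebra_simps)
  qed
  have "H \<le> (?g + ln Y / 2 + (?r + 1) / (2 * Y) - 1/2) * ?S + (1 + 1 / ?r) / (2 * Y) * (Y * ?S)"
    by (rule sums_le[OF upper H]) (intro sums_add sums_mult s s2)
  also have "\<dots> = (?g + ln Y / 2 + ((?r + 1) / (2 * Y) + 1 / (2 * ?r))) * ?S"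
    using Y by (simp add: field_simps)
  also have "\<dots> \<le> (?g + ln Y / 2 + 3 / ?r) * ?S"
  proof -
    have "(?r + 1) / (2 * Y) \<le> (?r + ?r) / (2 * Y)" using Y r by (intro divide_right_mono) auto
    also have "\<dots> = 1 / ?r"
    proof -
      have "(t + t) / (2 * (t * t)) = 1 / t" if "t > 0" for t :: real
        using that by (simp add: field_simps)
      from this[of ?r] show ?thesis using r Y by (simp only: r(2); simp?)
    qed
    finally have "(?r + 1) / (2 * Y) \<le> 1 / ?r" .
    moreover have "1 / (2 * ?r) = 1/2 * (1 / ?r)" "3 / ?r = 3 * (1 / ?r)" by simp_all
    moreover have "0 \<le> 1 / ?r" using r by simp
    ultimately have "(?r + 1) / (2 * Y) + 1 / (2 * ?r) \<le> 3 / ?r" by linarith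
    then show ?thesis using S by (intro mult_right_mono) auto
  qed
  finally have up: "H / ?S - ln Y / 2 - ?g \<le> 3 / ?r" using S by (simp add: pos_divide_le_eq algebra_simps)
  have lower: "(?g + ln Y / 2 + 1/2 - 1 / ?r) * ?w k + (- 1/2 - 1 / ?r) * ?w (Suc k) \<le> harm k * ?w k" for k
  proof -
    let ?y = "Y / (real k + 1)\<^sup>2"
    have "2 / (real k + 1) \<le> 1 / ?r + 1 / ?r * ?y"
    proof -
      have eq: "(1 - t / m)\<^sup>2 / t = 1 / t + 1 / t * (t * t / m\<^sup>2) - 2 / m" if "t > 0" "m > 0" for t m :: real
        using that by (simp add: power2_eq_square field_simps)
      have "0 \<le> (1 - ?r / (real k + 1))\<^sup>2 / ?r" using r by simp
      also have "\<dots> = 1 / ?r + 1 / ?r * (?r * ?r / (real k + 1)\<^sup>2) - 2 / (real k + 1)"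
        using r by (intro eq) auto
      finally show ?thesis unfolding r(2) by simp
    qed
    moreover have "- ln ((real k + 1)\<^sup>2 / Y) \<le> ?y - 1"
    proof -
      have "- ln ((real k + 1)\<^sup>2 / Y) = ln ?y" using Y by (simp add: ln_div)
      also have "\<dots> \<le> ?y - 1" using Y by (intro ln_le_minus_one) (auto intro!: divide_pos_pos)
      finally show ?thesis .
    qed
    ultimately have "(?g + ln Y / 2 + 1/2 - 1 / ?r) + (- 1/2 - 1 / ?r) * ?y \<le> harm k"
      using harm_bounds(2)[of k] lnY[of k] by (simp add: algebra_simps)
    then have "((?g + ln Y / 2 + 1/2 - 1 / ?r) + (- 1/2 - 1 / ?r) * ?y) * ?w k \<le> harm k * ?w k"
      using w[of k] by (intro mult_right_mono) auto
    then show ?thesis unfolding rec by (simp only: distrib_right mult.assoc)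
  qed
  have "(?g + ln Y / 2 + 1/2 - 1 / ?r) * ?S + (- 1/2 - 1 / ?r) * (?S - 1) \<le> H"
    by (rule sums_le[OF lower _ H]) (intro sums_add sums_mult s s1)
  moreover have "(?g + ln Y / 2 - 3 / ?r) * ?S \<le> (?g + ln Y / 2 + 1/2 - 1 / ?r) * ?S + (- 1/2 - 1 / ?r) * (?S - 1)"
  proof -
    have "0 \<le> 1 / ?r * ?S" "0 \<le> 1 / ?r" using S r by auto
    moreover have "(?g + ln Y / 2 + 1/2 - 1 / ?r) * ?S + (- 1/2 - 1 / ?r) * (?S - 1)
       = (?g + ln Y / 2 - 3 / ?r) * ?S + 1 / ?r * ?S + 1/2 + 1 / ?r"
      by (simp add: algebra_simps diff_divide_distrib)
    ultimately show ?thesis by linarith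
  qed
  ultimately have "(?g + ln Y / 2 - 3 / ?r) * ?S \<le> H" by linarith
  then have "?g + ln Y / 2 - 3 / ?r \<le> H / ?S" using S by (simp only: pos_le_divide_eq)
  then have lo: "- (3 / ?r) \<le> H / ?S - ln Y / 2 - ?g" by linarith
  show ?thesis by (rule that[OF H LH]) (use up lo in \<open>simp add: abs_le_iff\<close>)
qed

lemma weyl_limit_minus_one:
  assumes \<nu>: "0 \<le> \<nu>" "\<nu> < 1"
  shows "weyl_limit \<nu> (-1) =
    (if \<nu> = 0 then of_real (ln 2 - euler_mascheroni)
     else - of_real (Gamma (1 - \<nu>) / (2 * \<nu> * 4 powr \<nu> * Gamma (1 + \<nu>))))"
proof -
  have Z: "(-1) * complex_of_real (b\<^sup>2) = of_real (- (4 * (b\<^sup>2 / 4)))" for b by simp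
  have lim: "((\<lambda>b. weyl_quot \<nu> b (-1)) \<longlongrightarrow> weyl_limit \<nu> (-1)) at_top"
    by (rule weyl_quot_tendsto[OF \<nu>]) (simp add: complex_nonneg_Reals_iff)
  have Y: "filterlim (\<lambda>b::real. b\<^sup>2 / 4) at_top at_top"
    by real_asymp
  show ?thesis
  proof (cases "\<nu> = 0")
    case True
    define h where "h b = Re (bessel_L (of_real (- (4 * (b\<^sup>2 / 4))))) / mod_series 0 (b\<^sup>2 / 4)
        - ln (b\<^sup>2 / 4) / 2 - euler_mascheroni" for b :: real
    have hb: "\<bar>h b\<bar> \<le> 3 / sqrt (b\<^sup>2 / 4) \<and> weyl_quot 0 b (-1) = of_real (ln 2 - euler_mascheroni - h b)"
      if b: "b \<ge> 2" for b
    proof -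
      have "b * b \<ge> 2 * 2" using b by (intro mult_mono) auto
      then have Y1: "b\<^sup>2 / 4 \<ge> 1" by (simp add: power2_eq_square)
      obtain H where H: "bessel_L (of_real (- (4 * (b\<^sup>2 / 4)))) = of_real H"
        "\<bar>H / mod_series 0 (b\<^sup>2 / 4) - ln (b\<^sup>2 / 4) / 2 - euler_mascheroni\<bar> \<le> 3 / sqrt (b\<^sup>2 / 4)"
        using harm_mod_series[OF Y1] by metis
      have h: "h b = H / mod_series 0 (b\<^sup>2 / 4) - ln (b\<^sup>2 / 4) / 2 - euler_mascheroni"
        unfolding h_def H(1) by (simp only: Re_complex_of_real)
      have S: "mod_series 0 (b\<^sup>2 / 4) > 0" using Y1 by (intro mod_series_pos) auto
      have E: "bessel_E 0 (of_real (- (4 * (b\<^sup>2 / 4)))) = of_real (mod_series 0 (b\<^sup>2 / 4))"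
        using mod_term_sums(2)[of 0 "b\<^sup>2 / 4"] by simp
      have ln4: "ln (b\<^sup>2 / 4) / 2 = ln b - ln 2"
      proof -
        have "ln (4::real) = 2 * ln 2" using ln_realpow[of 2 2] by simp
        then show ?thesis using b by (simp add: ln_div ln_realpow)
      qed
      have "weyl_quot 0 b (-1) = - (of_real H - of_real (ln b) * of_real (mod_series 0 (b\<^sup>2 / 4))) / of_real (mod_series 0 (b\<^sup>2 / 4))"
        unfolding weyl_quot_def singular_def log_solution_def frobenius_def Z H(1) E using b by simp
      also have "\<dots> = of_real (ln b - H / mod_series 0 (b\<^sup>2 / 4))" using S by (simp add: field_simps)
      also have "ln b - H / mod_series 0 (b\<^sup>2 / 4) = ln 2 - euler_mascheroni - h b"
        unfolding h ln4 by simp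
      finally show ?thesis using H(2) by (simp only: h)
    qed
    have "((\<lambda>b::real. 3 / sqrt (b\<^sup>2 / 4)) \<longlongrightarrow> 0) at_top" by real_asymp
    then have "(h \<longlongrightarrow> 0) at_top"
      by (rule Lim_null_comparison[rotated]) (use hb in \<open>auto intro!: eventually_mono[OF eventually_ge_at_top[of 2]]\<close>)
    then have "((\<lambda>b. complex_of_real (ln 2 - euler_mascheroni - h b)) \<longlongrightarrow> of_real (ln 2 - euler_mascheroni - 0)) at_top"
      by (intro tendsto_intros)
    moreover have "eventually (\<lambda>b. of_real (ln 2 - euler_mascheroni - h b) = weyl_quot \<nu> b (-1)) at_top"
      using hb True by (auto intro!: eventually_mono[OF eventually_ge_at_top[of 2]])
    ultimately have "((\<lambda>b. weyl_quot \<nu> b (-1)) \<longlongrightarrow> of_real (ln 2 - euler_mascheroni - 0)) at_top"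
      by (rule Lim_transform_eventually)
    from tendsto_unique[OF trivial_limit_at_top_linorder lim this] show ?thesis using True by simp
  next
    case False
    then have nu: "0 < \<nu>" using \<nu> by simp
    define c where "c = Gamma (1 - \<nu>) / (2 * \<nu> * 4 powr \<nu> * Gamma (1 + \<nu>))"
    define R where "R Y = Y powr (- \<nu>) * mod_series (- \<nu>) Y / mod_series \<nu> Y" for Y
    have "((\<lambda>b. R (b\<^sup>2 / 4)) \<longlongrightarrow> 1) at_top"
      unfolding R_def by (rule filterlim_compose[OF mod_series_ratio_tendsto[OF nu \<nu>(2)] Y])
    then have "((\<lambda>b. complex_of_real (- c * R (b\<^sup>2 / 4))) \<longlongrightarrow> of_real (- c * 1)) at_top"
      by (intro tendsto_of_real tendsto_mult tendsto_const)
    moreover have "eventually (\<lambda>b. of_real (- c * R (b\<^sup>2 / 4)) = weyl_quot \<nu> b (-1)) at_top"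
      using eventually_gt_at_top[of 0]
    proof eventually_elim
      case (elim b)
      let ?Y = "b\<^sup>2 / 4"
      have "?Y powr (- \<nu>) = b powr (- \<nu>) * b powr (- \<nu>) * 4 powr \<nu>"
        using elim by (simp add: power2_eq_square powr_mult powr_divide powr_minus_divide)
      moreover have "b powr (- \<nu>) * b powr \<nu> = 1" using elim by (simp add: powr_minus)
      moreover have "4 powr \<nu> > 0" "b powr \<nu> > 0" using elim by auto
      ultimately have pw: "?Y powr (- \<nu>) / 4 powr \<nu> = b powr (- \<nu>) / b powr \<nu>"
        by (simp add: powr_minus_divide)
      have E1: "bessel_E (-\<nu>) (of_real (- (4 * ?Y))) = of_real (Gamma (1 + -\<nu>) * mod_series (-\<nu>) ?Y)"
        and E2: "bessel_E \<nu> (of_real (- (4 * ?Y))) = of_real (Gamma (1 + \<nu>) * mod_series \<nu> ?Y)"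
        by (rule mod_term_sums(2); use \<nu> nu in simp)+
      have "weyl_quot \<nu> b (-1) = of_real (- (b powr (-\<nu>) * (Gamma (1 - \<nu>) * mod_series (-\<nu>) ?Y) / (2 * \<nu>)) / (b powr \<nu> * (Gamma (1 + \<nu>) * mod_series \<nu> ?Y)))"
        unfolding weyl_quot_def singular_def frobenius_def Z E1 E2 using False by simp
      also have "- (b powr (-\<nu>) * (Gamma (1 - \<nu>) * mod_series (-\<nu>) ?Y) / (2 * \<nu>)) / (b powr \<nu> * (Gamma (1 + \<nu>) * mod_series \<nu> ?Y))
          = - (b powr (- \<nu>) / b powr \<nu>) * (Gamma (1 - \<nu>) / (2 * \<nu> * Gamma (1 + \<nu>))) * (mod_series (-\<nu>) ?Y / mod_series \<nu> ?Y)"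
        by (simp add: mult_ac)
      also have "\<dots> = - c * R ?Y" unfolding pw[symmetric] c_def R_def by (simp add: mult_ac)
      finally show ?case by simp
    qed
    ultimately have "((\<lambda>b. weyl_quot \<nu> b (-1)) \<longlongrightarrow> of_real (- c * 1)) at_top"
      by (rule Lim_transform_eventually)
    from tendsto_unique[OF trivial_limit_at_top_linorder lim this] show ?thesis using False by (simp add: c_def)
  qed
qed

section \<open>Closed forms of the Weyl functions\<close>

text \<open>
  Along the ray through \<open>w\<close> the derivative is \<open>w * f' w\<close>, hence \<open>f' = 0\<close> in the connected cut plane.
\<close>

lemma scale_invariant_imp_constant:
  assumes hol: "f holomorphic_on - \<real>\<^sub>\<le>\<^sub>0" and inv: "\<And>w t. w \<notin> \<real>\<^sub>\<le>\<^sub>0 \<Longrightarrow> t > 0 \<Longrightarrow> f (w * of_real t) = f w"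
    and w: "w \<notin> \<real>\<^sub>\<le>\<^sub>0"
  shows "f w = f 1"
proof -
  have op: "open (- \<real>\<^sub>\<le>\<^sub>0 :: complex set)" using closed_nonpos_Reals_complex by (simp add: open_Compl)
  have conn: "connected (- \<real>\<^sub>\<le>\<^sub>0 :: complex set)"
  proof -
    have "\<real>\<^sub>\<le>\<^sub>0 = complex_of_real ` {..0}" by (auto elim!: nonpos_Reals_cases)
    then show ?thesis using starlike_imp_connected[OF starlike_slotted_complex_plane_left[of 0]] by simp
  qed
  have d: "(f has_field_derivative 0) (at x)" if "x \<in> - \<real>\<^sub>\<le>\<^sub>0" for x
  proof -
    have "f field_differentiable at x"
      using holomorphic_on_imp_differentiable_at[OF hol op that] .
    then obtain D where D: "(f has_field_derivative D) (at x)"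
      unfolding field_differentiable_def by (elim exE)
    have "((\<lambda>t. x * complex_of_real t) has_vector_derivative x * of_real 1) (at (1::real))"
      by (intro has_vector_derivative_mult_right has_vector_derivative_of_real DERIV_ident)
    then have "((\<lambda>t. x * complex_of_real t) has_vector_derivative x) (at (1::real))" by simp
    moreover have "(f has_field_derivative D) (at (x * complex_of_real 1))" using D by simp
    ultimately have "(f \<circ> (\<lambda>t. x * complex_of_real t) has_vector_derivative x * D) (at 1)"
      by (rule field_vector_diff_chain_at)
    moreover have "((\<lambda>t::real. f x) has_vector_derivative 0) (at 1)" by simp
    then have "(f \<circ> (\<lambda>t. x * complex_of_real t) has_vector_derivative 0) (at 1)"
      by (rule has_vector_derivative_transform_within_open[of _ _ _ "{0<..}"]) (use inv that in auto)
    ultimately have "x * D = 0" by (rule vector_derivative_unique_at)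
    then have "D = 0" using that by auto
    then show ?thesis using D by simp
  qed
  obtain c where "\<And>x. x \<in> - \<real>\<^sub>\<le>\<^sub>0 \<Longrightarrow> f x = c"
  proof (rule DERIV_zero_connected_constant[OF conn op finite.emptyI holomorphic_on_imp_continuous_on[OF hol]])
    show "\<forall>x\<in>- \<real>\<^sub>\<le>\<^sub>0 - {}. (f has_field_derivative 0) (at x)" using d by blast
  qed blast
  then show ?thesis using w by (simp add: complex_nonpos_Reals_iff)
qed

lemma weyl_limit_closed_form:
  assumes \<nu>: "0 \<le> \<nu>" "\<nu> < 1" and z: "z \<notin> \<real>\<^sub>\<ge>\<^sub>0"
  shows "weyl_limit \<nu> z = (if \<nu> = 0 then weyl_limit \<nu> (-1) - Ln (- z) / 2
           else weyl_limit \<nu> (-1) * (- z) powr of_real \<nu>)"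
proof -
  \<comment> \<open>The substitution \<open>w = - z\<close> moves the cut to where the principal branches have theirs.\<close>
  define f where "f w = (if \<nu> = 0 then weyl_limit \<nu> (- w) + Ln w / 2
      else weyl_limit \<nu> (- w) * w powr (- of_real \<nu>))" for w
  have neg: "- w \<notin> \<real>\<^sub>\<ge>\<^sub>0" if "w \<notin> \<real>\<^sub>\<le>\<^sub>0" for w :: complex
    using that by (auto simp: complex_nonpos_Reals_iff complex_nonneg_Reals_iff)
  have "uminus ` (- \<real>\<^sub>\<le>\<^sub>0) \<subseteq> (- \<real>\<^sub>\<ge>\<^sub>0 :: complex set)" using neg by auto
  then have h: "(\<lambda>w. weyl_limit \<nu> (- w)) holomorphic_on - \<real>\<^sub>\<le>\<^sub>0"
    using holomorphic_on_compose_gen[OF _ weyl_limit_holomorphic[OF \<nu>], of uminus]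
    by (simp add: o_def holomorphic_on_minus)
  have hol: "f holomorphic_on - \<real>\<^sub>\<le>\<^sub>0"
    unfolding f_def using h by (cases "\<nu> = 0") (auto intro!: holomorphic_intros)
  have inv: "f (w * of_real t) = f w" if w: "w \<notin> \<real>\<^sub>\<le>\<^sub>0" and t: "t > 0" for w t
  proof -
    have M: "weyl_limit \<nu> (- (w * of_real t)) = (if \<nu> = 0 then weyl_limit \<nu> (- w) - of_real (ln t) / 2
        else of_real (t powr \<nu>) * weyl_limit \<nu> (- w))"
    proof -
      have "sqrt t powr (2 * \<nu>) = t powr \<nu>" using t by (simp add: powr_powr flip: powr_half_sqrt)
      moreover have "(sqrt t)\<^sup>2 = t" "ln (sqrt t) = ln t / 2" using t by (simp_all add: ln_sqrt)
      moreover have "- (w * complex_of_real t) = - w * of_real t" by simp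
      ultimately show ?thesis
        using weyl_limit_scaling[OF \<nu> neg[OF w], of "sqrt t"] t by (simp only:) simp
    qed
    have "w \<noteq> 0" using w by auto
    then have L: "Ln (w * of_real t) = Ln w + of_real (ln t)"
      using Ln_times_of_real[OF t \<open>w \<noteq> 0\<close>] Ln_of_real[OF t] by (simp add: mult.commute add.commute)
    show ?thesis
    proof (cases "\<nu> = 0")
      case True
      then show ?thesis unfolding f_def M L by (simp add: add_divide_distrib)
    next
      case False
      have "(w * of_real t) powr (- of_real \<nu>) = w powr (- of_real \<nu>) * of_real (t powr (- \<nu>))"
        using t \<open>w \<noteq> 0\<close> unfolding powr_def by (simp add: L distrib_left flip: exp_of_real exp_add)
      moreover have "complex_of_real (t powr \<nu>) * of_real (t powr (- \<nu>)) = 1"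
        using t by (simp add: powr_minus flip: of_real_mult)
      ultimately show ?thesis unfolding f_def M using False by (simp add: mult_ac)
    qed
  qed
  have mz: "- z \<notin> \<real>\<^sub>\<le>\<^sub>0" using z by (auto simp: complex_nonpos_Reals_iff complex_nonneg_Reals_iff)
  have "f (- z) = f 1" by (rule scale_invariant_imp_constant[OF hol inv mz])
  then show ?thesis
  proof (cases "\<nu> = 0")
    case False
    have "(- z) powr (- of_real \<nu>) * (- z) powr (of_real \<nu>) = 1"
      using z by (cases "z = 0") (auto simp: powr_minus powr_def simp flip: exp_add)
    moreover have "weyl_limit \<nu> z * (- z) powr (- of_real \<nu>) = weyl_limit \<nu> (-1)"
      using \<open>f (- z) = f 1\<close> False by (simp add: f_def)
    ultimately show ?thesis using False by (metis mult.assoc mult.right_neutral)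
  qed (simp add: f_def algebra_simps)
qed

lemma Ln_minus_upper:
  assumes "Im z > 0"
  shows "Ln (- z) = of_real (ln (cmod z)) + \<i> * of_real (Arg2pi z - pi)"
proof -
  have "z \<noteq> 0" using assms by auto
  have "0 < Arg2pi z" using assms Arg2pi_lt_pi[of z] by blast
  then have "Im (Ln (- z)) = Arg2pi z - pi" using Arg2pi_Ln[of z] by linarith
  moreover have "Re (Ln (- z)) = ln (cmod z)" using \<open>z \<noteq> 0\<close> by simp
  ultimately show ?thesis by (simp add: complex_eq_iff)
qed

lemma cut_powr_exp:
  assumes "z \<noteq> 0"
  shows "cut_powr z s = exp (of_real s * (of_real (ln (cmod z)) + \<i> * of_real (Arg2pi z)))"
proof -
  have "complex_of_real (cmod z powr s) = exp (of_real (s * ln (cmod z)))"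
    using assms by (simp add: powr_def flip: exp_of_real)
  then show ?thesis
    by (simp add: cut_powr_def cis_conv_exp distrib_left mult_ac flip: exp_add)
qed

text \<open>
  In the upper half-plane \<open>cut_sqrt z\<close> lies in the first quadrant. Products with positive numbers
  and powers can therefore be computed in the principal branch.
\<close>

lemma cut_sqrt_half_exp:
  assumes "Im z > 0" "b > 0"
  shows "of_real b * cut_sqrt z / 2 =
     exp (of_real (ln b) + (of_real (ln (cmod z) / 2 - ln 2) + \<i> * of_real (Arg2pi z / 2)))"
proof -
  have "z \<noteq> 0" using assms by auto
  have "exp (of_real (ln b) + (of_real (ln (cmod z) / 2 - ln 2) + \<i> * of_real (Arg2pi z / 2)))
     = exp (of_real (ln b)) * exp (of_real (1/2) * (of_real (ln (cmod z)) + \<i> * of_real (Arg2pi z))) / exp (of_real (ln 2))"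
    by (simp add: algebra_simps flip: exp_add exp_diff)
  also have "\<dots> = of_real b * cut_sqrt z / 2"
    unfolding cut_sqrt_def cut_powr_exp[OF \<open>z \<noteq> 0\<close>] using assms
    by (simp only: exp_of_real exp_ln) simp
  finally show ?thesis by simp
qed

lemma Ln_cut_sqrt_half:
  assumes "Im z > 0" "b > 0"
  shows "Ln (of_real b * cut_sqrt z / 2) =
     of_real (ln b) + (of_real (ln (cmod z) / 2 - ln 2) + \<i> * of_real (Arg2pi z / 2))"
proof -
  have "Arg2pi z < 2 * pi" "0 \<le> Arg2pi z" using Arg2pi by auto
  then show ?thesis unfolding cut_sqrt_half_exp[OF assms]
    by (intro Ln_exp) auto
qed

lemma cut_sqrt_square:
  assumes "Im z > 0"
  shows "(of_real b * cut_sqrt z)\<^sup>2 = z * of_real (b\<^sup>2)"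
proof -
  have z: "z \<noteq> 0" using assms by auto
  have "(cut_sqrt z)\<^sup>2 = cut_powr z 1"
    unfolding cut_sqrt_def cut_powr_exp[OF z] exp_double[symmetric]
    by (rule arg_cong[of _ _ exp]) simp
  also have "\<dots> = z"
    unfolding cut_powr_def using Arg2pi_eq[of z] z by (simp add: cis_conv_exp)
  finally show ?thesis by (simp add: power_mult_distrib)
qed

lemma upper_half_plane_subset: "Im z > 0 \<Longrightarrow> z \<notin> \<real>\<^sub>\<ge>\<^sub>0"
  by (auto simp: complex_nonneg_Reals_iff)

lemma M_inf_eq_weyl_limit:
  assumes \<nu>: "0 \<le> \<nu>" "\<nu> < 1" and z: "Im z > 0"
  shows "M_inf \<nu> z = weyl_limit \<nu> z"
proof (cases "\<nu> = 0")
  case True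
  have "Ln (cut_sqrt z / 2) = of_real (ln (cmod z) / 2 - ln 2) + \<i> * of_real (Arg2pi z / 2)"
    using Ln_cut_sqrt_half[OF z, of 1] by simp
  then show ?thesis
    unfolding M_inf_def weyl_limit_closed_form[OF \<nu> upper_half_plane_subset[OF z]] Ln_minus_upper[OF z]
      weyl_limit_minus_one[OF \<nu>]
    using True by (simp add: algebra_simps add_divide_distrib diff_divide_distrib)
next
  case False
  have z0: "z \<noteq> 0" using z by auto
  have "exp (\<i> * of_real ((1 - \<nu>) * pi)) * cut_powr z \<nu>
     = exp (\<i> * of_real pi) * exp (of_real \<nu> * (of_real (ln (cmod z)) + \<i> * of_real (Arg2pi z - pi)))"
    unfolding cut_powr_exp[OF z0] exp_add[symmetric] by (simp only: of_real_mult of_real_diff of_real_1) (simp only: algebra_simps mult_1_left)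
  also have "\<dots> = - ((- z) powr of_real \<nu>)"
    unfolding Ln_minus_upper[OF z, symmetric] using z0 by (simp add: powr_def)
  finally have "exp (\<i> * of_real ((1 - \<nu>) * pi)) * cut_powr z \<nu> = - ((- z) powr of_real \<nu>)" .
  then have "exp (\<i> * of_real ((1 - \<nu>) * pi)) * C * cut_powr z \<nu> = - C * (- z) powr of_real \<nu>" for C
    by (metis mult.commute mult.left_commute mult_minus_left mult_minus_right)
  then show ?thesis
    unfolding M_inf_def weyl_limit_closed_form[OF \<nu> upper_half_plane_subset[OF z]] weyl_limit_minus_one[OF \<nu>]
    using False by simp
qed

lemma M_fin_eq_weyl_quot:
  assumes \<nu>: "0 \<le> \<nu>" "\<nu> < 1" and z: "Im z > 0" and b: "b > 0"
  shows "M_fin \<nu> b z = weyl_quot \<nu> b z"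
proof -
  let ?Z = "z * complex_of_real (b\<^sup>2)" and ?w = "of_real b * cut_sqrt z"
  have "frobenius \<nu> z b \<noteq> 0"
    using csqrt_minus_Re_pos[OF upper_half_plane_subset[OF z]] b
    by (intro frobenius_nonzero[of _ "csqrt (-z)"] \<nu>) auto
  then have E: "bessel_E \<nu> ?Z \<noteq> 0" by (simp add: frobenius_def)
  note sq = cut_sqrt_square[OF z, of b]
  define l where "l = complex_of_real (ln (cmod z) / 2 - ln 2) + \<i> * of_real (Arg2pi z / 2)"
  have w: "?w / 2 = exp (of_real (ln b) + l)" unfolding l_def by (rule cut_sqrt_half_exp[OF z b])
  have Lnw: "Ln (?w / 2) = of_real (ln b) + l" unfolding l_def by (rule Ln_cut_sqrt_half[OF z b])
  show ?thesis
  proof (cases "\<nu> = 0")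
    case True
    have Lnz: "Ln (cut_sqrt z / 2) = l" unfolding l_def using Ln_cut_sqrt_half[OF z, of 1] by simp
    have "M_fin 0 b z = - l + of_real (pi / 2) * ((2 / of_real pi * ((of_real (ln b) + l + euler_mascheroni) * bessel_E 0 ?Z - bessel_L ?Z)) / bessel_E 0 ?Z) - euler_mascheroni"
      unfolding M_fin_def bessel_Y0_entire bessel_J_0_entire sq Lnz Lnw by simp
    also have "\<dots> = of_real (ln b) - bessel_L ?Z / bessel_E 0 ?Z"
    proof -
      have "- l + p / 2 * ((2 / p * ((lb + l + g) * e - L)) / e) - g = lb - L / e"
        if "e \<noteq> 0" "p \<noteq> 0" for p lb g e L :: complex
        using that by (simp add: field_simps)
      from this[of "bessel_E 0 ?Z" "of_real pi"] show ?thesis using E True by simp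
    qed
    also have "\<dots> = weyl_quot 0 b z"
      unfolding weyl_quot_def singular_def log_solution_def frobenius_def using E True b
      by (simp add: diff_divide_distrib)
    finally show ?thesis using True by simp
  next
    case False
    have pw: "(?w / 2) powr of_real \<mu> = exp (of_real \<mu> * (of_real (ln b) + l))" for \<mu>
      using b z unfolding powr_def Lnw by (auto simp: w)
    have z0: "z \<noteq> 0" using z by auto
    have cp: "cut_powr z \<nu> = exp (2 * of_real \<nu> * (l + of_real (ln 2)))"
      unfolding cut_powr_exp[OF z0] l_def by (simp add: algebra_simps)
    have ex: "exp (of_real (-\<nu>) * (of_real (ln b) + l)) / exp (of_real \<nu> * (of_real (ln b) + l)) * cut_powr z \<nu>
        = of_real (4 powr \<nu>) * (of_real (b powr (-\<nu>)) / of_real (b powr \<nu>))"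
    proof -
      have four: "ln (4::real) = 2 * ln 2" using ln_realpow[of 2 2] by simp
      have "exp (of_real (-\<nu>) * (of_real (ln b) + l)) / exp (of_real \<nu> * (of_real (ln b) + l)) * cut_powr z \<nu>
         = exp (complex_of_real (\<nu> * ln 4 - \<nu> * ln b - \<nu> * ln b))"
        unfolding cp four by (simp add: algebra_simps flip: exp_add exp_diff)
      also have "\<dots> = of_real (exp (\<nu> * ln 4 - \<nu> * ln b - \<nu> * ln b))" by (rule exp_of_real)
      also have "exp (\<nu> * ln 4 - \<nu> * ln b - \<nu> * ln b) = 4 powr \<nu> * (b powr (-\<nu>) / b powr \<nu>)"
        using b by (simp add: powr_def flip: exp_add exp_diff)
      finally show ?thesis by simp
    qed
    have G: "Gamma (1 - \<nu>) > 0" "Gamma (1 + \<nu>) > 0" using \<nu> by (auto intro!: Gamma_real_pos)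
    have rG: "rGamma (1 - \<nu>) = 1 / Gamma (1 - \<nu>)" "rGamma (1 + \<nu>) = 1 / Gamma (1 + \<nu>)"
      by (simp_all add: rGamma_inverse_Gamma inverse_eq_divide)
    have J1: "bessel_J (-\<nu>) ?w = exp (of_real (-\<nu>) * (of_real (ln b) + l)) * of_real (1 / Gamma (1 - \<nu>)) * bessel_E (-\<nu>) ?Z"
      using bessel_J_entire[of "-\<nu>" ?w] \<nu> False by (simp only: pw sq) (simp add: rG)
    have J2: "bessel_J \<nu> ?w = exp (of_real \<nu> * (of_real (ln b) + l)) * of_real (1 / Gamma (1 + \<nu>)) * bessel_E \<nu> ?Z"
      using bessel_J_entire[of "\<nu>" ?w] \<nu> False by (simp only: pw sq) (simp add: rG)
    have "M_fin \<nu> b z = - of_real (Gamma (1 - \<nu>) / (2 * \<nu> * 4 powr \<nu> * Gamma (1 + \<nu>))) *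
          (bessel_J (- \<nu>) ?w / bessel_J \<nu> ?w) * cut_powr z \<nu>"
      using False by (simp add: M_fin_def)
    also have "\<dots> = - of_real (1 / (2 * \<nu> * 4 powr \<nu>)) * (exp (of_real (-\<nu>) * (of_real (ln b) + l)) / exp (of_real \<nu> * (of_real (ln b) + l)) * cut_powr z \<nu>)
        * (bessel_E (-\<nu>) ?Z / bessel_E \<nu> ?Z)"
      unfolding J1 J2 using G by (simp add: mult_ac)
    also have "\<dots> = - of_real (1 / (2 * \<nu>)) * (of_real (b powr (-\<nu>)) / of_real (b powr \<nu>)) * (bessel_E (-\<nu>) ?Z / bessel_E \<nu> ?Z)"
      unfolding ex by simp
    also have "\<dots> = weyl_quot \<nu> b z"
      unfolding weyl_quot_def singular_def frobenius_def using False by simp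
    finally show ?thesis .
  qed
qed

section \<open>Square integrable functions\<close>

lemma absolutely_integrable_lebesgue_on:
  fixes f :: "real \<Rightarrow> 'a :: euclidean_space"
  assumes "S \<in> sets lebesgue"
  shows "f absolutely_integrable_on S \<longleftrightarrow> integrable (lebesgue_on S) f"
  using assms by (simp add: set_integrable_def integrable_restrict_space)

lemma L2_space_mult_integrable:
  assumes f: "f \<in> L2_space I" and g: "g \<in> L2_space I"
  shows "integrable (lebesgue_on I) (\<lambda>x. f x * cnj (g x))"
proof (rule Bochner_Integration.integrable_bound)
  show "integrable (lebesgue_on I) (\<lambda>x. (cmod (f x))\<^sup>2 + (cmod (g x))\<^sup>2)"
    using assms by (auto simp: L2_space_def)
  have "(\<lambda>x. cnj (g x)) \<in> borel_measurable (lebesgue_on I)"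
    using g by (intro borel_measurable_continuous_on[of cnj]) (auto simp: L2_space_def intro: continuous_intros)
  then show "(\<lambda>x. f x * cnj (g x)) \<in> borel_measurable (lebesgue_on I)"
    using f by (auto simp: L2_space_def)
  have "cmod (a * cnj b) \<le> \<bar>(cmod a)\<^sup>2 + (cmod b)\<^sup>2\<bar>" for a b
  proof -
    have "2 * cmod a * cmod b \<le> (cmod a)\<^sup>2 + (cmod b)\<^sup>2" by (rule sum_squares_bound)
    moreover have "0 \<le> cmod a * cmod b" by simp
    ultimately have "cmod a * cmod b \<le> (cmod a)\<^sup>2 + (cmod b)\<^sup>2" by linarith
    then show ?thesis by (simp add: norm_mult)
  qed
  then show "AE x in lebesgue_on I. norm (f x * cnj (g x)) \<le> norm ((cmod (f x))\<^sup>2 + (cmod (g x))\<^sup>2)"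
    by simp
qed

lemma L2_space_lincomb:
  assumes f: "f \<in> L2_space I" and g: "g \<in> L2_space I"
  shows "(\<lambda>x. a * f x + c * g x) \<in> L2_space I"
proof -
  have m: "(\<lambda>x. a * f x + c * g x) \<in> borel_measurable (lebesgue_on I)"
    using assms by (auto simp: L2_space_def)
  have "integrable (lebesgue_on I) (\<lambda>x. (cmod (a * f x + c * g x))\<^sup>2)"
  proof (rule Bochner_Integration.integrable_bound)
    show "integrable (lebesgue_on I) (\<lambda>x. 2 * (cmod a)\<^sup>2 * (cmod (f x))\<^sup>2 + 2 * (cmod c)\<^sup>2 * (cmod (g x))\<^sup>2)"
      using assms by (auto simp: L2_space_def)
    show "(\<lambda>x. (cmod (a * f x + c * g x))\<^sup>2) \<in> borel_measurable (lebesgue_on I)" using m by simp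
    have "(cmod (a * u + c * v))\<^sup>2 \<le> \<bar>2 * (cmod a)\<^sup>2 * (cmod u)\<^sup>2 + 2 * (cmod c)\<^sup>2 * (cmod v)\<^sup>2\<bar>" for u v
    proof -
      have "(cmod (a * u + c * v))\<^sup>2 \<le> (cmod (a * u) + cmod (c * v))\<^sup>2"
        by (intro power_mono norm_triangle_ineq) simp
      also have "\<dots> \<le> 2 * (cmod (a * u))\<^sup>2 + 2 * (cmod (c * v))\<^sup>2"
        using sum_squares_bound[of "cmod (a * u)" "cmod (c * v)"] by (simp add: power2_sum)
      finally show ?thesis by (simp add: norm_mult power_mult_distrib)
    qed
    then show "AE x in lebesgue_on I. norm ((cmod (a * f x + c * g x))\<^sup>2)
        \<le> norm (2 * (cmod a)\<^sup>2 * (cmod (f x))\<^sup>2 + 2 * (cmod c)\<^sup>2 * (cmod (g x))\<^sup>2)"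
      by simp
  qed
  with m show ?thesis by (simp add: L2_space_def)
qed

lemma L2_inner_lincomb_right:
  assumes "h \<in> L2_space I" "f \<in> L2_space I" "g \<in> L2_space I"
  shows "L2_inner I h (\<lambda>x. a * f x + c * g x) = cnj a * L2_inner I h f + cnj c * L2_inner I h g"
proof -
  have "L2_inner I h (\<lambda>x. a * f x + c * g x)
      = integral\<^sup>L (lebesgue_on I) (\<lambda>x. cnj a * (h x * cnj (f x)) + cnj c * (h x * cnj (g x)))"
    unfolding L2_inner_def by (simp add: algebra_simps)
  also have "\<dots> = cnj a * L2_inner I h f + cnj c * L2_inner I h g"
    unfolding L2_inner_def using assms
    by (subst Bochner_Integration.integral_add) (auto intro!: L2_space_mult_integrable)
  finally show ?thesis .
qed

lemma L2_absolutely_integrable: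
  assumes f: "f \<in> L2_space I" and I: "I \<in> sets lebesgue" and sub: "{a..c} \<subseteq> I"
  shows "f absolutely_integrable_on {a..c}"
    and "(\<lambda>x. (cmod (f x))\<^sup>2) integrable_on {a..c}"
    and "integral {a..c} (\<lambda>x. (cmod (f x))\<^sup>2) \<le> integral I (\<lambda>x. (cmod (f x))\<^sup>2)"
proof -
  have m: "f \<in> borel_measurable (lebesgue_on {a..c})"
    using f sub by (auto simp: L2_space_def intro: measurable_restrict_mono)
  have i: "(\<lambda>x. (cmod (f x))\<^sup>2) absolutely_integrable_on I"
    using f I by (simp add: L2_space_def absolutely_integrable_lebesgue_on)
  then have "(\<lambda>x. (cmod (f x))\<^sup>2) absolutely_integrable_on {a..c}"
    using sub by (rule absolutely_integrable_on_subinterval)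
  then show sq: "(\<lambda>x. (cmod (f x))\<^sup>2) integrable_on {a..c}"
    by (rule set_lebesgue_integral_eq_integral(1))
  show "integral {a..c} (\<lambda>x. (cmod (f x))\<^sup>2) \<le> integral I (\<lambda>x. (cmod (f x))\<^sup>2)"
    using sub sq set_lebesgue_integral_eq_integral(1)[OF i] by (intro integral_subset_le) auto
  show "f absolutely_integrable_on {a..c}"
  proof (rule measurable_bounded_by_integrable_imp_absolutely_integrable[OF m])
    show "(\<lambda>x. 1 + (cmod (f x))\<^sup>2) integrable_on {a..c}"
      using sq by (intro integrable_add) (auto intro: integrable_const_ivl)
    fix x
    show "norm (f x) \<le> 1 + (cmod (f x))\<^sup>2"
    proof -
      have "2 * cmod (f x) \<le> 1 + (cmod (f x))\<^sup>2" using sum_squares_bound[of 1 "cmod (f x)"] by simp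
      then show ?thesis using norm_ge_zero[of "f x"] by linarith
    qed
  qed simp
qed

text \<open>
  The Cauchy-Schwarz inequality up to the constant, from \<open>2 * \<bar>f\<bar> \<le> 1 / r + r * \<bar>f\<bar>\<^sup>2\<close> with
  \<open>r = sqrt l\<close>.
\<close>

lemma L2_integral_le:
  assumes f: "f \<in> L2_space I" and I: "I \<in> sets lebesgue" and sub: "{a..c} \<subseteq> I"
    and "a \<le> c" "c - a \<le> l" "l > 0"
  shows "norm (integral {a..c} f) \<le> (1 + integral I (\<lambda>x. (cmod (f x))\<^sup>2)) * sqrt l"
proof -
  let ?A = "integral I (\<lambda>x. (cmod (f x))\<^sup>2)" and ?r = "sqrt l"
  note L = L2_absolutely_integrable[OF f I sub]
  have Lr: "(\<lambda>x. ?r * (cmod (f x))\<^sup>2) integrable_on {a..c}"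
    using integrable_cmul[OF L(2), of ?r] by simp
  have r: "?r > 0" "?r * ?r = l" using \<open>l > 0\<close> by auto
  have "norm (integral {a..c} f) \<le> integral {a..c} (\<lambda>x. 1 / ?r + ?r * (cmod (f x))\<^sup>2)"
  proof (rule integral_norm_bound_integral)
    show "f integrable_on {a..c}" using L(1) by (rule set_lebesgue_integral_eq_integral(1))
    show "(\<lambda>x. 1 / ?r + ?r * (cmod (f x))\<^sup>2) integrable_on {a..c}"
      by (intro integrable_add Lr integrable_const_ivl)
    fix x
    show "norm (f x) \<le> 1 / ?r + ?r * (cmod (f x))\<^sup>2"
    proof -
      have "0 \<le> (1 / ?r - cmod (f x))\<^sup>2 * ?r" using r by simp
      also have "\<dots> = 1 / ?r - 2 * cmod (f x) + ?r * (cmod (f x))\<^sup>2"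
      proof -
        have "(1 / t - y)\<^sup>2 * t = 1 / t - 2 * y + t * y\<^sup>2" if "t > 0" for t y :: real
          using that by (simp add: power2_eq_square field_simps)
        then show ?thesis using r(1) by blast
      qed
      finally show ?thesis using norm_ge_zero[of "f x"] by linarith
    qed
  qed
  also have "\<dots> = (c - a) * (1 / ?r) + ?r * integral {a..c} (\<lambda>x. (cmod (f x))\<^sup>2)"
    using \<open>a \<le> c\<close> by (subst Henstock_Kurzweil_Integration.integral_add)
      (auto intro!: Lr integrable_const_ivl)
  also have "\<dots> \<le> l * (1 / ?r) + ?r * ?A"
    using assms r L by (intro add_mono mult_right_mono mult_left_mono) auto
  also have "l * (1 / ?r) = ?r"
  proof -
    have "t * t * (1 / t) = t" if "t > 0" for t :: real using that by simp
    from this[OF r(1)] show ?thesis using r(2) by simp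
  qed
  finally show ?thesis by (simp add: algebra_simps)
qed

section \<open>Integration by parts\<close>

text \<open>
  The function \<open>U\<close> is an indefinite integral of \<open>w\<close> and may fail to be differentiable. But the difference
  of the two sides, as a function of the upper limit, has an increment on \<open>[x, y]\<close> of at most a
  constant times \<open>(y - x)\<close> times the integral of \<open>\<bar>w\<bar>\<close> over \<open>[x, y]\<close>. This is \<open>o(y - x)\<close>, so the
  difference has derivative 0 everywhere.
\<close>

lemma integration_by_parts_AC:
  fixes U w \<Phi> \<Phi>' :: "real \<Rightarrow> complex"
  assumes ac: "a \<le> c" and w: "w absolutely_integrable_on {a..c}"
    and U: "\<And>x y. a \<le> x \<Longrightarrow> x \<le> y \<Longrightarrow> y \<le> c \<Longrightarrow> (w has_integral (U y - U x)) {x..y}"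
    and \<Phi>: "\<And>x. x \<in> {a..c} \<Longrightarrow> (\<Phi> has_vector_derivative \<Phi>' x) (at x)"
    and \<Phi>': "continuous_on {a..c} \<Phi>'"
  shows "((\<lambda>t. w t * \<Phi> t + U t * \<Phi>' t) has_integral (U c * \<Phi> c - U a * \<Phi> a)) {a..c}"
proof -
  have wi: "w integrable_on {a..c}" and nwi: "(\<lambda>t. norm (w t)) integrable_on {a..c}"
    using w by (auto simp: absolutely_integrable_on_def)
  have contPhi: "continuous_on {a..c} \<Phi>"
    by (intro continuous_at_imp_continuous_on ballI) (use \<Phi> has_vector_derivative_continuous in blast)
  define N where "N x = integral {a..x} (\<lambda>t. norm (w t))" for x
  have contN: "continuous_on {a..c} N" unfolding N_def by (rule indefinite_integral_continuous_1[OF nwi])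
  have Ueq: "U x = U a + integral {a..x} w" if "x \<in> {a..c}" for x
    using U[of a x] that by (auto dest: integral_unique)
  have contU: "continuous_on {a..c} U"
  proof (rule continuous_on_eq)
    show "continuous_on {a..c} (\<lambda>x. U a + integral {a..x} w)"
      by (rule continuous_on_add[OF continuous_on_const indefinite_integral_continuous_1[OF wi]])
  qed (rule Ueq[symmetric])
  have sub: "f integrable_on {x..y}" if "f integrable_on {a..c}" "a \<le> x" "y \<le> c" for f :: "real \<Rightarrow> 'b::euclidean_space" and x y
    using that by (auto intro: integrable_subinterval_real)
  have NN: "integral {x..y} (\<lambda>t. norm (w t)) = N y - N x" if "a \<le> x" "x \<le> y" "y \<le> c" for x y
    using Henstock_Kurzweil_Integration.integral_combine[of a x y "\<lambda>t. norm (w t)"] that sub[OF nwi, of a y]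
    by (simp add: N_def algebra_simps)
  have UN: "norm (U y - U x) \<le> N y - N x" if "a \<le> x" "x \<le> y" "y \<le> c" for x y
  proof -
    have "U y - U x = integral {x..y} w" by (rule integral_unique[OF U[OF that], symmetric])
    moreover have "norm (integral {x..y} w) \<le> integral {x..y} (\<lambda>t. norm (w t))"
      by (rule integral_norm_bound_integral) (use that in \<open>auto intro: sub wi nwi\<close>)
    ultimately show ?thesis using NN[OF that] by simp
  qed
  obtain B where B: "B > 0" "\<And>x. x \<in> {a..c} \<Longrightarrow> norm (\<Phi>' x) \<le> B"
    using compact_imp_bounded[OF compact_continuous_image[OF \<Phi>' compact_Icc]]
    unfolding bounded_pos by auto
  have PhiB: "norm (\<Phi> t - \<Phi> y) \<le> B * \<bar>t - y\<bar>" if "t \<in> {a..c}" "y \<in> {a..c}" for t y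
  proof -
    have "norm (\<Phi> t - \<Phi> y) \<le> B * norm (t - y)"
    proof (rule differentiable_bound[where S = "{a..c}" and f' = "\<lambda>x h. h *\<^sub>R \<Phi>' x"])
      fix x assume x: "x \<in> {a..c}"
      show "(\<Phi> has_derivative (\<lambda>h. h *\<^sub>R \<Phi>' x)) (at x within {a..c})"
        using \<Phi>[OF x] has_derivative_at_withinI unfolding has_vector_derivative_def by blast
      show "onorm (\<lambda>h. h *\<^sub>R \<Phi>' x) \<le> B"
        by (rule onorm_bound) (use B x in \<open>auto simp: mult.commute[of B] intro!: mult_left_mono\<close>)
    qed (use that in auto)
    then show ?thesis by simp
  qed
  define g where "g t = w t * \<Phi> t + U t * \<Phi>' t" for t
  have gi: "g integrable_on {a..c}"
  proof -
    have "(\<lambda>t. \<Phi> t * w t) absolutely_integrable_on {a..c}"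
      using compact_imp_bounded[OF compact_continuous_image[OF contPhi compact_Icc]]
      by (intro absolutely_integrable_bounded_measurable_product[OF bilinear_times] w
          continuous_imp_measurable_on_sets_lebesgue[OF contPhi]) auto
    then have "(\<lambda>t. w t * \<Phi> t) integrable_on {a..c}"
      using set_lebesgue_integral_eq_integral(1) by (simp add: mult.commute)
    moreover have "(\<lambda>t. U t * \<Phi>' t) integrable_on {a..c}"
      by (intro integrable_continuous_real continuous_intros contU \<Phi>')
    ultimately show ?thesis unfolding g_def[abs_def] by (rule integrable_add)
  qed
  \<comment> \<open>The claim is that \<open>H\<close> is constant.\<close>
  define H where "H x = integral {a..x} g - U x * \<Phi> x" for x
  have key: "norm (H y - H x) \<le> 2 * B * (y - x) * (N y - N x)" if xy: "a \<le> x" "x \<le> y" "y \<le> c" for x y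
  proof -
    have i1: "(g has_integral (integral {a..y} g - integral {a..x} g)) {x..y}"
    proof -
      have "integral {a..x} g + integral {x..y} g = integral {a..y} g"
        using xy by (intro Henstock_Kurzweil_Integration.integral_combine sub[OF gi]) auto
      moreover have "(g has_integral integral {x..y} g) {x..y}"
        using xy by (intro integrable_integral sub[OF gi]) auto
      ultimately show ?thesis by (metis add_diff_cancel_left')
    qed
    have i2: "((\<lambda>t. w t * \<Phi> y) has_integral ((U y - U x) * \<Phi> y)) {x..y}"
      by (rule has_integral_mult_left[OF U[OF xy]])
    have "(\<Phi>' has_integral (\<Phi> y - \<Phi> x)) {x..y}"
      using xy by (intro fundamental_theorem_of_calculus) (auto intro!: has_vector_derivative_at_within \<Phi>)
    then have i3: "((\<lambda>t. U x * \<Phi>' t) has_integral (U x * (\<Phi> y - \<Phi> x))) {x..y}"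
      by (rule has_integral_mult_right)
    have i: "((\<lambda>t. g t - w t * \<Phi> y - U x * \<Phi>' t) has_integral (H y - H x)) {x..y}"
      using has_integral_diff[OF has_integral_diff[OF i1 i2] i3] by (simp add: H_def algebra_simps)
    have j: "((\<lambda>t. B * (y - x) * norm (w t) + (N y - N x) * B) has_integral
        (B * (y - x) * (N y - N x) + (y - x) * ((N y - N x) * B))) {x..y}"
    proof (rule has_integral_add)
      have "((\<lambda>t. norm (w t)) has_integral (N y - N x)) {x..y}"
        using integrable_integral[OF sub[OF nwi xy(1,3)]] NN[OF xy] by simp
      then show "((\<lambda>t. B * (y - x) * norm (w t)) has_integral (B * (y - x) * (N y - N x))) {x..y}"
        by (rule has_integral_mult_right)
      show "((\<lambda>t. (N y - N x) * B) has_integral ((y - x) * ((N y - N x) * B))) {x..y}"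
        using has_integral_const_real[of "(N y - N x) * B" x y] xy by simp
    qed
    have "norm (H y - H x) \<le> B * (y - x) * (N y - N x) + (y - x) * ((N y - N x) * B)"
    proof -
      have "norm (integral {x..y} (\<lambda>t. g t - w t * \<Phi> y - U x * \<Phi>' t))
          \<le> integral {x..y} (\<lambda>t. B * (y - x) * norm (w t) + (N y - N x) * B)"
      proof (rule integral_norm_bound_integral[OF has_integral_integrable[OF i] has_integral_integrable[OF j]])
        fix t assume t: "t \<in> {x..y}"
        have eq: "g t - w t * \<Phi> y - U x * \<Phi>' t = w t * (\<Phi> t - \<Phi> y) + (U t - U x) * \<Phi>' t"
          by (simp add: g_def algebra_simps)
        have "norm (w t * (\<Phi> t - \<Phi> y) + (U t - U x) * \<Phi>' t) \<le> norm (w t) * norm (\<Phi> t - \<Phi> y) + norm (U t - U x) * norm (\<Phi>' t)"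
          by (rule order_trans[OF norm_triangle_ineq]) (simp add: norm_mult)
        also have "\<dots> \<le> norm (w t) * (B * (y - x)) + (N y - N x) * B"
        proof (intro add_mono mult_mono mult_left_mono)
          have "norm (\<Phi> t - \<Phi> y) \<le> B * \<bar>t - y\<bar>" using t xy by (intro PhiB) auto
          also have "\<dots> \<le> B * (y - x)" using t B by (intro mult_left_mono) auto
          finally show "norm (\<Phi> t - \<Phi> y) \<le> B * (y - x)" .
          have "norm (U t - U x) \<le> N t - N x" "norm (U y - U t) \<le> N y - N t"
            using t xy by (auto intro!: UN)
          moreover have "0 \<le> norm (U y - U t)" "0 \<le> norm (U t - U x)" by auto
          ultimately show "norm (U t - U x) \<le> N y - N x" "0 \<le> N y - N x" by linarith+
          show "norm (\<Phi>' t) \<le> B" using t xy by (intro B) auto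
        qed auto
        finally show "norm (g t - w t * \<Phi> y - U x * \<Phi>' t) \<le> B * (y - x) * norm (w t) + (N y - N x) * B"
          unfolding eq by (simp add: mult_ac)
      qed
      then show ?thesis using integral_unique[OF i] integral_unique[OF j] by simp
    qed
    then show ?thesis by (simp add: algebra_simps)
  qed
  have "(H has_vector_derivative 0) (at x within {a..c})" if x: "x \<in> {a..c}" for x
    unfolding has_vector_derivative_def has_derivative_within_alt
  proof (intro conjI allI impI)
    fix e :: real assume e: "e > 0"
    then obtain d where d: "d > 0" "\<And>y. y \<in> {a..c} \<Longrightarrow> dist y x < d \<Longrightarrow> dist (N y) (N x) < e / (2 * B)"
      using contN x B unfolding continuous_on_iff by (metis divide_pos_pos mult_pos_pos zero_less_numeral)
    show "\<exists>d>0. \<forall>y\<in>{a..c}. norm (y - x) < d \<longrightarrow> norm (H y - H x - (y - x) *\<^sub>R 0) \<le> e * norm (y - x)"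
    proof (intro exI[of _ d] conjI ballI impI d(1))
      fix y assume y: "y \<in> {a..c}" "norm (y - x) < d"
      have "norm (H y - H x) \<le> 2 * B * \<bar>y - x\<bar> * \<bar>N y - N x\<bar>"
      proof (cases "x \<le> y")
        case True
        moreover have "0 \<le> N y - N x" using order_trans[OF norm_ge_zero UN[of x y]] x y True by auto
        ultimately show ?thesis using key[of x y] x y by auto
      next
        case False
        moreover have "0 \<le> N x - N y" using order_trans[OF norm_ge_zero UN[of y x]] x y False by auto
        ultimately show ?thesis using key[of y x] x y
          by (auto simp: norm_minus_commute[of "H y"] abs_minus_commute[of y] abs_minus_commute[of "N y"])
      qed
      also have "\<dots> \<le> 2 * B * \<bar>y - x\<bar> * (e / (2 * B))"
        using d(2)[OF y(1)] y(2) B(1) by (intro mult_left_mono) (auto simp: dist_real_def)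
      also have "\<dots> = e * norm (y - x)" using B(1) by simp
      finally show "norm (H y - H x - (y - x) *\<^sub>R 0) \<le> e * norm (y - x)" by simp
    qed
  qed simp
  then obtain k where "\<And>x. x \<in> {a..c} \<Longrightarrow> H x = k"
    using has_vector_derivative_zero_constant[OF convex_real_interval(5)] by metis
  then have "H c = H a" using ac by simp
  then have "integral {a..c} g = U c * \<Phi> c - U a * \<Phi> a" by (simp add: H_def algebra_simps eq_diff_eq)
  then show ?thesis using integrable_integral[OF gi] unfolding g_def[abs_def] by simp
qed

lemma integral_exhaustion:
  fixes G :: "real \<Rightarrow> complex"
  assumes G: "G absolutely_integrable_on I" and sub: "\<And>n. {a n..c n} \<subseteq> I"
    and ev: "\<And>x. x \<in> I \<Longrightarrow> eventually (\<lambda>n. x \<in> {a n..c n}) sequentially"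
  shows "(\<lambda>n. integral {a n..c n} G) \<longlonglongrightarrow> integral I G"
proof -
  have "(\<lambda>n. integral I (\<lambda>x. if x \<in> {a n..c n} then G x else 0)) \<longlonglongrightarrow> integral I G"
  proof (rule dominated_convergence(2))
    fix n
    have "G integrable_on ({a n..c n} \<inter> I)"
      using absolutely_integrable_on_subinterval[OF G sub[of n]] sub[of n] set_lebesgue_integral_eq_integral(1)
      by (simp add: Int_absorb2)
    then show "(\<lambda>x. if x \<in> {a n..c n} then G x else 0) integrable_on I"
      by (simp only: integrable_restrict_Int)
    show "(\<lambda>x. norm (G x)) integrable_on I" using G by (simp add: absolutely_integrable_on_def)
    show "norm (if x \<in> {a n..c n} then G x else 0) \<le> norm (G x)" for x by simp
  next
    fix x assume "x \<in> I"
    from ev[OF this] show "(\<lambda>n. if x \<in> {a n..c n} then G x else 0) \<longlonglongrightarrow> G x"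
      by (intro tendsto_eventually) (rule eventually_mono, assumption, simp)
  qed
  then show ?thesis unfolding integral_restrict_Int Int_absorb2[OF sub] .
qed

lemma integrable_imp_arbitrarily_small:
  fixes f :: "real \<Rightarrow> complex"
  assumes f: "f absolutely_integrable_on {1..}" and e: "e > 0"
  shows "\<exists>x\<ge>X. norm (f x) < e"
proof (rule ccontr)
  assume "\<not> ?thesis"
  then have ge: "norm (f x) \<ge> e" if "x \<ge> X" for x using that by (meson not_less)
  let ?Y = "max X 1"
  have nf: "(\<lambda>x. norm (f x)) integrable_on {1..}" using f by (simp add: absolutely_integrable_on_def)
  let ?A = "integral {1..} (\<lambda>x. norm (f x))"
  obtain n :: nat where n: "real n * e > ?A" using reals_Archimedean3[OF e] by blast
  have i: "(\<lambda>x. norm (f x)) integrable_on {?Y..?Y + n}"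
    by (rule integrable_on_subinterval[OF nf]) auto
  have "real n * e = integral {?Y..?Y + n} (\<lambda>x. e)" by simp
  also have "\<dots> \<le> integral {?Y..?Y + n} (\<lambda>x. norm (f x))"
    by (intro integral_le i integrable_const_ivl ge) auto
  also have "\<dots> \<le> ?A" by (intro integral_subset_le i nf) auto
  finally show False using n by simp
qed

section \<open>Solutions in the kernel of \<open>A\<^sup>* - z\<close>\<close>

definition liouville :: "(real \<Rightarrow> complex) \<Rightarrow> real \<Rightarrow> complex" where
  "liouville p x = of_real (x powr (1/2)) * p x"

text \<open>
  The derivative of \<open>liouville p\<close> in terms of the quasi-derivative \<open>P\<close> of \<open>p\<close>.
\<close>

definition liouville_deriv :: "(real \<Rightarrow> complex) \<Rightarrow> (real \<Rightarrow> complex) \<Rightarrow> real \<Rightarrow> complex" where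
  "liouville_deriv p P x = of_real (x powr (-1/2)) * (P x + p x / 2)"

lemma liouville_has_vector_derivative:
  assumes p: "(p has_vector_derivative P x / of_real x) (at x)" and x: "x > 0"
  shows "(liouville p has_vector_derivative liouville_deriv p P x) (at x)"
proof -
  let ?m = "complex_of_real (x powr (-1/2))"
  have "x powr (1/2) = x * x powr (-1/2)"
    using x powr_add[of x 1 "-1/2"] by simp
  then have half: "complex_of_real (x powr (1/2)) = of_real x * ?m" by (simp only: of_real_mult)
  have "(liouville p has_vector_derivative
      of_real (x powr (1/2)) * (P x / of_real x) + of_real (1/2) * of_real (x powr (1/2)) / of_real x * p x) (at x)"
    unfolding liouville_def[abs_def] by (intro has_vector_derivative_mult powr_vector_deriv x p)
  moreover have "of_real (x powr (1/2)) * (P x / of_real x) + of_real (1/2) * of_real (x powr (1/2)) / of_real x * p x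
      = liouville_deriv p P x"
    unfolding half liouville_deriv_def using x by (simp add: field_simps)
  ultimately show ?thesis by simp
qed

lemma liouville_has_derivs:
  assumes sys: "bessel_system \<nu> z p P" and x: "x > 0"
  shows "(liouville p has_vector_derivative liouville_deriv p P x) (at x)"
    and "(liouville_deriv p P has_vector_derivative
            of_real ((\<nu>\<^sup>2 - 1/4) / x\<^sup>2) * liouville p x - z * liouville p x) (at x)"
proof -
  have *: "(p has_vector_derivative P x / of_real x) (at x)"
    "(P has_vector_derivative (of_real (\<nu>\<^sup>2 / x) - z * of_real x) * p x) (at x)"
    using sys x unfolding bessel_system_def by blast+
  let ?m = "complex_of_real (x powr (-1/2))"
  have "x powr (1/2) = x * x powr (-1/2)"
    using x powr_add[of x 1 "-1/2"] by simp
  then have half: "complex_of_real (x powr (1/2)) = of_real x * ?m" by (simp only: of_real_mult)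
  show "(liouville p has_vector_derivative liouville_deriv p P x) (at x)"
    by (rule liouville_has_vector_derivative[where p = p and P = P, OF *(1) x])
  let ?q = "complex_of_real (\<nu>\<^sup>2 / x) - z * of_real x"
  have "(liouville_deriv p P has_vector_derivative
      ?m * (?q * p x + P x / of_real x / 2) + of_real (-1/2) * ?m / of_real x * (P x + p x / 2)) (at x)"
    unfolding liouville_deriv_def[abs_def]
    by (intro has_vector_derivative_mult has_vector_derivative_add has_vector_derivative_divide powr_vector_deriv x *)
  moreover have "?m * (?q * p x + P x / of_real x / 2) + of_real (-1/2) * ?m / of_real x * (P x + p x / 2)
      = of_real ((\<nu>\<^sup>2 - 1/4) / x\<^sup>2) * liouville p x - z * liouville p x"
  proof -
    have "m * ((n / y - z * y) * a + b / y / 2) + (-1/2) * m / y * (b + a / 2)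
       = (n - 1/4) / y\<^sup>2 * (y * m * a) - z * (y * m * a)" if "y \<noteq> 0" for m n y a b :: complex
      using that by (simp add: field_simps power2_eq_square)
    from this[of "of_real x" ?m "of_real (\<nu>\<^sup>2)" "p x" "P x"] x show ?thesis
      unfolding liouville_def half by simp
  qed
  ultimately show "(liouville_deriv p P has_vector_derivative
            of_real ((\<nu>\<^sup>2 - 1/4) / x\<^sup>2) * liouville p x - z * liouville p x) (at x)" by simp
qed

lemma bessel_system_continuous_on:
  assumes "bessel_system \<nu> z p P" "S \<subseteq> {0<..}"
  shows "continuous_on S p" "continuous_on S P"
    "continuous_on S (liouville p)" "continuous_on S (liouville_deriv p P)"
proof -
  have vd: "continuous_on S f" if "\<And>x. x > 0 \<Longrightarrow> \<exists>D. (f has_vector_derivative D) (at x)" for f :: "real \<Rightarrow> complex"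
    using that assms(2) by (intro continuous_at_imp_continuous_on ballI)
      (use has_vector_derivative_continuous in blast)
  show "continuous_on S p" "continuous_on S P"
    using assms(1) unfolding bessel_system_def by (blast intro: vd)+
  show "continuous_on S (liouville p)" "continuous_on S (liouville_deriv p P)"
    using liouville_has_derivs[OF assms(1)] by (blast intro: vd)+
qed

definition bessel_interval :: "real set \<Rightarrow> bool" where
  "bessel_interval I \<longleftrightarrow> I = {0<..} \<or> (\<exists>b>0. I = {0<..<b})"

lemma closure_greaterThan_real: "closure {0<..} = {0::real..}"
  using closure_greaterThan by blast

lemma bessel_interval_facts:
  assumes "bessel_interval I"
  shows "I \<in> sets lebesgue" "open I" "I \<noteq> {}"
    and "x \<in> I \<Longrightarrow> x > 0" and "x \<in> I \<Longrightarrow> {0<..x} \<subseteq> I" and "x \<in> I \<Longrightarrow> {0..x} \<subseteq> closure I"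
    and "I \<subseteq> closure I"
proof -
  have cl: "closure I = (if I = {0<..} then {0..} else {0..Sup I})"
    using assms unfolding bessel_interval_def by (auto simp: closure_greaterThan_real)
  have "(1::real) \<in> {0<..}" by simp
  then have ne: "{} \<noteq> {0::real<..}" by blast
  show "I \<in> sets lebesgue" "open I" "I \<noteq> {}" "x \<in> I \<Longrightarrow> x > 0" "x \<in> I \<Longrightarrow> {0<..x} \<subseteq> I" "I \<subseteq> closure I"
    using assms closure_subset ne by (auto simp: bessel_interval_def dense)
  show "x \<in> I \<Longrightarrow> {0..x} \<subseteq> closure I"
    using assms unfolding bessel_interval_def by (auto simp: closure_greaterThan_real)
qed

text \<open>
  The Cauchy-Schwarz inequality for \<open>u2\<close> on \<open>(0, x)\<close> bounds \<open>u1 x\<close>, and integrating once more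
  bounds \<open>u x\<close>.
\<close>

lemma H2_function_near_0:
  assumes I: "bessel_interval I" and H2: "H2_function I u u1 u2" and 0: "u 0 = 0" "u1 0 = 0"
  obtains C where "C \<ge> 0" "\<And>x. x \<in> I \<Longrightarrow> norm (u1 x) \<le> C * sqrt x"
    "\<And>x. x \<in> I \<Longrightarrow> norm (u x) \<le> C * x * sqrt x"
proof -
  note F = bessel_interval_facts[OF I]
  define C where "C = 1 + integral I (\<lambda>x. (cmod (u2 x))\<^sup>2)"
  have u2: "u2 \<in> L2_space I" and int: "\<And>x y. x \<in> closure I \<Longrightarrow> y \<in> closure I \<Longrightarrow> x \<le> y \<Longrightarrow> (u2 has_integral (u1 y - u1 x)) {x..y}"
    and der: "\<And>x. x \<in> closure I \<Longrightarrow> (u has_vector_derivative u1 x) (at x within closure I)"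
    using H2 by (auto simp: H2_function_def)
  have le1: "norm (u1 x) \<le> C * sqrt x" if x: "x \<in> I" for x
  proof -
    have x0: "x > 0" using F(4)[OF x] .
    have cl: "{0..x} \<subseteq> closure I" using F(6)[OF x] .
    have i: "(u2 has_integral (u1 y - u1 0)) {0..y}" if "y \<in> {0..x}" for y
      using that cl x0 by (intro int) auto
    have "continuous_on {0..x} u1"
    proof (rule continuous_on_eq)
      show "continuous_on {0..x} (\<lambda>y. integral {0..y} u2)"
        using i[of x] x0 by (intro indefinite_integral_continuous_1) (auto intro: has_integral_integrable)
      show "integral {0..y} u2 = u1 y" if "y \<in> {0..x}" for y
        using integral_unique[OF i[OF that]] 0 by simp
    qed
    from continuous_on_Icc_at_rightD[OF this x0] have "(u1 \<longlongrightarrow> u1 0) (at_right 0)" .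
    then have "((\<lambda>e. norm (u1 x - u1 e)) \<longlongrightarrow> norm (u1 x - u1 0)) (at_right 0)"
      by (intro tendsto_intros)
    moreover have "eventually (\<lambda>e. norm (u1 x - u1 e) \<le> C * sqrt x) (at_right 0)"
    proof -
      have "norm (u1 x - u1 e) \<le> C * sqrt x" if e: "0 < e" "e < x" for e
      proof -
        have "u1 x - u1 e = integral {e..x} u2"
          using e cl by (intro integral_unique[symmetric] int) auto
        moreover have "norm (integral {e..x} u2) \<le> C * sqrt x"
          unfolding C_def using e F(5)[OF x] by (intro L2_integral_le[OF u2 F(1)]) auto
        ultimately show ?thesis by simp
      qed
      then show ?thesis using x0 by (auto simp: eventually_at_right[of 0 x])
    qed
    ultimately have "norm (u1 x - u1 0) \<le> C * sqrt x" by (rule tendsto_upperbound) simp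
    then show ?thesis using 0 by simp
  qed
  have C0: "C \<ge> 0"
  proof -
    obtain x where x: "x \<in> I" using F(3) by blast
    have "0 \<le> C * sqrt x" using le1[OF x] norm_ge_zero order_trans by blast
    then show ?thesis using F(4)[OF x] by (simp add: zero_le_mult_iff)
  qed
  have le0: "norm (u x) \<le> C * x * sqrt x" if x: "x \<in> I" for x
  proof -
    have x0: "x > 0" using F(4)[OF x] .
    have cl: "{0..x} \<subseteq> closure I" using F(6)[OF x] .
    have "norm (u x - u 0) \<le> (C * sqrt x) * norm (x - 0)"
    proof (rule differentiable_bound[where S = "{0..x}" and f' = "\<lambda>y h. h *\<^sub>R u1 y"])
      fix y assume y: "y \<in> {0..x}"
      show "(u has_derivative (\<lambda>h. h *\<^sub>R u1 y)) (at y within {0..x})"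
        using der[of y] y cl unfolding has_vector_derivative_def by (meson has_derivative_subset subsetD)
      have "norm (u1 y) \<le> C * sqrt x"
      proof (cases "y = 0")
        case True
        then show ?thesis using 0 C0 x0 by simp
      next
        case False
        then have "y \<in> I" using y F(5)[OF x] by auto
        from le1[OF this] have "norm (u1 y) \<le> C * sqrt y" .
        also have "\<dots> \<le> C * sqrt x" using y C0 by (intro mult_left_mono) auto
        finally show ?thesis .
      qed
      then show "onorm (\<lambda>h. h *\<^sub>R u1 y) \<le> C * sqrt x"
        by (intro onorm_bound) (use C0 x0 in \<open>auto simp: mult.commute[of "C * sqrt x"] intro!: mult_left_mono\<close>)
    qed (use x0 in auto)
    then show ?thesis using 0 x0 by (simp add: mult_ac)
  qed
  show ?thesis by (rule that[OF C0 le1 le0])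
qed

text \<open>
  The bracket \<open>[u, f]\<^sub>x\<close> for \<open>f = liouville p\<close>, in terms of the given derivatives.
\<close>

definition lagrange_form ::
  "(real \<Rightarrow> complex) \<Rightarrow> (real \<Rightarrow> complex) \<Rightarrow> (real \<Rightarrow> complex) \<Rightarrow> (real \<Rightarrow> complex) \<Rightarrow> real \<Rightarrow> complex" where
  "lagrange_form u u1 p P x = u x * cnj (liouville_deriv p P x) - u1 x * cnj (liouville p x)"

lemma lagrange_identity:
  assumes I: "bessel_interval I" and H2: "H2_function I u u1 u2" and sys: "bessel_system \<nu> z p P"
    and ac: "a \<in> I" "c \<in> I" "a \<le> c"
  shows "((\<lambda>x. (- u2 x + of_real ((\<nu>\<^sup>2 - 1/4) / x\<^sup>2) * u x) * cnj (liouville p x) - u x * cnj (z * liouville p x))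
     has_integral (lagrange_form u u1 p P c - lagrange_form u u1 p P a)) {a..c}"
proof -
  note F = bessel_interval_facts[OF I]
  let ?f = "liouville p" and ?f1 = "liouville_deriv p P"
  let ?f2 = "\<lambda>x. of_real ((\<nu>\<^sup>2 - 1/4) / x\<^sup>2) * ?f x - z * ?f x"
  have pos: "x > 0" if "x \<in> {a..c}" for x using that F(4)[OF ac(1)] by simp
  have sub: "{a..c} \<subseteq> I" using F(5)[OF ac(2)] pos by auto
  have scl: "{a..c} \<subseteq> closure I" using sub F(7) by blast
  have u2: "u2 \<in> L2_space I" and int: "\<And>x y. x \<in> closure I \<Longrightarrow> y \<in> closure I \<Longrightarrow> x \<le> y \<Longrightarrow> (u2 has_integral (u1 y - u1 x)) {x..y}"
    and der: "\<And>x. x \<in> closure I \<Longrightarrow> (u has_vector_derivative u1 x) (at x within closure I)"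
    using H2 by (auto simp: H2_function_def)
  have cf: "((\<lambda>x. cnj (?f x)) has_vector_derivative cnj (?f1 x)) (at x)" if "x \<in> {a..c}" for x
    by (intro has_vector_derivative_cnj liouville_has_derivs(1)[OF sys pos[OF that]])
  have cf1: "((\<lambda>x. cnj (?f1 x)) has_vector_derivative cnj (?f2 x)) (at x)" if "x \<in> {a..c}" for x
    by (intro has_vector_derivative_cnj liouville_has_derivs(2)[OF sys pos[OF that]])
  have cont: "continuous_on {a..c} (\<lambda>x. cnj (?f1 x))"
  proof -
    have "{a..c} \<subseteq> {0<..}" using pos by (auto simp del: atLeastAtMost_iff)
    from bessel_system_continuous_on(4)[OF sys this] show ?thesis by (rule continuous_on_cnj)
  qed
  have 1: "((\<lambda>x. u2 x * cnj (?f x) + u1 x * cnj (?f1 x)) has_integral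
      (u1 c * cnj (?f c) - u1 a * cnj (?f a))) {a..c}"
  proof (rule integration_by_parts_AC[OF ac(3) L2_absolutely_integrable(1)[OF u2 F(1) sub] _ cf cont])
    fix x y assume "a \<le> x" "x \<le> y" "y \<le> c"
    then show "(u2 has_integral u1 y - u1 x) {x..y}" using scl by (intro int) auto
  qed
  have 2: "((\<lambda>x. u x * cnj (?f2 x) + u1 x * cnj (?f1 x)) has_integral
      (u c * cnj (?f1 c) - u a * cnj (?f1 a))) {a..c}"
  proof (rule fundamental_theorem_of_calculus[OF ac(3)])
    fix x assume x: "x \<in> {a..c}"
    have "(u has_vector_derivative u1 x) (at x within {a..c})"
      using der[of x] x scl by (meson has_vector_derivative_within_subset subsetD)
    then show "((\<lambda>x. u x * cnj (?f1 x)) has_vector_derivative u x * cnj (?f2 x) + u1 x * cnj (?f1 x)) (at x within {a..c})"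
      by (intro has_vector_derivative_mult has_vector_derivative_at_within[OF cf1[OF x]])
  qed
  have "((\<lambda>x. (u x * cnj (?f2 x) + u1 x * cnj (?f1 x)) - (u2 x * cnj (?f x) + u1 x * cnj (?f1 x))) has_integral
      ((u c * cnj (?f1 c) - u a * cnj (?f1 a)) - (u1 c * cnj (?f c) - u1 a * cnj (?f a)))) {a..c}"
    by (rule has_integral_diff[OF 2 1])
  then show ?thesis
    by (rule back_subst[of "\<lambda>(f, i). (f has_integral i) {a..c}", OF _ , of "(_, _)" "(_, _)", unfolded prod.case])
      (auto simp: lagrange_form_def fun_eq_iff algebra_simps)
qed

lemma powr_mult_tendsto_0_mono:
  fixes f :: "real \<Rightarrow> complex"
  assumes "((\<lambda>x. of_real (x powr \<mu>) * f x) \<longlongrightarrow> 0) (at_right 0)" "\<mu> < \<kappa>"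
  shows "((\<lambda>x. of_real (x powr \<kappa>) * f x) \<longlongrightarrow> 0) (at_right 0)"
proof -
  have "((\<lambda>x. x powr (\<kappa> - \<mu>)) \<longlongrightarrow> 0) (at_right 0)"
    using assms(2) by (intro tendsto_zero_powrI[where b = "\<kappa> - \<mu>"] tendsto_intros) (auto simp: eventually_at_filter)
  from tendsto_mult[OF tendsto_of_real[OF this] assms(1)]
  have "((\<lambda>x. of_real (x powr (\<kappa> - \<mu>)) * (of_real (x powr \<mu>) * f x)) \<longlongrightarrow> 0) (at_right 0)" by simp
  moreover have "eventually (\<lambda>x. of_real (x powr (\<kappa> - \<mu>)) * (of_real (x powr \<mu>) * f x) = of_real (x powr \<kappa>) * f x) (at_right (0::real))"
    using eventually_at_right_less[of 0]
  proof eventually_elim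
    case (elim x)
    have "x powr (\<kappa> - \<mu>) * x powr \<mu> = x powr \<kappa>" using elim by (simp flip: powr_add)
    then show ?case by (simp only: mult.assoc[symmetric] flip: of_real_mult)
  qed
  ultimately show ?thesis by (rule Lim_transform_eventually)
qed

text \<open>
  Growth at 0 of an order less than \<open>1 / x\<close> makes \<open>sqrt x * p x\<close> square integrable there, and makes its
  boundary terms with the elements of \<open>H\<^sup>2\<^sub>0\<close> vanish. For the Bessel solutions this is the condition
  \<open>\<nu> < 1\<close>.
\<close>

definition subcritical :: "(real \<Rightarrow> complex) \<Rightarrow> bool" where
  "subcritical p \<longleftrightarrow> (\<exists>\<mu><1. ((\<lambda>x. of_real (x powr \<mu>) * p x) \<longlongrightarrow> 0) (at_right 0))"

text \<open>
  By \<open>H2_function_near_0\<close> the form is \<open>O(x * (\<bar>p\<bar> + \<bar>P\<bar>))\<close>.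
\<close>

lemma lagrange_form_tendsto_0:
  assumes I: "bessel_interval I" and H2: "H2_function I u u1 u2" and 0: "u 0 = 0" "u1 0 = 0"
    and p: "subcritical p" and P: "subcritical P"
  shows "(lagrange_form u u1 p P \<longlongrightarrow> 0) (at_right 0)"
proof -
  note F = bessel_interval_facts[OF I]
  obtain C where C: "C \<ge> 0" "\<And>x. x \<in> I \<Longrightarrow> norm (u1 x) \<le> C * sqrt x"
    "\<And>x. x \<in> I \<Longrightarrow> norm (u x) \<le> C * x * sqrt x"
    using H2_function_near_0[OF I H2 0] by blast
  have "((\<lambda>x. of_real (x powr 1) * p x) \<longlongrightarrow> 0) (at_right 0)" "((\<lambda>x. of_real (x powr 1) * P x) \<longlongrightarrow> 0) (at_right 0)"
    using p P powr_mult_tendsto_0_mono unfolding subcritical_def by blast+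
  then have "((\<lambda>x. C * norm (of_real (x powr 1) * P x) + 2 * C * norm (of_real (x powr 1) * p x)) \<longlongrightarrow> C * norm (0::complex) + 2 * C * norm (0::complex)) (at_right 0)"
    by (intro tendsto_intros)
  then have lim: "((\<lambda>x. C * norm (of_real (x powr 1) * P x) + 2 * C * norm (of_real (x powr 1) * p x)) \<longlongrightarrow> 0) (at_right 0)"
    by simp
  obtain x0 where x0: "x0 \<in> I" using F(3) by blast
  have bound: "norm (lagrange_form u u1 p P x) \<le> C * norm (of_real (x powr 1) * P x) + 2 * C * norm (of_real (x powr 1) * p x)"
    if x: "0 < x" "x < x0" for x
  proof -
    have xI: "x \<in> I" using F(5)[OF x0] x by auto
    let ?s = "sqrt x"
    have s: "x powr (1/2) = ?s" "x powr (-1/2) = 1 / ?s" "?s > 0" "?s * ?s = x"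
      using x by (auto simp: powr_half_sqrt powr_minus_divide)
    have "norm (lagrange_form u u1 p P x) \<le> norm (u x) * (1 / ?s * norm (P x + p x / 2)) + norm (u1 x) * (?s * norm (p x))"
      unfolding lagrange_form_def liouville_def liouville_deriv_def s(1,2)
      by (rule order_trans[OF norm_triangle_ineq4]) (use s in \<open>simp add: norm_mult norm_divide del: complex_cnj_add complex_cnj_mult complex_cnj_divide\<close>)
    also have "\<dots> \<le> (C * x * ?s) * (1 / ?s * (norm (P x) + norm (p x))) + (C * ?s) * (?s * norm (p x))"
    proof (intro add_mono mult_mono C xI mult_left_mono)
      show "norm (P x + p x / 2) \<le> norm (P x) + norm (p x)"
        by (rule order_trans[OF norm_triangle_ineq]) (simp add: norm_divide)
    qed (use C x s in auto)
    also have "\<dots> = C * x * norm (P x) + 2 * C * x * norm (p x)"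
    proof -
      have "(C * (t * t) * t) * (1 / t * (A + B)) + (C * t) * (t * B) = C * (t * t) * A + 2 * C * (t * t) * B"
        if "t > 0" for t A B :: real
        using that by (simp add: field_simps)
      from this[OF s(3)] show ?thesis unfolding s(4) .
    qed
    finally show ?thesis using x by (simp add: norm_mult mult_ac)
  qed
  show ?thesis
    by (rule Lim_null_comparison[OF _ lim]) (use bound F(4)[OF x0] in \<open>auto simp: eventually_at_right[of 0 x0]\<close>)
qed

text \<open>
  Lagrange's identity is integrated over intervals \<open>[a\<^sub>n, c\<^sub>n]\<close> that exhaust \<open>I\<close>. The boundary
  term at \<open>a\<^sub>n\<close> tends to 0 by \<open>lagrange_form_tendsto_0\<close>; at the other end it suffices that it
  tends to 0 along one sequence, as the integral over \<open>I\<close> exists anyway.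
\<close>

lemma liouville_in_defect_space:
  assumes I: "bessel_interval I" and sys: "bessel_system \<nu> z p P"
    and p: "subcritical p" and P: "subcritical P" and L2: "liouville p \<in> L2_space I"
    and far: "\<And>u u1 u2. H2_function I u u1 u2 \<Longrightarrow> \<forall>x\<in>E. u x = 0 \<Longrightarrow>
       \<exists>c. (\<forall>n. c n \<in> I) \<and> (\<forall>x\<in>I. eventually (\<lambda>n. x \<le> c n) sequentially) \<and>
           (\<lambda>n. lagrange_form u u1 p P (c n)) \<longlonglongrightarrow> 0"
  shows "liouville p \<in> defect_space I (bessel_operator \<nu> I E) z"
proof -
  note F = bessel_interval_facts[OF I]
  let ?f = "liouville p"
  have zL2: "(\<lambda>x. z * ?f x) \<in> L2_space I" using L2_space_lincomb[OF L2 L2, of z 0] by simp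
  have "L2_inner I h ?f = L2_inner I g (\<lambda>x. z * ?f x)" if gh: "(g, h) \<in> bessel_operator \<nu> I E" for g h
  proof -
    obtain u u1 u2 where g: "g \<in> L2_space I" and h: "h \<in> L2_space I" and H2: "H2_function I u u1 u2"
      and u0: "u 0 = 0" "u1 0 = 0" and uE: "\<forall>x\<in>E. u x = 0" and gu: "ae_eq I g u"
      and hu: "ae_eq I h (\<lambda>x. - u2 x + of_real ((\<nu>\<^sup>2 - 1/4) / x\<^sup>2) * u x)"
      using gh unfolding bessel_operator_def by blast
    let ?G = "\<lambda>x. (- u2 x + of_real ((\<nu>\<^sup>2 - 1/4) / x\<^sup>2) * u x) * cnj (?f x) - u x * cnj (z * ?f x)"
    let ?D = "\<lambda>x. h x * cnj (?f x) - g x * cnj (z * ?f x)"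
    have Dint: "integrable (lebesgue_on I) ?D"
      by (intro Bochner_Integration.integrable_diff L2_space_mult_integrable g h L2 zL2)
    have D: "L2_inner I h ?f - L2_inner I g (\<lambda>x. z * ?f x) = integral\<^sup>L (lebesgue_on I) ?D"
      unfolding L2_inner_def
      by (intro Bochner_Integration.integral_diff[symmetric] L2_space_mult_integrable g h L2 zL2)
    have ae: "AE x in lebesgue_on I. ?D x = ?G x"
      using gu hu unfolding ae_eq_def by eventually_elim simp
    have q: "(\<lambda>x. complex_of_real ((\<nu>\<^sup>2 - 1/4) / x\<^sup>2)) \<in> borel_measurable (lebesgue_on I)"
    proof (rule continuous_imp_measurable_on_sets_lebesgue[OF _ F(1)])
      show "continuous_on I (\<lambda>x. complex_of_real ((\<nu>\<^sup>2 - 1/4) / x\<^sup>2))"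
        using F(4) by (intro continuous_intros) force
    qed
    have cm: "(\<lambda>x. cnj (f x)) \<in> borel_measurable (lebesgue_on I)" if "f \<in> borel_measurable (lebesgue_on I)" for f
      by (intro borel_measurable_continuous_on[of cnj] continuous_intros that)
    have "u \<in> borel_measurable (lebesgue_on I)" "u2 \<in> borel_measurable (lebesgue_on I)"
        "?f \<in> borel_measurable (lebesgue_on I)" "(\<lambda>x. z * ?f x) \<in> borel_measurable (lebesgue_on I)"
      using H2 L2 zL2 by (auto simp: H2_function_def L2_space_def)
    then have Gm: "?G \<in> borel_measurable (lebesgue_on I)"
      by (intro borel_measurable_diff borel_measurable_times borel_measurable_add borel_measurable_uminus borel_measurable_const q cm)
    have Gint: "integrable (lebesgue_on I) ?G"
      using integrable_cong_AE[OF borel_measurable_integrable[OF Dint] Gm ae] Dint by simp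
    have DG: "integral\<^sup>L (lebesgue_on I) ?D = integral I ?G"
      using integral_cong_AE[OF borel_measurable_integrable[OF Dint] Gm ae]
        lebesgue_integral_eq_integral[OF Gint F(1)] by simp
    obtain c where c: "\<And>n. c n \<in> I" "\<And>x. x \<in> I \<Longrightarrow> eventually (\<lambda>n. x \<le> c n) sequentially"
      "(\<lambda>n. lagrange_form u u1 p P (c n)) \<longlonglongrightarrow> 0"
      using far[OF H2 uE] by blast
    obtain x0 where x0: "x0 \<in> I" using F(3) by blast
    have x0pos: "x0 > 0" by (rule F(4)[OF x0])
    define a where "a n = x0 / real (Suc n)" for n
    have a: "a n \<in> I" "a n \<le> x0" "a n > 0" for n
    proof -
      have "a n \<le> x0 / 1" unfolding a_def using x0pos by (intro divide_left_mono) auto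
      moreover show "a n > 0" using x0pos by (simp add: a_def)
      ultimately show "a n \<le> x0" "a n \<in> I" using F(5)[OF x0] by auto
    qed
    have a0: "a \<longlonglongrightarrow> 0" unfolding a_def by (intro tendsto_divide_0[OF tendsto_const] filterlim_at_top_imp_at_infinity
          filterlim_compose[OF filterlim_real_sequentially filterlim_Suc])
    then have "filterlim a (at_right 0) sequentially"
      using a by (intro tendsto_imp_filterlim_at_right) auto
    then have La: "(\<lambda>n. lagrange_form u u1 p P (a n)) \<longlonglongrightarrow> 0"
      by (rule filterlim_compose[OF lagrange_form_tendsto_0[OF I H2 u0 p P]])
    have "(\<lambda>n. integral {a n..c n} ?G) \<longlonglongrightarrow> integral I ?G"
    proof (rule integral_exhaustion)
      show "?G absolutely_integrable_on I" using Gint F(1) by (simp only: absolutely_integrable_lebesgue_on)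
      show "{a n..c n} \<subseteq> I" for n using F(5)[OF c(1)[of n]] a(3)[of n] by force
      fix x assume x: "x \<in> I"
      have "eventually (\<lambda>n. a n < x) sequentially" using order_tendstoD(2)[OF a0 F(4)[OF x]] .
      with c(2)[OF x] show "eventually (\<lambda>n. x \<in> {a n..c n}) sequentially"
        by eventually_elim auto
    qed
    moreover have "eventually (\<lambda>n. integral {a n..c n} ?G = lagrange_form u u1 p P (c n) - lagrange_form u u1 p P (a n)) sequentially"
      using c(2)[OF x0]
    proof eventually_elim
      case (elim n)
      have "a n \<le> c n" using elim a(2)[of n] by simp
      from integral_unique[OF lagrange_identity[OF I H2 sys a(1) c(1) this]] show ?case .
    qed
    ultimately have "(\<lambda>n. lagrange_form u u1 p P (c n) - lagrange_form u u1 p P (a n)) \<longlonglongrightarrow> integral I ?G"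
      by (rule Lim_transform_eventually)
    moreover have "(\<lambda>n. lagrange_form u u1 p P (c n) - lagrange_form u u1 p P (a n)) \<longlonglongrightarrow> 0 - 0"
      by (intro tendsto_diff c(3) La)
    ultimately have "integral I ?G = 0 - 0" by (rule LIMSEQ_unique)
    then show ?thesis using D DG by simp
  qed
  then show ?thesis unfolding defect_space_def adjoint_graph_def using L2 zL2 by auto
qed

lemma liouville_square_integrable_near_0:
  assumes sys: "bessel_system \<nu> z p P" and p: "subcritical p" and b: "b > 0"
  shows "(\<lambda>x. (cmod (liouville p x))\<^sup>2) absolutely_integrable_on {0<..<b}"
proof -
  obtain \<mu> where \<mu>: "\<mu> < 1" "((\<lambda>x. of_real (x powr \<mu>) * p x) \<longlongrightarrow> 0) (at_right 0)"
    using p unfolding subcritical_def by blast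
  define g where "g x = norm (of_real (x powr \<mu>) * p x)" for x
  have "(g \<longlongrightarrow> norm (0::complex)) (at_right 0)" unfolding g_def by (intro tendsto_intros \<mu>)
  then have "eventually (\<lambda>x. g x < 1) (at_right 0)" by (intro order_tendstoD) auto
  then obtain d where d: "d > 0" "\<And>x. 0 < x \<Longrightarrow> x < d \<Longrightarrow> g x < 1"
    by (auto simp: eventually_at_right[of 0 1])
  have "continuous_on {d/2..b} g"
  proof -
    have sub: "{d/2..b} \<subseteq> {0<..}" using d(1) by (auto intro: less_le_trans[of 0 "d/2"])
    then show ?thesis
      unfolding g_def by (intro continuous_intros bessel_system_continuous_on(1)[OF sys]) auto
  qed
  then have "bounded (g ` {d/2..b})" by (intro compact_imp_bounded compact_continuous_image compact_Icc)
  then obtain K where K0: "\<forall>y\<in>g ` {d/2..b}. norm y \<le> K" unfolding bounded_iff by blast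
  have K: "g x \<le> K" if "x \<in> {d/2..b}" for x
  proof -
    have "norm (g x) \<le> K" using K0 that by blast
    then show ?thesis using abs_ge_self[of "g x"] by simp
  qed
  \<comment> \<open>\<open>g\<close> is bounded on \<open>(0, b)\<close>: near 0 by the limit, and on the rest by compactness.\<close>
  define C where "C = max K 1"
  have C: "g x \<le> C" if "0 < x" "x < b" for x
    using d(2)[of x] K[of x] that d(1) by (cases "x < d") (auto simp: C_def max_def)
  have "(\<lambda>x. x powr (1 - 2 * \<mu>)) integrable_on {0..b}"
    using has_integral_powr_from_0[of "1 - 2 * \<mu>" b] \<mu>(1) b by (auto intro: has_integral_integrable)
  then have "(\<lambda>x. x powr (1 - 2 * \<mu>)) integrable_on {0<..<b}" by (simp only: integrable_on_Icc_iff_Ioo)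
  from integrable_cmul[OF this, of "C\<^sup>2"] have gi: "(\<lambda>x. C\<^sup>2 * x powr (1 - 2 * \<mu>)) integrable_on {0<..<b}"
    by simp
  show ?thesis
  proof (rule measurable_bounded_by_integrable_imp_absolutely_integrable[OF _ _ gi])
    show "(\<lambda>x. (cmod (liouville p x))\<^sup>2) \<in> borel_measurable (lebesgue_on {0<..<b})"
    proof (rule continuous_imp_measurable_on_sets_lebesgue)
      have "{0<..<b} \<subseteq> {0<..}" by auto
      from bessel_system_continuous_on(3)[OF sys this]
      show "continuous_on {0<..<b} (\<lambda>x. (cmod (liouville p x))\<^sup>2)" by (intro continuous_intros)
    qed simp
    fix x assume "x \<in> {0<..<b}"
    then have x: "0 < x" "x < b" by auto
    have "cmod (liouville p x) = x powr (1/2 - \<mu>) * g x"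
    proof -
      have "x powr (1/2) = x powr (1/2 - \<mu>) * x powr \<mu>" by (simp flip: powr_add)
      then show ?thesis by (simp add: liouville_def g_def norm_mult)
    qed
    also have "\<dots> \<le> x powr (1/2 - \<mu>) * C" by (intro mult_left_mono C x) simp
    finally have "(cmod (liouville p x))\<^sup>2 \<le> (x powr (1/2 - \<mu>) * C)\<^sup>2" by (intro power_mono) auto
    also have "\<dots> = C\<^sup>2 * x powr (1 - 2 * \<mu>)"
    proof -
      have "(x powr (1/2 - \<mu>))\<^sup>2 = x powr (1 - 2 * \<mu>)"
        by (simp add: power2_eq_square flip: powr_add)
      then show ?thesis by (simp add: power_mult_distrib mult.commute)
    qed
    finally show "norm ((cmod (liouville p x))\<^sup>2) \<le> C\<^sup>2 * x powr (1 - 2 * \<mu>)" by simp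
  qed simp
qed

lemma liouville_L2_spaceI:
  assumes sys: "bessel_system \<nu> z p P" and I: "bessel_interval I"
    and i: "(\<lambda>x. (cmod (liouville p x))\<^sup>2) absolutely_integrable_on I"
  shows "liouville p \<in> L2_space I"
proof -
  note F = bessel_interval_facts[OF I]
  have "liouville p \<in> borel_measurable (lebesgue_on I)"
    using F by (intro continuous_imp_measurable_on_sets_lebesgue bessel_system_continuous_on(3)[OF sys]) auto
  then show ?thesis using i F(1) by (simp add: L2_space_def absolutely_integrable_lebesgue_on)
qed

lemma liouville_in_defect_space_fin:
  assumes sys: "bessel_system \<nu> z p P" and p: "subcritical p" and P: "subcritical P"
    and b: "b > 0" and pb: "p b = 0"
  shows "liouville p \<in> defect_space {0<..<b} (bessel_operator_fin \<nu> b) z"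
  unfolding bessel_operator_fin_def
proof (rule liouville_in_defect_space[OF _ sys p P])
  show I: "bessel_interval {0<..<b}" using b by (auto simp: bessel_interval_def)
  show "liouville p \<in> L2_space {0<..<b}"
    by (rule liouville_L2_spaceI[OF sys I liouville_square_integrable_near_0[OF sys p b]])
  fix u u1 u2 assume H2: "H2_function {0<..<b} u u1 u2" and ub: "\<forall>x\<in>{b}. u x = 0"
  \<comment> \<open>The shift by two keeps \<open>c 0\<close> away from the endpoint 0.\<close>
  define c where "c n = b - b / real (Suc (Suc n))" for n
  have c: "c n \<in> {0<..<b}" for n
    using b by (auto simp: c_def field_simps add_pos_nonneg)
  have lim: "c \<longlonglongrightarrow> b"
  proof -
    have "(\<lambda>n. b / real (Suc (Suc n))) \<longlonglongrightarrow> 0"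
      using LIMSEQ_Suc[OF LIMSEQ_Suc[OF lim_const_over_n[of b]]] by simp
    from tendsto_diff[OF tendsto_const this, of b] show ?thesis by (simp add: c_def[abs_def])
  qed
  have cl: "closure {0<..<b} = {0..b}" using b by simp
  have ucont: "(\<lambda>n. u (c n)) \<longlonglongrightarrow> u b"
  proof -
    have "(u has_vector_derivative u1 b) (at b within {0..b})"
      using H2 b unfolding H2_function_def cl by simp
    then have "continuous (at b within {0..b}) u" by (rule has_vector_derivative_continuous)
    then show ?thesis
      using c lim unfolding continuous_within_sequentially by (auto simp: o_def less_imp_le)
  qed
  have u1cont: "(\<lambda>n. u1 (c n)) \<longlonglongrightarrow> u1 b"
  proof -
    have i: "(u2 has_integral (u1 y - u1 0)) {0..y}" if "y \<in> {0..b}" for y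
      using H2 that unfolding H2_function_def cl by auto
    have "continuous_on {0..b} u1"
    proof (rule continuous_on_eq)
      show "continuous_on {0..b} (\<lambda>y. u1 0 + integral {0..y} u2)"
        using i[of b] b by (intro continuous_on_add[OF continuous_on_const] indefinite_integral_continuous_1)
          (auto intro: has_integral_integrable)
      show "u1 0 + integral {0..y} u2 = u1 y" if "y \<in> {0..b}" for y
        using integral_unique[OF i[OF that]] by simp
    qed
    then have "continuous (at b within {0..b}) u1" using b by (simp add: continuous_on_eq_continuous_within)
    then show ?thesis
      using c lim unfolding continuous_within_sequentially by (auto simp: o_def less_imp_le)
  qed
  have fc: "(\<lambda>n. f (c n)) \<longlonglongrightarrow> f b" if "continuous_on {0<..} f" for f :: "real \<Rightarrow> complex"
    using continuous_on_tendsto_compose[OF that lim] b c by auto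
  have "(\<lambda>n. lagrange_form u u1 p P (c n)) \<longlonglongrightarrow> u b * cnj (liouville_deriv p P b) - u1 b * cnj (liouville p b)"
    unfolding lagrange_form_def
    by (intro tendsto_intros ucont u1cont fc bessel_system_continuous_on[OF sys] order_refl)
  then have "(\<lambda>n. lagrange_form u u1 p P (c n)) \<longlonglongrightarrow> 0"
    using ub pb by (simp add: liouville_def)
  moreover have "eventually (\<lambda>n. x \<le> c n) sequentially" if "x \<in> {0<..<b}" for x
    using order_tendstoD(1)[OF lim, of x] that by (auto elim: eventually_mono)
  ultimately show "\<exists>c. (\<forall>n. c n \<in> {0<..<b}) \<and> (\<forall>x\<in>{0<..<b}. eventually (\<lambda>n. x \<le> c n) sequentially) \<and>
      (\<lambda>n. lagrange_form u u1 p P (c n)) \<longlonglongrightarrow> 0"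
    using c by blast
qed

text \<open>
  The energy increases and stays nonpositive, so its derivative is integrable. On \<open>[1, \<infinity>)\<close> the energy
  density dominates both \<open>\<bar>f\<bar>\<^sup>2\<close> and \<open>\<bar>f'\<bar>\<^sup>2\<close> for \<open>f = liouville p\<close>.
\<close>

lemma liouville_square_integrable_at_top:
  assumes sys: "bessel_system \<nu> z p P" and s: "s\<^sup>2 = - z" "Re s > 0"
    and neg: "\<And>x. x > 0 \<Longrightarrow> energy s p P x \<le> 0"
  shows "(\<lambda>x. (cmod (liouville p x))\<^sup>2) absolutely_integrable_on {1..}"
    and "(\<lambda>x. (cmod (liouville_deriv p P x))\<^sup>2) absolutely_integrable_on {1..}"
proof -
  let ?D = "energy_density \<nu> s p P"
  have cP: "continuous_on S P" and cp: "continuous_on S p" if "S \<subseteq> {0<..}" for S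
    using bessel_system_continuous_on[OF sys that] by auto
  have cD: "continuous_on S ?D" if "S \<subseteq> {0<..}" for S
    unfolding energy_density_def using that by (intro continuous_intros cP cp that) auto
  have int: "integral {1..1 + real k} ?D \<le> - energy s p P 1 / Re s" "?D integrable_on {1..1 + real k}" for k
  proof -
    show i: "?D integrable_on {1..1 + real k}" by (intro integrable_continuous_real cD) auto
    have "(energy s p P has_vector_derivative Re s * ?D x) (at x within {1..1 + real k})"
      if "x \<in> {1..1 + real k}" for x
    proof -
      have "x > 0" using that by simp
      from energy_deriv[OF sys s(1) this] show ?thesis
        unfolding has_real_derivative_iff_has_vector_derivative by (rule has_vector_derivative_at_within)
    qed
    from fundamental_theorem_of_calculus[OF _ this]
    have "((\<lambda>x. Re s * ?D x) has_integral (energy s p P (1 + real k) - energy s p P 1)) {1..1 + real k}"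
      by simp
    then have "Re s * integral {1..1 + real k} ?D = energy s p P (1 + real k) - energy s p P 1"
      by (simp only: integral_mult_right[symmetric] integral_unique)
    also have "\<dots> \<le> - energy s p P 1" using neg[of "1 + real k"] by simp
    finally show "integral {1..1 + real k} ?D \<le> - energy s p P 1 / Re s"
      by (simp only: pos_le_divide_eq[OF s(2)] mult.commute)
  qed
  have nn: "?D x \<ge> 0" if "x \<ge> 1" for x using that by (intro energy_density_nonneg) simp
  have Dint: "?D integrable_on {1..}"
  proof (rule monotone_convergence_increasing[THEN conjunct1])
    fix k
    have inter: "{1..1 + real k} \<inter> {1..} = {1..1 + real k}" for k by auto
    have eq: "integral {1..} (\<lambda>x. if x \<in> {1..1 + real k} then ?D x else 0) = integral {1..1 + real k} ?D" for k
      unfolding integral_restrict_Int inter ..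
    show "(\<lambda>x. if x \<in> {1..1 + real k} then ?D x else 0) integrable_on {1..}"
      unfolding integrable_restrict_Int inter by (rule int(2))
    show "(if x \<in> {1..1 + real k} then ?D x else 0) \<le> (if x \<in> {1..1 + real (Suc k)} then ?D x else 0)"
      if "x \<in> {1..}" for x using that nn[of x] by auto
    show "(\<lambda>k. if x \<in> {1..1 + real k} then ?D x else 0) \<longlonglongrightarrow> ?D x" if "x \<in> {1..}" for x
    proof (rule tendsto_eventually)
      obtain N where N: "x \<le> real N" using real_arch_simple by blast
      show "eventually (\<lambda>k. (if x \<in> {1..1 + real k} then ?D x else 0) = ?D x) sequentially"
        using eventually_ge_at_top[of N] by eventually_elim (use N that in auto)
    qed
    have "norm (integral {1..1 + real k} ?D) \<le> - energy s p P 1 / Re s" for k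
      using int(1)[of k] integral_nonneg[OF int(2)[of k]] nn by auto
    then show "bounded (range (\<lambda>k. integral {1..} (\<lambda>x. if x \<in> {1..1 + real k} then ?D x else 0)))"
      unfolding eq bounded_iff by blast
  qed
  have s0: "cmod s > 0" using s(2) by auto
  have meas: "(\<lambda>x. (cmod (f x))\<^sup>2) \<in> borel_measurable (lebesgue_on {1..})" if "continuous_on {1..} f" for f :: "real \<Rightarrow> complex"
    by (intro continuous_imp_measurable_on_sets_lebesgue continuous_intros that) simp
  have sub: "{1::real..} \<subseteq> {0<..}" by auto
  have sq: "(x powr (1/2))\<^sup>2 = x" "(x powr (-1/2))\<^sup>2 = 1 / x" if "x > 0" for x :: real
    using that by (simp_all add: power2_eq_square powr_minus_divide flip: powr_add)
  have 1: "(cmod (liouville p x))\<^sup>2 \<le> 1 / (cmod s)\<^sup>2 * ?D x" if x: "x \<ge> 1" for x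
  proof -
    have "(cmod (liouville p x))\<^sup>2 = x * (cmod (p x))\<^sup>2"
      using x sq[of x] by (simp add: liouville_def norm_mult power_mult_distrib)
    moreover have "(cmod s)\<^sup>2 * x * (cmod (p x))\<^sup>2 \<le> ?D x" using x by (simp add: energy_density_def)
    ultimately show ?thesis using s0 by (simp add: field_simps)
  qed
  have 2: "(cmod (liouville_deriv p P x))\<^sup>2 \<le> (2 + 1 / (cmod s)\<^sup>2) * ?D x" if x: "x \<ge> 1" for x
  proof -
    have "(cmod (liouville_deriv p P x))\<^sup>2 = (cmod (P x + p x / 2))\<^sup>2 / x"
      using x sq[of x] by (simp add: liouville_deriv_def norm_mult power_mult_distrib)
    also have "(cmod (P x + p x / 2))\<^sup>2 \<le> 2 * (cmod (P x))\<^sup>2 + (cmod (p x))\<^sup>2"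
    proof -
      have "(cmod (P x + p x / 2))\<^sup>2 \<le> (cmod (P x) + cmod (p x / 2))\<^sup>2"
        by (intro power_mono norm_triangle_ineq) simp
      also have "\<dots> \<le> 2 * (cmod (P x))\<^sup>2 + 2 * (cmod (p x / 2))\<^sup>2"
        using sum_squares_bound[of "cmod (P x)" "cmod (p x / 2)"] by (simp add: power2_sum)
      also have "2 * (cmod (p x / 2))\<^sup>2 \<le> (cmod (p x))\<^sup>2" by (simp add: norm_divide power_divide)
      finally show ?thesis by simp
    qed
    also have "(2 * (cmod (P x))\<^sup>2 + (cmod (p x))\<^sup>2) / x \<le> 2 * ((cmod (P x))\<^sup>2 / x) + x * (cmod (p x))\<^sup>2"
    proof -
      have "(cmod (p x))\<^sup>2 / x \<le> (cmod (p x))\<^sup>2 / 1" using x by (intro divide_left_mono) auto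
      also have "\<dots> \<le> x * (cmod (p x))\<^sup>2" using x mult_right_mono[of 1 x "(cmod (p x))\<^sup>2"] by simp
      finally show ?thesis by (simp add: add_divide_distrib)
    qed
    also have "\<dots> \<le> 2 * ?D x + 1 / (cmod s)\<^sup>2 * ?D x"
    proof (intro add_mono mult_left_mono)
      show "(cmod (P x))\<^sup>2 / x \<le> ?D x" using x by (simp add: energy_density_def)
      show "x * (cmod (p x))\<^sup>2 \<le> 1 / (cmod s)\<^sup>2 * ?D x"
        using 1[OF x] x sq[of x] by (simp add: liouville_def norm_mult power_mult_distrib)
    qed simp
    finally show ?thesis using x by (simp add: divide_right_mono algebra_simps)
  qed
  show "(\<lambda>x. (cmod (liouville p x))\<^sup>2) absolutely_integrable_on {1..}"
    using 1 integrable_cmul[OF Dint, of "1 / (cmod s)\<^sup>2"]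
    by (intro measurable_bounded_by_integrable_imp_absolutely_integrable[of _ _ "\<lambda>x. 1 / (cmod s)\<^sup>2 * ?D x"]
        meas bessel_system_continuous_on[OF sys] sub) auto
  show "(\<lambda>x. (cmod (liouville_deriv p P x))\<^sup>2) absolutely_integrable_on {1..}"
    using 2 integrable_cmul[OF Dint, of "2 + 1 / (cmod s)\<^sup>2"]
    by (intro measurable_bounded_by_integrable_imp_absolutely_integrable[of _ _ "\<lambda>x. (2 + 1 / (cmod s)\<^sup>2) * ?D x"]
        meas bessel_system_continuous_on[OF sys] sub) auto
qed

text \<open>
  The boundary term at infinity is built from products of square integrable functions. It is
  therefore integrable, and so it is small along some sequence tending to infinity.
\<close>

lemma liouville_in_defect_space_inf:
  assumes sys: "bessel_system \<nu> z p P" and p: "subcritical p" and P: "subcritical P"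
    and s: "s\<^sup>2 = - z" "Re s > 0" and neg: "\<And>x. x > 0 \<Longrightarrow> energy s p P x \<le> 0"
  shows "liouville p \<in> defect_space {0<..} (bessel_operator_inf \<nu>) z"
  unfolding bessel_operator_inf_def
proof (rule liouville_in_defect_space[OF _ sys p P])
  show I: "bessel_interval {0<..}" by (auto simp: bessel_interval_def)
  note top = liouville_square_integrable_at_top[OF sys s neg]
  have un: "{0<..} = {0<..<2} \<union> {1::real..}" by auto
  have "(\<lambda>x. (cmod (liouville p x))\<^sup>2) absolutely_integrable_on {0<..}"
    unfolding un using top(1) liouville_square_integrable_near_0[OF sys p, of 2]
    by (intro set_integrable_Un) auto
  then show L2: "liouville p \<in> L2_space {0<..}" by (rule liouville_L2_spaceI[OF sys I])
  fix u u1 u2 assume H2: "H2_function {0<..} u u1 u2"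
  let ?L = "lagrange_form u u1 p P"
  have sub: "{1::real..} \<subseteq> {0<..}" by auto
  have L2r: "f \<in> L2_space {1..}" if f: "f \<in> L2_space {0<..}" for f
  proof -
    have "(\<lambda>x. (cmod (f x))\<^sup>2) absolutely_integrable_on {0<..}"
      using f by (simp add: L2_space_def absolutely_integrable_lebesgue_on)
    then have "(\<lambda>x. (cmod (f x))\<^sup>2) absolutely_integrable_on {1..}"
      by (rule set_integrable_subset) (use sub in auto)
    then show ?thesis
      using f sub by (auto simp: L2_space_def absolutely_integrable_lebesgue_on intro: measurable_restrict_mono)
  qed
  have d: "liouville_deriv p P \<in> L2_space {1..}"
    using top(2) bessel_system_continuous_on(4)[OF sys sub]
    by (auto simp: L2_space_def absolutely_integrable_lebesgue_on intro: continuous_imp_measurable_on_sets_lebesgue)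
  have u: "u \<in> L2_space {0<..}" "u1 \<in> L2_space {0<..}" using H2 by (auto simp: H2_function_def)
  have "integrable (lebesgue_on {1..}) ?L"
    unfolding lagrange_form_def
    by (intro Bochner_Integration.integrable_diff L2_space_mult_integrable d L2r u L2)
  then have Lint: "?L absolutely_integrable_on {1..}" by (simp add: absolutely_integrable_lebesgue_on)
  define c where "c n = (SOME x. real n + 1 \<le> x \<and> norm (?L x) < 1 / real (Suc n))" for n
  have c_props: "real n + 1 \<le> c n \<and> norm (?L (c n)) < 1 / real (Suc n)" for n
    unfolding c_def by (rule someI_ex) (rule integrable_imp_arbitrarily_small[OF Lint], simp)
  have c: "c n \<ge> real n + 1" "norm (?L (c n)) < 1 / real (Suc n)" for n
    by (rule c_props[THEN conjunct1], rule c_props[THEN conjunct2])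
  have "(\<lambda>n. ?L (c n)) \<longlonglongrightarrow> 0"
  proof (rule Lim_null_comparison)
    show "eventually (\<lambda>n. norm (?L (c n)) \<le> 1 / real (Suc n)) sequentially"
      by (intro always_eventually allI less_imp_le c)
    show "(\<lambda>n. 1 / real (Suc n)) \<longlonglongrightarrow> 0" by (rule LIMSEQ_Suc[OF lim_const_over_n])
  qed
  moreover have "c n \<in> {0<..}" for n using c(1)[of n] by simp
  moreover have "eventually (\<lambda>n. x \<le> c n) sequentially" for x
  proof -
    obtain N where N: "x \<le> real N" using real_arch_simple by blast
    show ?thesis
      using eventually_ge_at_top[of N]
    proof eventually_elim
      case (elim n)
      then show ?case using N c(1)[of n] by linarith
    qed
  qed
  ultimately show "\<exists>c. (\<forall>n. c n \<in> {0<..}) \<and> (\<forall>x\<in>{0<..}. eventually (\<lambda>n. x \<le> c n) sequentially) \<and>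
      (\<lambda>n. lagrange_form u u1 p P (c n)) \<longlonglongrightarrow> 0"
    by blast
qed

section \<open>Boundary values\<close>

lemma powr_mult_tendsto_0_lincomb:
  fixes p r :: "real \<Rightarrow> complex"
  assumes "((\<lambda>x. of_real (x powr \<kappa>) * p x) \<longlongrightarrow> 0) (at_right 0)" "((\<lambda>x. of_real (x powr \<kappa>) * r x) \<longlongrightarrow> 0) (at_right 0)"
  shows "((\<lambda>x. of_real (x powr \<kappa>) * (p x + c * r x)) \<longlongrightarrow> 0) (at_right 0)"
proof -
  have "((\<lambda>x. of_real (x powr \<kappa>) * p x + c * (of_real (x powr \<kappa>) * r x)) \<longlongrightarrow> 0 + c * 0) (at_right 0)"
    by (intro tendsto_intros assms)
  then show ?thesis by (simp add: algebra_simps)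
qed

lemma powr_mult_bounded_tendsto_0:
  fixes f :: "real \<Rightarrow> complex"
  assumes "(f \<longlongrightarrow> l) (at_right 0)" "s > 0"
  shows "((\<lambda>x. of_real (x powr s) * f x) \<longlongrightarrow> 0) (at_right 0)"
proof -
  have "((\<lambda>x::real. x powr s) \<longlongrightarrow> 0) (at_right 0)" using assms(2) by real_asymp
  from tendsto_mult[OF tendsto_of_real[OF this] assms(1)] show ?thesis by simp
qed

lemma frobenius_growth:
  assumes "\<mu> > -1" "\<kappa> + \<mu> > 0"
  shows "((\<lambda>x. of_real (x powr \<kappa>) * frobenius \<mu> z x) \<longlongrightarrow> 0) (at_right 0)"
    and "((\<lambda>x. of_real (x powr \<kappa>) * frobenius_quasi \<mu> z x) \<longlongrightarrow> 0) (at_right 0)"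
proof -
  have eq: "of_real (x powr \<kappa>) * (of_real (x powr \<mu>) * y) = of_real (x powr (\<kappa> + \<mu>)) * y" for x and y :: complex
    by (simp add: powr_add)
  show "((\<lambda>x. of_real (x powr \<kappa>) * frobenius \<mu> z x) \<longlongrightarrow> 0) (at_right 0)"
    unfolding frobenius_def eq
    by (rule powr_mult_bounded_tendsto_0[OF entire_series_square_tendsto assms(2)])
      (intro entire_coeffs_intros assms)
  have "((\<lambda>x. of_real \<mu> * bessel_E \<mu> (z * of_real (x\<^sup>2)) + 2 * bessel_E1 \<mu> (z * of_real (x\<^sup>2))) \<longlongrightarrow>
      of_real \<mu> * bessel_coeff \<mu> 0 + 2 * euler_op (bessel_coeff \<mu>) 0) (at_right 0)"
    by (intro tendsto_intros entire_series_square_tendsto entire_coeffs_intros assms)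
  then show "((\<lambda>x. of_real (x powr \<kappa>) * frobenius_quasi \<mu> z x) \<longlongrightarrow> 0) (at_right 0)"
    unfolding frobenius_quasi_def eq by (rule powr_mult_bounded_tendsto_0[OF _ assms(2)])
qed

text \<open>
  A factor \<open>x\<close> is taken from the series, which is \<open>O(x\<^sup>2)\<close>, to beat the logarithms.
\<close>

lemma ln_mult_entire_tendsto_0:
  assumes "entire_coeffs c" "c 0 = 0"
  shows "((\<lambda>x. of_real (ln x) * entire_series c (z * of_real (x\<^sup>2))) \<longlongrightarrow> 0) (at_right 0)"
    and "((\<lambda>x. of_real (ln x) * (of_real (ln x) * entire_series c (z * of_real (x\<^sup>2)))) \<longlongrightarrow> 0) (at_right 0)"
proof -
  have e: "((\<lambda>x. of_real (x powr (-1)) * entire_series c (z * of_real (x\<^sup>2))) \<longlongrightarrow> 0) (at_right 0)"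
    by (rule powr_square_mult_tendsto_0[OF assms]) simp
  have 1: "((\<lambda>x::real. x powr 1 * ln x) \<longlongrightarrow> 0) (at_right 0)" by real_asymp
  have 2: "((\<lambda>x::real. x powr 1 * ln x * ln x) \<longlongrightarrow> 0) (at_right 0)" by real_asymp
  have eq: "of_real (x powr 1 * y) * (of_real (x powr (-1)) * w) = of_real y * w" if "x > 0" for x y :: real and w :: complex
    using that by (simp add: powr_minus_divide)
  have "((\<lambda>x. of_real (x powr 1 * ln x) * (of_real (x powr (-1)) * entire_series c (z * of_real (x\<^sup>2)))) \<longlongrightarrow> of_real 0 * 0) (at_right 0)"
    by (intro tendsto_mult tendsto_of_real 1 e)
  then have "((\<lambda>x. of_real (x powr 1 * ln x) * (of_real (x powr (-1)) * entire_series c (z * of_real (x\<^sup>2)))) \<longlongrightarrow> 0) (at_right 0)"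
    by simp
  then show "((\<lambda>x. of_real (ln x) * entire_series c (z * of_real (x\<^sup>2))) \<longlongrightarrow> 0) (at_right 0)"
    by (rule Lim_transform_eventually) (use eventually_at_right_less[of 0] in eventually_elim, rule eq)
  have "((\<lambda>x. of_real (x powr 1 * (ln x * ln x)) * (of_real (x powr (-1)) * entire_series c (z * of_real (x\<^sup>2)))) \<longlongrightarrow> of_real 0 * 0) (at_right 0)"
    using 2 by (intro tendsto_mult tendsto_of_real e) (simp add: mult.assoc)
  then have "((\<lambda>x. of_real (x powr 1 * (ln x * ln x)) * (of_real (x powr (-1)) * entire_series c (z * of_real (x\<^sup>2)))) \<longlongrightarrow> 0) (at_right 0)"
    by simp
  then have "((\<lambda>x. of_real (ln x * ln x) * entire_series c (z * of_real (x\<^sup>2))) \<longlongrightarrow> 0) (at_right 0)"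
    by (rule Lim_transform_eventually) (use eventually_at_right_less[of 0] in eventually_elim, rule eq)
  then show "((\<lambda>x. of_real (ln x) * (of_real (ln x) * entire_series c (z * of_real (x\<^sup>2)))) \<longlongrightarrow> 0) (at_right 0)"
    by (simp add: mult.assoc)
qed

lemma singular_growth:
  assumes \<nu>: "0 \<le> \<nu>" "\<nu> < 1"
  defines "\<kappa> \<equiv> (1 + \<nu>) / 2"
  shows "((\<lambda>x. of_real (x powr \<kappa>) * singular \<nu> z x) \<longlongrightarrow> 0) (at_right 0)"
    and "((\<lambda>x. of_real (x powr \<kappa>) * singular_quasi \<nu> z x) \<longlongrightarrow> 0) (at_right 0)"
proof -
  show "((\<lambda>x. of_real (x powr \<kappa>) * singular \<nu> z x) \<longlongrightarrow> 0) (at_right 0)"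
  proof (cases "\<nu> = 0")
    case True
    have "((\<lambda>x::real. x powr (1/2) * ln x) \<longlongrightarrow> 0) (at_right 0)" by real_asymp
    from tendsto_mult[OF tendsto_of_real[OF this] entire_series_square_tendsto[OF entire_coeffs_bessel[of 0], of z]]
    have "((\<lambda>x. of_real (x powr (1/2) * ln x) * bessel_E 0 (z * of_real (x\<^sup>2))) \<longlongrightarrow> 0) (at_right 0)" by simp
    from tendsto_diff[OF powr_mult_bounded_tendsto_0[OF entire_series_square_tendsto[OF entire_coeffs_bessel_log, of z], of "1/2"] this]
    show ?thesis unfolding True \<kappa>_def singular_def log_solution_def by (simp add: algebra_simps)
  next
    case False
    have "((\<lambda>x. of_real (x powr \<kappa>) * frobenius (- \<nu>) z x / of_real (2 * \<nu>)) \<longlongrightarrow> 0 / of_real (2 * \<nu>)) (at_right 0)"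
      using \<nu> False by (intro tendsto_intros frobenius_growth) (auto simp: \<kappa>_def)
    then show ?thesis using False by (simp add: singular_def)
  qed
  show "((\<lambda>x. of_real (x powr \<kappa>) * singular_quasi \<nu> z x) \<longlongrightarrow> 0) (at_right 0)"
  proof (cases "\<nu> = 0")
    case True
    have "((\<lambda>x. 2 * bessel_L1 (z * of_real (x\<^sup>2)) - bessel_E 0 (z * of_real (x\<^sup>2))
        - 2 * (of_real (ln x) * bessel_E1 0 (z * of_real (x\<^sup>2)))) \<longlongrightarrow>
        2 * euler_op bessel_log_coeff 0 - bessel_coeff 0 0 - 2 * 0) (at_right 0)"
      by (intro tendsto_intros entire_series_square_tendsto ln_mult_entire_tendsto_0 entire_coeffs_intros)
        (auto simp: euler_op_def)
    from powr_mult_bounded_tendsto_0[OF this, of "1/2"]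
    show ?thesis unfolding True \<kappa>_def singular_quasi_def log_solution_quasi_def by simp
  next
    case False
    have "((\<lambda>x. of_real (x powr \<kappa>) * frobenius_quasi (- \<nu>) z x / of_real (2 * \<nu>)) \<longlongrightarrow> 0 / of_real (2 * \<nu>)) (at_right 0)"
      using \<nu> False by (intro tendsto_intros frobenius_growth) (auto simp: \<kappa>_def)
    then show ?thesis using False by (simp add: singular_quasi_def)
  qed
qed

lemma subcritical_weyl_sol:
  assumes \<nu>: "0 \<le> \<nu>" "\<nu> < 1"
  shows "subcritical (weyl_sol \<nu> z m)" "subcritical (weyl_sol_quasi \<nu> z m)"
proof -
  have k: "(1 + \<nu>) / 2 < 1" "(1 + \<nu>) / 2 + \<nu> > 0" "\<nu> > -1" using \<nu> by (auto intro: add_pos_nonneg)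
  show "subcritical (weyl_sol \<nu> z m)"
    unfolding subcritical_def weyl_sol_def
    by (rule exI[of _ "(1 + \<nu>) / 2"]) (intro conjI k powr_mult_tendsto_0_lincomb singular_growth \<nu> frobenius_growth)
  show "subcritical (weyl_sol_quasi \<nu> z m)"
    unfolding subcritical_def weyl_sol_quasi_def
    by (rule exI[of _ "(1 + \<nu>) / 2"]) (intro conjI k powr_mult_tendsto_0_lincomb singular_growth \<nu> frobenius_growth)
qed

text \<open>
  The weights \<open>sqrt x\<close> cancel, and the bracket becomes the Wronskian of the quasi-derivatives.
\<close>

lemma bracket_liouville:
  assumes p: "(p has_vector_derivative P x / of_real x) (at x)" and r: "(r has_vector_derivative R x / of_real x) (at x)"
    and x: "x > 0"
  shows "bracket (liouville p) (liouville r) x = p x * cnj (R x) - P x * cnj (r x)"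
proof -
  have "x powr (1/2) * x powr (-1/2) = 1" using x by (simp flip: powr_add)
  then have inv: "complex_of_real (x powr (1/2)) * of_real (x powr (-1/2)) = 1"
    by (simp only: of_real_1 flip: of_real_mult)
  have "bracket (liouville p) (liouville r) x
      = liouville p x * cnj (liouville_deriv r R x) - liouville_deriv p P x * cnj (liouville r x)"
    unfolding bracket_def
    using liouville_has_vector_derivative[where p = p and P = P, OF p x]
      liouville_has_vector_derivative[where p = r and P = R, OF r x] by (simp add: vector_derivative_at)
  also have "\<dots> = (of_real (x powr (1/2)) * of_real (x powr (-1/2))) * (p x * cnj (R x) - P x * cnj (r x))"
    unfolding liouville_def liouville_deriv_def
    by (simp only: complex_cnj_mult complex_cnj_complex_of_real complex_cnj_add complex_cnj_divide complex_cnj_numeral)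
      (simp add: algebra_simps)
  finally show ?thesis unfolding inv by simp
qed

lemma ae_eq_continuous_imp_eq:
  assumes I: "open I" and f: "continuous_on I f" and g: "continuous_on I g" and ae: "ae_eq I f g" and x: "x \<in> I"
  shows "f x = (g x :: complex)"
proof -
  let ?S = "I \<inter> (\<lambda>x. f x - g x) -` (- {0})"
  have op: "open ?S"
    by (rule continuous_open_preimage[OF continuous_on_diff[OF f g] I]) (simp add: open_Compl)
  have I_leb: "I \<in> sets lebesgue" using I by simp
  have "AE x in lebesgue. x \<in> I \<longrightarrow> f x = g x"
    using ae I_leb unfolding ae_eq_def by (simp add: AE_restrict_space_iff)
  moreover have S: "?S = {x \<in> space lebesgue. \<not> (x \<in> I \<longrightarrow> f x = g x)}" by auto
  moreover have "?S \<in> sets lebesgue" using op by simp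
  ultimately have "?S \<in> null_sets lebesgue" using AE_iff_null[of lebesgue "\<lambda>x. x \<in> I \<longrightarrow> f x = g x"] by simp
  then have "negligible ?S" by (simp add: negligible_iff_null_sets)
  then have "?S = {}" using op open_not_negligible by blast
  then show ?thesis using x by auto
qed

text \<open>
  Two continuously differentiable representatives on the open set \<open>I\<close> coincide there, and so do
  their brackets.
\<close>

lemma bracket0_eqI:
  assumes I: "bessel_interval I" and f: "f C1_differentiable_on I" and lim: "(bracket f g \<longlongrightarrow> c) (at_right 0)"
  shows "bracket0 I f g = c"
  unfolding bracket0_def
proof (rule the_equality)
  show "\<exists>u. ae_eq I f u \<and> u C1_differentiable_on I \<and> (bracket u g \<longlongrightarrow> c) (at_right 0)"
    using f lim by (intro exI[of _ f]) (simp add: ae_eq_def)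
next
  note F = bessel_interval_facts[OF I]
  fix d assume "\<exists>u. ae_eq I f u \<and> u C1_differentiable_on I \<and> (bracket u g \<longlongrightarrow> d) (at_right 0)"
  then obtain u where u: "ae_eq I f u" "u C1_differentiable_on I" "(bracket u g \<longlongrightarrow> d) (at_right 0)" by blast
  have eq: "f x = u x" if "x \<in> I" for x
    using ae_eq_continuous_imp_eq[OF F(2) C1_differentiable_imp_continuous_on[OF f]
        C1_differentiable_imp_continuous_on[OF u(2)] u(1) that] .
  have beq: "bracket f g x = bracket u g x" if x: "x \<in> I" for x
  proof -
    obtain D where D: "(f has_vector_derivative D) (at x)"
      using f x unfolding C1_differentiable_on_def by blast
    then have "(u has_vector_derivative D) (at x)"
      by (rule has_vector_derivative_transform_within_open[OF _ F(2) x]) (rule eq)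
    then show ?thesis using D eq[OF x] by (simp add: bracket_def vector_derivative_at)
  qed
  obtain x0 where x0: "x0 \<in> I" using F(3) by blast
  have "eventually (\<lambda>x. bracket u g x = bracket f g x) (at_right 0)"
    using F(4,5)[OF x0] beq by (force simp: eventually_at_right[of 0 x0])
  with u(3) have "(bracket f g \<longlongrightarrow> d) (at_right 0)" by (rule Lim_transform_eventually)
  then show "d = c" using lim by (rule tendsto_unique[OF trivial_limit_at_right_real])
qed

lemma liouville_C1:
  assumes sys: "bessel_system \<nu> z p P" and I: "bessel_interval I"
  shows "liouville p C1_differentiable_on I"
  unfolding C1_differentiable_on_def
proof (intro exI[of _ "liouville_deriv p P"] conjI ballI)
  note F = bessel_interval_facts[OF I]
  show "(liouville p has_vector_derivative liouville_deriv p P x) (at x)" if "x \<in> I" for x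
    by (rule liouville_has_derivs(1)[OF sys F(4)[OF that]])
  show "continuous_on I (liouville_deriv p P)"
    using F(4) by (intro bessel_system_continuous_on(4)[OF sys]) auto
qed

lemma bracket0_liouville:
  assumes I: "bessel_interval I" and sys: "bessel_system \<nu> z p P"
    and r: "\<And>x. x > 0 \<Longrightarrow> (r has_vector_derivative R x / of_real x) (at x)"
    and lim: "((\<lambda>x. p x * cnj (R x) - P x * cnj (r x)) \<longlongrightarrow> c) (at_right 0)"
  shows "bracket0 I (liouville p) (liouville r) = c"
proof (rule bracket0_eqI[OF I liouville_C1[OF sys I]])
  show "(bracket (liouville p) (liouville r) \<longlongrightarrow> c) (at_right 0)"
    using lim
  proof (rule Lim_transform_eventually)
    show "eventually (\<lambda>x. p x * cnj (R x) - P x * cnj (r x) = bracket (liouville p) (liouville r) x) (at_right 0)"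
      using eventually_at_right_less[of 0]
    proof eventually_elim
      case (elim x)
      then have "(p has_vector_derivative P x / of_real x) (at x)"
        using sys unfolding bessel_system_def by blast
      from bracket_liouville[where p = p and P = P and r = r and R = R, OF this r[OF elim] elim] show ?case by simp
    qed
  qed
qed

lemma powr_as_liouville:
  "(\<lambda>x. complex_of_real (x powr (1/2 + \<mu>))) = liouville (\<lambda>x. of_real (x powr \<mu>))"
  by (simp add: fun_eq_iff liouville_def powr_add)

lemma frobenius_boundary_form:
  assumes "x > 0"
  shows "of_real (x powr (-\<mu>)) * (frobenius_quasi \<mu> z x + of_real \<mu> * frobenius \<mu> z x)
      = 2 * of_real \<mu> * bessel_E \<mu> (z * of_real (x\<^sup>2)) + 2 * bessel_E1 \<mu> (z * of_real (x\<^sup>2))"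
    and "of_real (x powr \<mu>) * (frobenius_quasi \<mu> z x - of_real \<mu> * frobenius \<mu> z x)
      = 2 * (of_real (x powr (2 * \<mu>)) * bessel_E1 \<mu> (z * of_real (x\<^sup>2)))"
proof -
  have "x powr (-\<mu>) * x powr \<mu> = 1" using assms by (simp flip: powr_add)
  then have 1: "complex_of_real (x powr (-\<mu>)) * of_real (x powr \<mu>) = 1"
    by (simp only: of_real_1 flip: of_real_mult)
  have 2: "complex_of_real (x powr (2 * \<mu>)) = of_real (x powr \<mu>) * of_real (x powr \<mu>)"
    by (simp flip: powr_add of_real_mult)
  have "Y * (X * (m * e + 2 * e1) + m * (X * e)) = (Y * X) * (2 * m * e + 2 * e1)" for X Y m e e1 :: complex
    by (simp add: algebra_simps)
  from this[of "of_real (x powr (-\<mu>))" "of_real (x powr \<mu>)"]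
  show "of_real (x powr (-\<mu>)) * (frobenius_quasi \<mu> z x + of_real \<mu> * frobenius \<mu> z x)
      = 2 * of_real \<mu> * bessel_E \<mu> (z * of_real (x\<^sup>2)) + 2 * bessel_E1 \<mu> (z * of_real (x\<^sup>2))"
    unfolding frobenius_def frobenius_quasi_def 1 by (simp only: mult_1_left)
  show "of_real (x powr \<mu>) * (frobenius_quasi \<mu> z x - of_real \<mu> * frobenius \<mu> z x)
      = 2 * (of_real (x powr (2 * \<mu>)) * bessel_E1 \<mu> (z * of_real (x\<^sup>2)))"
    unfolding frobenius_def frobenius_quasi_def 2 by (simp add: algebra_simps)
qed

text \<open>
  The boundary map \<open>\<Gamma>\<^sub>0\<close> is the Wronskian with \<open>x powr \<nu>\<close> at 0. It annihilates \<open>frobenius \<nu> z\<close>, which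
  has the same leading term, and is 1 on \<open>singular \<nu> z\<close>.
\<close>

lemma Gamma_0_weyl_sol:
  assumes \<nu>: "0 \<le> \<nu>" "\<nu> < 1" and I: "bessel_interval I"
  shows "Gamma_0 \<nu> I (liouville (weyl_sol \<nu> z m)) = 1"
  unfolding Gamma_0_def powr_as_liouville
proof (rule bracket0_liouville[OF I bessel_system_weyl_sol[OF \<nu>] powr_vector_deriv])
  let ?X = "\<lambda>x. complex_of_real (x powr \<nu>)" and ?Z = "\<lambda>x::real. z * of_real (x\<^sup>2)"
  have reg: "((\<lambda>x. ?X x * (frobenius_quasi \<nu> z x - of_real \<nu> * frobenius \<nu> z x)) \<longlongrightarrow> 0) (at_right 0)"
  proof -
    have "((\<lambda>x. 2 * (of_real (x powr (2 * \<nu>)) * bessel_E1 \<nu> (?Z x))) \<longlongrightarrow> 2 * 0) (at_right 0)"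
      using \<nu> by (intro tendsto_intros powr_square_mult_tendsto_0 entire_coeffs_intros) (auto simp: euler_op_def)
    then have "((\<lambda>x. 2 * (of_real (x powr (2 * \<nu>)) * bessel_E1 \<nu> (?Z x))) \<longlongrightarrow> 0) (at_right 0)"
      by (simp only: mult_zero_right)
    then show ?thesis
      by (rule Lim_transform_eventually)
        (use eventually_at_right_less[of 0] in eventually_elim, simp only: frobenius_boundary_form)
  qed
  have sing: "((\<lambda>x. ?X x * (of_real \<nu> * singular \<nu> z x - singular_quasi \<nu> z x)) \<longlongrightarrow> 1) (at_right 0)"
  proof (cases "\<nu> = 0")
    case True
    have "((\<lambda>x. - (2 * bessel_L1 (?Z x) - bessel_E 0 (?Z x) - 2 * (of_real (ln x) * bessel_E1 0 (?Z x)))) \<longlongrightarrow>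
        - (2 * euler_op bessel_log_coeff 0 - bessel_coeff 0 0 - 2 * 0)) (at_right 0)"
      by (intro tendsto_intros entire_series_square_tendsto ln_mult_entire_tendsto_0 entire_coeffs_intros)
        (auto simp: euler_op_def)
    then have "((\<lambda>x. - log_solution_quasi z x) \<longlongrightarrow> 1) (at_right 0)"
      by (simp add: euler_op_def log_solution_quasi_def)
    then show ?thesis
      by (rule Lim_transform_eventually)
        (use eventually_at_right_less[of 0] in eventually_elim, simp add: True singular_quasi_def)
  next
    case False
    have "((\<lambda>x. - (2 * of_real (- \<nu>) * bessel_E (- \<nu>) (?Z x) + 2 * bessel_E1 (- \<nu>) (?Z x)) / of_real (2 * \<nu>)) \<longlongrightarrow>
        - (2 * of_real (- \<nu>) * bessel_coeff (- \<nu>) 0 + 2 * euler_op (bessel_coeff (- \<nu>)) 0) / of_real (2 * \<nu>)) (at_right 0)"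
      using \<nu> False by (intro tendsto_intros entire_series_square_tendsto entire_coeffs_intros) auto
    moreover have "- (2 * of_real (- \<nu>) * bessel_coeff (- \<nu>) 0 + 2 * euler_op (bessel_coeff (- \<nu>)) 0) / of_real (2 * \<nu>) = 1"
      using False by (simp add: euler_op_def)
    ultimately have "((\<lambda>x. - (2 * of_real (- \<nu>) * bessel_E (- \<nu>) (?Z x) + 2 * bessel_E1 (- \<nu>) (?Z x)) / of_real (2 * \<nu>)) \<longlongrightarrow> 1) (at_right 0)"
      by (simp only:)
    then show ?thesis
    proof (rule Lim_transform_eventually)
      show "eventually (\<lambda>x. - (2 * of_real (- \<nu>) * bessel_E (- \<nu>) (?Z x) + 2 * bessel_E1 (- \<nu>) (?Z x)) / of_real (2 * \<nu>)
          = ?X x * (of_real \<nu> * singular \<nu> z x - singular_quasi \<nu> z x)) (at_right 0)"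
        using eventually_at_right_less[of 0]
      proof eventually_elim
        case (elim x)
        have "- (X * (q + - n * f)) / d = X * (n * (f / d) - q / d)" for X q n f d :: complex
          by (simp add: diff_divide_distrib algebra_simps)
        from this[of "?X x" "frobenius_quasi (- \<nu>) z x" "of_real \<nu>" "frobenius (- \<nu>) z x" "of_real (2 * \<nu>)"]
          frobenius_boundary_form(1)[OF elim, of "- \<nu>" z, symmetric]
        show ?case using False by (simp only: singular_def singular_quasi_def if_False minus_minus of_real_minus)
      qed
    qed
  qed
  have "((\<lambda>x. ?X x * (of_real \<nu> * singular \<nu> z x - singular_quasi \<nu> z x)
      - m * (?X x * (frobenius_quasi \<nu> z x - of_real \<nu> * frobenius \<nu> z x))) \<longlongrightarrow> 1 - m * 0) (at_right 0)"
    by (intro tendsto_intros sing reg)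
  then show "((\<lambda>x. weyl_sol \<nu> z m x * cnj (of_real \<nu> * of_real (x powr \<nu>)) - weyl_sol_quasi \<nu> z m x * cnj (of_real (x powr \<nu>))) \<longlongrightarrow> 1) (at_right 0)"
    by (simp add: weyl_sol_def weyl_sol_quasi_def algebra_simps)
qed

text \<open>
  In the same way \<open>\<Gamma>\<^sub>1\<close> annihilates \<open>singular \<nu> z\<close>. For \<open>\<nu> > 0\<close> this needs \<open>x powr (2 - 2 * \<nu>)\<close> to
  tend to 0.
\<close>

lemma Gamma_1_weyl_sol:
  assumes \<nu>: "0 \<le> \<nu>" "\<nu> < 1" and I: "bessel_interval I"
  shows "Gamma_1 \<nu> I (liouville (weyl_sol \<nu> z m)) = m"
proof (cases "\<nu> = 0")
  case True
  let ?Z = "\<lambda>x::real. z * of_real (x\<^sup>2)"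
  have eq: "(\<lambda>x. complex_of_real (x powr (1/2) * ln x)) = liouville (\<lambda>x. of_real (ln x))"
    by (simp add: fun_eq_iff liouville_def)
  have "bracket0 I (liouville (weyl_sol 0 z m)) (liouville (\<lambda>x. of_real (ln x))) = m"
  proof (rule bracket0_liouville[where R = "\<lambda>_. 1", OF I bessel_system_weyl_sol])
    show "((\<lambda>x. complex_of_real (ln x)) has_vector_derivative 1 / of_real x) (at x)" if "x > 0" for x
    proof -
      have "(ln has_real_derivative 1 / x) (at x)" using that by (auto intro!: derivative_eq_intros)
      from has_vector_derivative_of_real[OF this, where 'a = complex] show ?thesis by simp
    qed
    have "((\<lambda>x. (bessel_L (?Z x) - 2 * (of_real (ln x) * bessel_L1 (?Z x)) + 2 * (of_real (ln x) * (of_real (ln x) * bessel_E1 0 (?Z x))))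
        + m * (bessel_E 0 (?Z x) - 2 * (of_real (ln x) * bessel_E1 0 (?Z x)))) \<longlongrightarrow>
        (bessel_log_coeff 0 - 2 * 0 + 2 * 0) + m * (bessel_coeff 0 0 - 2 * 0)) (at_right 0)"
      by (intro tendsto_intros entire_series_square_tendsto ln_mult_entire_tendsto_0 entire_coeffs_intros)
        (auto simp: euler_op_def)
    then have "((\<lambda>x. (bessel_L (?Z x) - 2 * (of_real (ln x) * bessel_L1 (?Z x)) + 2 * (of_real (ln x) * (of_real (ln x) * bessel_E1 0 (?Z x))))
        + m * (bessel_E 0 (?Z x) - 2 * (of_real (ln x) * bessel_E1 0 (?Z x)))) \<longlongrightarrow> m) (at_right 0)"
      by simp
    then show "((\<lambda>x. weyl_sol 0 z m x * cnj 1 - weyl_sol_quasi 0 z m x * cnj (of_real (ln x))) \<longlongrightarrow> m) (at_right 0)"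
    proof (rule Lim_transform_eventually)
      show "eventually (\<lambda>x. (bessel_L (?Z x) - 2 * (of_real (ln x) * bessel_L1 (?Z x)) + 2 * (of_real (ln x) * (of_real (ln x) * bessel_E1 0 (?Z x))))
        + m * (bessel_E 0 (?Z x) - 2 * (of_real (ln x) * bessel_E1 0 (?Z x)))
         = weyl_sol 0 z m x * cnj 1 - weyl_sol_quasi 0 z m x * cnj (of_real (ln x))) (at_right 0)"
        using eventually_at_right_less[of 0]
      proof eventually_elim
        case (elim x)
        have "(L - 2 * (l * L1) + 2 * (l * (l * e1))) + m * (e - 2 * (l * e1))
          = ((L - l * e) + m * (1 * e)) * 1 - ((2 * L1 - e - 2 * (l * e1)) + m * (1 * (0 * e + 2 * e1))) * l" for L l L1 e e1 :: complex
          by (simp add: algebra_simps)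
        from this[of "bessel_L (?Z x)" "of_real (ln x)" "bessel_L1 (?Z x)" "bessel_E1 0 (?Z x)" "bessel_E 0 (?Z x)"]
        show ?case using elim
          by (simp only: weyl_sol_def weyl_sol_quasi_def singular_def singular_quasi_def log_solution_def log_solution_quasi_def
              frobenius_def frobenius_quasi_def if_True refl complex_cnj_complex_of_real complex_cnj_one powr_zero_eq_one of_real_0 of_real_1 if_False less_imp_neq[THEN not_sym])
      qed
    qed
  qed auto
  then show ?thesis using True by (simp only: Gamma_1_def eq if_True refl)
next
  case False
  let ?X = "\<lambda>x. complex_of_real (x powr (-\<nu>))" and ?Z = "\<lambda>x::real. z * of_real (x\<^sup>2)"
  have eq: "(\<lambda>x. complex_of_real (x powr (1/2 - \<nu>))) = liouville (\<lambda>x. of_real (x powr (-\<nu>)))"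
    using powr_as_liouville[of "-\<nu>"] by simp
  have "bracket0 I (liouville (weyl_sol \<nu> z m)) (liouville (\<lambda>x. of_real (x powr (-\<nu>)))) = - (2 * of_real \<nu>) * m"
  proof (rule bracket0_liouville[OF I bessel_system_weyl_sol[OF \<nu>] powr_vector_deriv])
    have "((\<lambda>x. 2 * of_real \<nu> * bessel_E \<nu> (?Z x) + 2 * bessel_E1 \<nu> (?Z x)) \<longlongrightarrow>
        2 * of_real \<nu> * bessel_coeff \<nu> 0 + 2 * euler_op (bessel_coeff \<nu>) 0) (at_right 0)"
      using \<nu> by (intro tendsto_intros entire_series_square_tendsto entire_coeffs_intros) auto
    then have "((\<lambda>x. 2 * of_real \<nu> * bessel_E \<nu> (?Z x) + 2 * bessel_E1 \<nu> (?Z x)) \<longlongrightarrow> 2 * of_real \<nu>) (at_right 0)"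
      by (simp add: euler_op_def)
    then have reg: "((\<lambda>x. ?X x * (frobenius_quasi \<nu> z x + of_real \<nu> * frobenius \<nu> z x)) \<longlongrightarrow> 2 * of_real \<nu>) (at_right 0)"
      by (rule Lim_transform_eventually)
        (use eventually_at_right_less[of 0] in eventually_elim, simp only: frobenius_boundary_form)
    have "((\<lambda>x. 2 * (of_real (x powr (2 * (-\<nu>))) * bessel_E1 (-\<nu>) (?Z x))) \<longlongrightarrow> 2 * 0) (at_right 0)"
      using \<nu> by (intro tendsto_intros powr_square_mult_tendsto_0 entire_coeffs_intros) (auto simp: euler_op_def)
    then have "((\<lambda>x. 2 * (of_real (x powr (2 * (-\<nu>))) * bessel_E1 (-\<nu>) (?Z x))) \<longlongrightarrow> 0) (at_right 0)"
      by (simp only: mult_zero_right)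
    then have "((\<lambda>x. ?X x * (frobenius_quasi (-\<nu>) z x - of_real (-\<nu>) * frobenius (-\<nu>) z x)) \<longlongrightarrow> 0) (at_right 0)"
      by (rule Lim_transform_eventually)
        (use eventually_at_right_less[of 0] in eventually_elim, simp only: frobenius_boundary_form)
    then have sing: "((\<lambda>x. ?X x * (frobenius_quasi (-\<nu>) z x - of_real (-\<nu>) * frobenius (-\<nu>) z x) / of_real (2 * \<nu>)) \<longlongrightarrow> 0 / of_real (2 * \<nu>)) (at_right 0)"
      using False by (intro tendsto_intros) auto
    have "((\<lambda>x. - (?X x * (frobenius_quasi (-\<nu>) z x - of_real (-\<nu>) * frobenius (-\<nu>) z x) / of_real (2 * \<nu>))
        - m * (?X x * (frobenius_quasi \<nu> z x + of_real \<nu> * frobenius \<nu> z x))) \<longlongrightarrow> - (0 / of_real (2 * \<nu>)) - m * (2 * of_real \<nu>)) (at_right 0)"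
      by (intro tendsto_intros sing reg)
    moreover have "- (X * (q - - n * f) / d) - m * (X * (q' + n * f'))
        = (f / d + m * f') * (- n * X) - (q / d + m * q') * X" for X q n f d q' f' :: complex
      by (simp add: diff_divide_distrib add_divide_distrib algebra_simps)
    ultimately show "((\<lambda>x. weyl_sol \<nu> z m x * cnj (of_real (- \<nu>) * of_real (x powr (- \<nu>))) - weyl_sol_quasi \<nu> z m x * cnj (of_real (x powr (- \<nu>)))) \<longlongrightarrow> - (2 * of_real \<nu>) * m) (at_right 0)"
      using False
      by (simp only: weyl_sol_def weyl_sol_quasi_def singular_def singular_quasi_def if_False of_real_minus
          complex_cnj_mult complex_cnj_minus complex_cnj_complex_of_real) (simp add: mult.commute)
  qed
  then show ?thesis using False by (simp add: Gamma_1_def eq)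
qed

section \<open>Weyl functions of boundary triplets\<close>

text \<open>
  Let \<open>g\<close> be the difference of two elements of the kernel of \<open>A\<^sup>* - z\<close> with the same value of \<open>G0\<close>.
  Green's identity for \<open>g\<close> and itself gives \<open>(z - cnj z) * L2_inner I g g = 0\<close>, so \<open>g = 0\<close> almost
  everywhere. Green's identity for \<open>g\<close> and an element on which \<open>G0\<close> is 1 then gives \<open>G1 g = 0\<close>.
\<close>

lemma weyl_function_eqI:
  assumes bt: "boundary_triplet I A G0 G1" and z: "Im z \<noteq> 0"
    and \<phi>: "\<phi> \<in> defect_space I A z" "G0 \<phi> = 1"
  shows "weyl_function I A G0 G1 z = G1 \<phi>"
proof -
  have A: "A \<subseteq> L2_space I \<times> L2_space I"
    using bt by (simp add: boundary_triplet_def linear_operator_def)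
  have lin: "G0 (\<lambda>x. a * f x + c * g x) = a * G0 f + c * G0 g"
    "G1 (\<lambda>x. a * f x + c * g x) = a * G1 f + c * G1 g"
    if "f \<in> Domain (adjoint_graph I A)" "g \<in> Domain (adjoint_graph I A)" for f g a c
    using bt that unfolding boundary_triplet_def by blast+
  have green: "L2_inner I h g - L2_inner I f k = G1 f * cnj (G0 g) - G0 f * cnj (G1 g)"
    if "(f, h) \<in> adjoint_graph I A" "(g, k) \<in> adjoint_graph I A" for f h g k
    using bt that unfolding boundary_triplet_def by blast
  have surj: "\<exists>f\<in>Domain (adjoint_graph I A). G0 f = a \<and> G1 f = c" for a c
    using bt unfolding boundary_triplet_def by blast
  define f where "f = inv_into (defect_space I A z) G0 1"
  have "1 \<in> G0 ` defect_space I A z" using \<phi> by (metis image_eqI)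
  then have f: "f \<in> defect_space I A z" "G0 f = 1"
    unfolding f_def by (rule inv_into_into, rule f_inv_into_f)
  \<comment> \<open>The coefficients are written out to match the linearity of the boundary maps.\<close>
  let ?g = "\<lambda>x. 1 * f x + (- 1) * \<phi> x"
  have fa: "(f, \<lambda>x. z * f x) \<in> adjoint_graph I A" "(\<phi>, \<lambda>x. z * \<phi> x) \<in> adjoint_graph I A"
    using f(1) \<phi>(1) by (simp_all add: defect_space_def)
  then have L2: "f \<in> L2_space I" "(\<lambda>x. z * f x) \<in> L2_space I" "\<phi> \<in> L2_space I" "(\<lambda>x. z * \<phi> x) \<in> L2_space I"
    and adj: "\<And>q h. (q, h) \<in> A \<Longrightarrow> L2_inner I h f = L2_inner I q (\<lambda>x. z * f x)"
      "\<And>q h. (q, h) \<in> A \<Longrightarrow> L2_inner I h \<phi> = L2_inner I q (\<lambda>x. z * \<phi> x)"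
    unfolding adjoint_graph_def by blast+
  have dom: "f \<in> Domain (adjoint_graph I A)" "\<phi> \<in> Domain (adjoint_graph I A)" using fa by blast+
  have g: "?g \<in> L2_space I" by (intro L2_space_lincomb L2)
  have zg: "(\<lambda>x. z * ?g x) = (\<lambda>x. 1 * (z * f x) + (- 1) * (z * \<phi> x))"
    by (simp add: fun_eq_iff algebra_simps)
  have zg2: "(\<lambda>x. z * ?g x) \<in> L2_space I" unfolding zg by (intro L2_space_lincomb L2)
  have ga: "(?g, \<lambda>x. z * ?g x) \<in> adjoint_graph I A"
  proof -
    have "L2_inner I h ?g = L2_inner I q (\<lambda>x. z * ?g x)" if qh: "(q, h) \<in> A" for q h
    proof -
      have "q \<in> L2_space I" "h \<in> L2_space I" using A qh by auto
      then show ?thesis unfolding zg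
        by (simp only: L2_inner_lincomb_right L2 adj(1)[OF qh] adj(2)[OF qh])
    qed
    then show ?thesis unfolding adjoint_graph_def using g zg2 by blast
  qed
  have G0g: "G0 ?g = 0" using lin(1)[OF dom, of 1 "-1"] f(2) \<phi>(2) by simp
  have "L2_inner I (\<lambda>x. z * ?g x) ?g - L2_inner I ?g (\<lambda>x. z * ?g x) = 0"
    using green[OF ga ga] G0g by simp
  moreover have "L2_inner I (\<lambda>x. z * ?g x) ?g = z * L2_inner I ?g ?g"
    unfolding L2_inner_def by (simp only: mult.assoc Bochner_Integration.integral_mult_right_zero)
  moreover have "L2_inner I ?g (\<lambda>x. z * ?g x) = cnj z * L2_inner I ?g ?g"
    unfolding L2_inner_def by (simp only: complex_cnj_mult mult.left_commute Bochner_Integration.integral_mult_right_zero)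
  ultimately have "(z - cnj z) * L2_inner I ?g ?g = 0" by (simp only: left_diff_distrib)
  moreover have "z - cnj z \<noteq> 0" using z by (simp add: complex_eq_iff)
  ultimately have "L2_inner I ?g ?g = 0" by (simp only: mult_eq_0_iff) blast
  moreover have "L2_inner I ?g ?g = complex_of_real (integral\<^sup>L (lebesgue_on I) (\<lambda>x. (cmod (?g x))\<^sup>2))"
    unfolding L2_inner_def complex_norm_square[symmetric] by (rule integral_complex_of_real)
  ultimately have "integral\<^sup>L (lebesgue_on I) (\<lambda>x. (cmod (?g x))\<^sup>2) = 0" by (simp only: of_real_eq_0_iff)
  moreover have "integrable (lebesgue_on I) (\<lambda>x. (cmod (?g x))\<^sup>2)"
    using g unfolding L2_space_def by blast
  ultimately have "AE x in lebesgue_on I. (cmod (?g x))\<^sup>2 = 0"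
    by (subst (asm) integral_nonneg_eq_0_iff_AE) auto
  then have g0: "AE x in lebesgue_on I. ?g x = 0" by eventually_elim simp
  obtain h where h: "h \<in> Domain (adjoint_graph I A)" "G0 h = 1" "G1 h = 0" using surj by blast
  then obtain k where hk: "(h, k) \<in> adjoint_graph I A" by blast
  have "L2_inner I (\<lambda>x. z * ?g x) h = 0" "L2_inner I ?g k = 0"
    unfolding L2_inner_def by (rule integral_eq_zero_AE, use g0 in eventually_elim, simp)+
  then have "G1 ?g = 0" using green[OF ga hk] h G0g by simp
  then have "G1 f = G1 \<phi>" using lin(2)[OF dom, of 1 "-1"] by simp
  then show ?thesis by (simp add: weyl_function_def f_def)
qed

section \<open>The Weyl functions and their convergence\<close>

lemma weyl_function_fin:
  assumes \<nu>: "0 \<le> \<nu>" "\<nu> < 1" and b: "b > 0" and z: "Im z > 0"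
    and bt: "boundary_triplet {0<..<b} (bessel_operator_fin \<nu> b) (Gamma_0 \<nu> {0<..<b}) (Gamma_1 \<nu> {0<..<b})"
  shows "weyl_function {0<..<b} (bessel_operator_fin \<nu> b) (Gamma_0 \<nu> {0<..<b}) (Gamma_1 \<nu> {0<..<b}) z
    = weyl_quot \<nu> b z"
proof -
  let ?m = "weyl_quot \<nu> b z" and ?s = "csqrt (- z)"
  let ?\<phi> = "liouville (weyl_sol \<nu> z ?m)"
  have I: "bessel_interval {0<..<b}" using b by (auto simp: bessel_interval_def)
  have s: "?s\<^sup>2 = - z" "Re ?s > 0"
    using csqrt_minus_Re_pos[OF upper_half_plane_subset[OF z]] by (auto simp del: csqrt.simps)
  have "?\<phi> \<in> defect_space {0<..<b} (bessel_operator_fin \<nu> b) z"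
    by (rule liouville_in_defect_space_fin[OF bessel_system_weyl_sol[OF \<nu>] subcritical_weyl_sol[OF \<nu>] b
          weyl_sol_at_endpoint[OF \<nu>(1) s b]])
  from weyl_function_eqI[OF bt _ this Gamma_0_weyl_sol[OF \<nu> I]] z show ?thesis
    by (simp add: Gamma_1_weyl_sol[OF \<nu> I])
qed

text \<open>
  The inequality of \<open>weyl_sol_energy_nonpos\<close> at a fixed \<open>x\<close> passes to the limit.
\<close>

lemma weyl_limit_energy_nonpos:
  assumes \<nu>: "0 \<le> \<nu>" "\<nu> < 1" and z: "z \<notin> \<real>\<^sub>\<ge>\<^sub>0" and s: "s\<^sup>2 = - z" "Re s > 0" and x: "x > 0"
  shows "energy s (weyl_sol \<nu> z (weyl_limit \<nu> z)) (weyl_sol_quasi \<nu> z (weyl_limit \<nu> z)) x \<le> 0"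
proof -
  have "((\<lambda>b. energy s (weyl_sol \<nu> z (weyl_quot \<nu> b z)) (weyl_sol_quasi \<nu> z (weyl_quot \<nu> b z)) x) \<longlongrightarrow>
      energy s (weyl_sol \<nu> z (weyl_limit \<nu> z)) (weyl_sol_quasi \<nu> z (weyl_limit \<nu> z)) x) at_top"
    unfolding energy_def weyl_sol_def weyl_sol_quasi_def
    by (intro tendsto_intros weyl_quot_tendsto \<nu> z)
  moreover have "eventually (\<lambda>b. energy s (weyl_sol \<nu> z (weyl_quot \<nu> b z)) (weyl_sol_quasi \<nu> z (weyl_quot \<nu> b z)) x \<le> 0) at_top"
    using eventually_ge_at_top[of x] by eventually_elim (rule weyl_sol_energy_nonpos[OF \<nu> s x])
  ultimately show ?thesis by (rule tendsto_upperbound) simp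
qed

lemma weyl_function_inf:
  assumes \<nu>: "0 \<le> \<nu>" "\<nu> < 1" and z: "Im z > 0"
    and bt: "boundary_triplet {0<..} (bessel_operator_inf \<nu>) (Gamma_0 \<nu> {0<..}) (Gamma_1 \<nu> {0<..})"
  shows "weyl_function {0<..} (bessel_operator_inf \<nu>) (Gamma_0 \<nu> {0<..}) (Gamma_1 \<nu> {0<..}) z
    = weyl_limit \<nu> z"
proof -
  let ?m = "weyl_limit \<nu> z" and ?s = "csqrt (- z)"
  let ?\<phi> = "liouville (weyl_sol \<nu> z ?m)"
  have I: "bessel_interval {0<..}" by (auto simp: bessel_interval_def)
  note z' = upper_half_plane_subset[OF z]
  have s: "?s\<^sup>2 = - z" "Re ?s > 0" using csqrt_minus_Re_pos[OF z'] by (auto simp del: csqrt.simps)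
  have "?\<phi> \<in> defect_space {0<..} (bessel_operator_inf \<nu>) z"
    by (rule liouville_in_defect_space_inf[OF bessel_system_weyl_sol[OF \<nu>] subcritical_weyl_sol[OF \<nu>] s
          weyl_limit_energy_nonpos[OF \<nu> z' s]])
  from weyl_function_eqI[OF bt _ this Gamma_0_weyl_sol[OF \<nu> I]] z show ?thesis
    by (simp add: Gamma_1_weyl_sol[OF \<nu> I])
qed

theorem proposition6p1:
  fixes \<nu> :: real
  assumes "0 \<le> \<nu>" and "\<nu> < 1"
  shows
    "(\<forall>b>0. boundary_triplet {0<..<b} (bessel_operator_fin \<nu> b)
               (Gamma_0 \<nu> {0<..<b}) (Gamma_1 \<nu> {0<..<b}) \<longrightarrow>
        (\<forall>z. Im z > 0 \<longrightarrow>
           weyl_function {0<..<b} (bessel_operator_fin \<nu> b)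
             (Gamma_0 \<nu> {0<..<b}) (Gamma_1 \<nu> {0<..<b}) z = M_fin \<nu> b z)) \<and>
     (boundary_triplet {0<..} (bessel_operator_inf \<nu>) (Gamma_0 \<nu> {0<..}) (Gamma_1 \<nu> {0<..}) \<longrightarrow>
        (\<forall>z. Im z > 0 \<longrightarrow>
           weyl_function {0<..} (bessel_operator_inf \<nu>)
             (Gamma_0 \<nu> {0<..}) (Gamma_1 \<nu> {0<..}) z = M_inf \<nu> z)) \<and>
     (\<forall>K. compact K \<and> K \<subseteq> {z. Im z > 0} \<longrightarrow>
        uniform_limit K (M_fin \<nu>) (M_inf \<nu>) at_top)"
proof (intro conjI allI impI)
  fix b z assume "b > 0" "Im z > 0"
    "boundary_triplet {0<..<b} (bessel_operator_fin \<nu> b) (Gamma_0 \<nu> {0<..<b}) (Gamma_1 \<nu> {0<..<b})"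
  then show "weyl_function {0<..<b} (bessel_operator_fin \<nu> b)
             (Gamma_0 \<nu> {0<..<b}) (Gamma_1 \<nu> {0<..<b}) z = M_fin \<nu> b z"
    by (simp only: weyl_function_fin[OF assms] M_fin_eq_weyl_quot[OF assms])
next
  fix z assume "Im z > 0"
    "boundary_triplet {0<..} (bessel_operator_inf \<nu>) (Gamma_0 \<nu> {0<..}) (Gamma_1 \<nu> {0<..})"
  then show "weyl_function {0<..} (bessel_operator_inf \<nu>)
             (Gamma_0 \<nu> {0<..}) (Gamma_1 \<nu> {0<..}) z = M_inf \<nu> z"
    by (simp only: weyl_function_inf[OF assms] M_inf_eq_weyl_limit[OF assms])
next
  fix K assume K: "compact K \<and> K \<subseteq> {z. Im z > 0}"
  then have "K \<subseteq> - \<real>\<^sub>\<ge>\<^sub>0" using upper_half_plane_subset by blast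
  then have lim: "uniform_limit K (weyl_quot \<nu>) (weyl_limit \<nu>) at_top"
    using K weyl_quot_uniform_limit[OF assms] by blast
  have fin: "eventually (\<lambda>b. \<forall>z\<in>K. weyl_quot \<nu> b z = M_fin \<nu> b z) at_top"
    using eventually_gt_at_top[of 0]
  proof eventually_elim
    case (elim b)
    show ?case
    proof
      fix z assume "z \<in> K"
      then have "Im z > 0" using K by blast
      then show "weyl_quot \<nu> b z = M_fin \<nu> b z" by (rule M_fin_eq_weyl_quot[OF assms _ elim, symmetric])
    qed
  qed
  have inf: "weyl_limit \<nu> z = M_inf \<nu> z" if "z \<in> K" for z
  proof -
    have "Im z > 0" using K that by blast
    then show ?thesis by (rule M_inf_eq_weyl_limit[OF assms, symmetric])
  qed
  show "uniform_limit K (M_fin \<nu>) (M_inf \<nu>) at_top"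
  proof -
    have "uniform_limit K (weyl_quot \<nu>) (weyl_limit \<nu>) at_top \<longleftrightarrow> uniform_limit K (M_fin \<nu>) (M_inf \<nu>) at_top"
      by (rule uniform_limit_cong[OF fin inf])
    then show ?thesis using lim by (rule iffD1)
  qed
qed

end
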